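(* Let $X$ be a linear diffusion on $\mathcal I=(\alpha,\beta)$ as described in the context, and fix $x\in\mathcal I$. Assume (Case (III)): $-\infty<\alpha<\beta<\infty$ and both end points are attractive (i.e. $S(\alpha)=0$ and $S(\beta)<\infty$). Then $V(x)<\infty$. Furthermore: (I) Assume that $\mathbb E_x\{X_{\tau_{(\alpha,\beta)}}\}\le\frac12(\beta+\alpha)$. Then the following statements hold. (I.A) There exist $a^*\in[\alpha,x]$ and $b^*,z^*\in[x,\beta)$ such that $\tau^*=\xi_{p^*}\tau_{(a^*,b^* )}+(1-\xi_{p^*})\tau_{(\alpha,z^* )}$ is an optimal stopping time, where $\xi_{p^*}$ is a Bernoulli random variable with a parameter $p^*\in[0,1]$. (I.B) Assume in addition the following: for each $c\in\mathcal I$ let $Z(c)$ denote the set of $z$ maximizing the ratio $\frac{z^2-\alpha^2-2c(z-\alpha)}{S(z)}$; for each $c\in\mathcal I$ for which $Z(c)$ has more than one element, $\mathbb E_{\hat z_i}\{X_{\tau_{(\alpha,\hat z_s)}}\}>c$, where $\hat z_i=\inf Z(c)$ and $\hat z_s=\sup Z(c)$. Then there exist $z_1^*,z_2^*\in[x,\beta)$ such that $\tau^*=\xi_{p^*}\tau_{(\alpha,z_1^* )}+(1-\xi_{p^*})\tau_{(\alpha,z_2^* )}$ is an optimal stopping time, where $\xi_{p^*}$ is a Bernoulli random variable with a parameter $p^*\in[0,1]$. (I.C) Assume in addition to the hypotheses of (I) that $S$ is differentiable and $\frac{S'(z)}{S(z)}(z-\alpha)$ is non-decreasing. Then $\tau_{(\alpha,z^*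 )}$ is an optimal stopping time, where $z^*=z^*(x)$ is either the unique solution on $(x,\beta)$ to $$\frac{S(z)-S(x)}{\frac12 S(z)-S(x)}=\frac{S'(z)}{S(z)}(z-\alpha),$$ or, if the root does not exist, $z^*=\beta$. Furthermore, $V(x)=(z^*-\alpha)^2\frac{S(x)}{S(z^* )}\left(1-\frac{S(x)}{S(z^* )}\right)$. (II) Assume that $\mathbb E_x\{X_{\tau_{(\alpha,\beta)}}\}>\frac12(\beta+\alpha)$. Then the following statements hold. (II.A) There exist $a^*,y^*\in(\alpha,x]$ and $b^*\in[x,\beta]$ such that $\tau^*=\xi_{p^*}\tau_{(y^*,\beta)}+(1-\xi_{p^*})\tau_{(a^*,b^* )}$ is an optimal stopping time, where $\xi_{p^*}$ is a Bernoulli random variable with a parameter $p^*\in[0,1]$. (II.B) Assume in addition the following: for each $c\in\mathcal I$ let $Y(c)$ denote the set of $y$ maximizing the ratio $\frac{y^2-\beta^2-2c(y-\beta)}{S(\beta)-S(y)}$; for each $c\in\mathcal I$ for which $Y(c)$ has more than one element, $\mathbb E_{\hat y_s}\{X_{\tau_{(\hat y_i,\beta)}}\}>c$, where $\hat y_i=\inf Y(c)$ and $\hat y_s=\sup Y(c)$. Then there exist $y_1^*,y_2^*\in(\alpha,x]$ such that $\tau^*=\xi_{p^*}\tau_{(y_1^*,\beta)}+(1-\xi_{p^*})\tau_{(y_2^*,\beta)}$ is an optimal stopping time, where $\xi_{p^*}$ is a Bernoulli random variable with a parameter $p^*\in[0,1]$. (II.C) Assume in addition to the hypotheses of (II) that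 $S$ is differentiable and $\frac{S'(y)}{S(\beta)-S(y)}(\beta-y)$ is non-increasing. Then $\tau_{(y^*,\beta)}$ is an optimal stopping time, where $y^*=y^*(x)$ is either the unique solution on $(\alpha,x)$ to $$\frac{S(x)-S(y)}{S(x)-\frac12S(y)-\frac12S(\beta)}=\frac{S'(y)}{S(\beta)-S(y)}(\beta-y),$$ or, if the root does not exist, $y^*=\alpha$. Furthermore, $V(x)=(\beta-y^* )^2\,\frac{S(\beta)-S(x)}{S(\beta)-S(y^* )}\left(\frac{S(x)-S(y^* )}{S(\beta)-S(y^* )}\right)$.
   Context: Setting. $X=(X_t)_{t\ge 0}$ is a regular linear diffusion on a filtered probability space $(\Omega,\mathcal F,\mathbb F,\mathbb P)$, where $\mathbb F$ is the filtration generated by $X$; it evolves on an interval $\mathcal I=(\alpha,\beta)\subseteq\mathbb R$, and $\mathbb P_x,\mathbb E_x,\mathrm{Var}_x$ refer to $X_0=x$. The boundaries may be natural, exit, entrance or killing (killing end points belong to $\mathcal I$); absorbing boundaries are also allowed. On the interior of $\mathcal I$ the diffusion is regular (from any interior point it hits any other interior point with positive probability), it does not die inside the state space, and its scale function $S$ and speed measure $m$ are continuous. $S$ is increasing and continuous and $\mathbb P_x(\tau_b<\tau_a)=\frac{S(x)-S(a)}{S(b)-S(a)}$ for $\alpha<a<x<b<\beta$. Boundary values of $S$ are limits; $S$ is normalized so that $S(\alpha)=0$ or $S(\alpha)=-\infty$. The boundary $\alpha$ (resp. $\beta$) is attractive if $\lim_{t\to\infty}X_t=\alpha$ (resp. $\beta$)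 with positive probability; finiteness of $S$ at a boundary means that this boundary is attractive. Stopping times may take the value $\infty$; with $\zeta=\inf\{t\ge0: X_t=\alpha\text{ or }\beta\}$ one sets $X_\infty:=\limsup_{t\to\zeta}X_t$. Notation: $\tau_z=\inf\{t\ge0:X_t=z\}$, $\tau_{(z,y)}=\inf\{t\ge0:X_t\notin(z,y)\}$, $\tau_{(\alpha,z)}=\lim_{a\to\alpha}\tau_{(a,z)}$, $\tau_{(z,\beta)}=\lim_{b\to\beta}\tau_{(z,b)}$. Randomized stopping times: let $U$ be uniform on $[0,1]$ and independent of $X$ (enlarging the probability space if necessary); $\mathcal T$ is the class of all stopping times of the filtration $\hat{\mathbb F}_t=\sigma\{U,(X_s)_{0\le s\le t}\}$. $\xi_p$ denotes a Bernoulli variable independent of $X$ with $\mathbb P(\xi_p=1)=p=1-\mathbb P(\xi_p=0)$ (e.g. $\xi_p=\mathbf 1_{\{U<p\}}$), so $\xi_p\tau_1+(1-\xi_p)\tau_2$ means that $\tau_1$ is used if $\xi_p=1$ and $\tau_2$ if $\xi_p=0$. Variance problem: $V(x)=\sup_{\tau\in\mathcal T}\mathrm{Var}_x\{X_\tau\}$; $\tau^*\in\mathcal T$ is optimal if $V(x)=\mathrm{Var}_x\{X_{\tau^*}\}$.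
   Formalization: The thresholds in (I.A), (I.B), (II.A), (II.B) range over the closed intervals [x,β] and [α,x], since the printed half-open ones fail for Brownian motion; the inequality in (II.B) is "< c" instead of "> c"; Z(c), Y(c) are maximizers over (α,β] and [α,β). *)

theory Defs
  imports "HOL-Probability.Probability"
begin

section \<open>Path functionals\<close>

text \<open>A process is a function \<open>X :: real \<Rightarrow> 'a \<Rightarrow> real\<close> of which only the times \<open>t \<ge> 0\<close> matter.
  Random times take values in \<^typ>\<open>ennreal\<close>; since \<open>Inf {} = \<top>\<close> there, a hitting time is
  infinite on paths that never hit.\<close>

definition hitting_time :: "(real \<Rightarrow> 'a \<Rightarrow> real) \<Rightarrow> real \<Rightarrow> 'a \<Rightarrow> ennreal" where
  "hitting_time X z \<omega> = (INF t\<in>{t. 0 \<le> t \<and> X t \<omega> = z}. ennreal t)"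

definition exit_time :: "(real \<Rightarrow> 'a \<Rightarrow> real) \<Rightarrow> real \<Rightarrow> real \<Rightarrow> 'a \<Rightarrow> ennreal" where
  "exit_time X z y \<omega> = (INF t\<in>{t. 0 \<le> t \<and> X t \<omega> \<notin> {z<..<y}}. ennreal t)"

text \<open>For a continuous path the exit times depend continuously on the end points of the interval
  when these are approached from inside. In particular \<open>exit_time X \<alpha> z\<close> and \<open>exit_time X z \<beta>\<close>, for
  the boundaries \<open>\<alpha>\<close> and \<open>\<beta>\<close> of the state space, are the limits by which exit times from
  \<open>(\<alpha>, z)\<close> and \<open>(z, \<beta>)\<close> are usually defined.\<close>

lemma less_exit_time:
  assumes cont: "continuous_on {0..} (\<lambda>t. X t \<omega>)" and r: "0 \<le> r"
    and in': "\<And>t. 0 \<le> t \<Longrightarrow> t \<le> r \<Longrightarrow> X t \<omega> \<in> {z<..<y}"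
  shows "ennreal r < exit_time X z y \<omega>"
proof -
  have "((\<lambda>t. X t \<omega>) \<longlongrightarrow> X r \<omega>) (at r within {0..})"
    using cont r by (auto simp: continuous_on)
  then have "\<forall>\<^sub>F t in at r within {0..}. X t \<omega> \<in> {z<..<y}"
    by (rule topological_tendstoD) (use in' r in auto)
  then obtain d where d: "d > 0" "\<And>t. 0 \<le> t \<Longrightarrow> dist t r < d \<Longrightarrow> t \<noteq> r \<Longrightarrow> X t \<omega> \<in> {z<..<y}"
    unfolding eventually_at by auto
  have "r + d \<le> t" if "0 \<le> t" "X t \<omega> \<notin> {z<..<y}" for t
  proof (rule ccontr)
    assume *: "\<not> r + d \<le> t"
    with that in'[of t] have "r < t" by force
    with d(2)[of t] * that show False by (auto simp: dist_real_def)
  qed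
  then have "ennreal (r + d) \<le> exit_time X z y \<omega>"
    unfolding exit_time_def by (intro INF_greatest ennreal_leI) auto
  moreover have "ennreal r < ennreal (r + d)"
    using d r by (intro ennreal_lessI) auto
  ultimately show ?thesis by simp
qed

lemma exit_time_tendsto_aux:
  fixes l u :: "real \<Rightarrow> real"
  assumes cont: "continuous_on {0..} (\<lambda>t. X t \<omega>)"
    and lim: "(l \<longlongrightarrow> z) F" "(u \<longlongrightarrow> y) F"
    and ins: "\<forall>\<^sub>F a in F. z \<le> l a \<and> u a \<le> y"
  shows "((\<lambda>a. exit_time X (l a) (u a) \<omega>) \<longlongrightarrow> exit_time X z y \<omega>) F"
proof (rule order_tendstoI)
  fix e assume e: "e < exit_time X z y \<omega>"
  then have "e \<noteq> \<top>" by auto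
  then obtain r where r: "e = ennreal r" "0 \<le> r" by (cases e) auto
  have stay: "X t \<omega> \<in> {z<..<y}" if "0 \<le> t" "t \<le> r" for t
  proof (rule ccontr)
    assume "X t \<omega> \<notin> {z<..<y}"
    then have "exit_time X z y \<omega> \<le> ennreal t"
      unfolding exit_time_def using that by (intro INF_lower) auto
    also have "\<dots> \<le> e" unfolding r(1) using that by (intro ennreal_leI) auto
    finally show False using e by simp
  qed
  have cr: "continuous_on {0..r} (\<lambda>t. X t \<omega>)"
    using cont by (rule continuous_on_subset) auto
  obtain t1 where t1: "t1 \<in> {0..r}" "\<And>t. t \<in> {0..r} \<Longrightarrow> X t1 \<omega> \<le> X t \<omega>"
    using continuous_attains_inf[OF compact_Icc _ cr] r by auto
  obtain t2 where t2: "t2 \<in> {0..r}" "\<And>t. t \<in> {0..r} \<Longrightarrow> X t \<omega> \<le> X t2 \<omega>"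
    using continuous_attains_sup[OF compact_Icc _ cr] r by auto
  have "\<forall>\<^sub>F a in F. l a < X t1 \<omega>" "\<forall>\<^sub>F a in F. X t2 \<omega> < u a"
    using order_tendstoD(2)[OF lim(1)] order_tendstoD(1)[OF lim(2)] stay t1(1) t2(1) by auto
  then show "\<forall>\<^sub>F a in F. e < exit_time X (l a) (u a) \<omega>"
  proof eventually_elim
    case (elim a)
    have "X t \<omega> \<in> {l a<..<u a}" if "0 \<le> t" "t \<le> r" for t
      using t1(2)[of t] t2(2)[of t] elim that by auto
    then show ?case
      unfolding r(1) by (intro less_exit_time cont r(2))
  qed
next
  fix e assume e: "exit_time X z y \<omega> < e"
  from ins show "\<forall>\<^sub>F a in F. exit_time X (l a) (u a) \<omega> < e"
  proof eventually_elim
    case (elim a)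
    have "exit_time X (l a) (u a) \<omega> \<le> exit_time X z y \<omega>"
      unfolding exit_time_def using elim by (intro INF_superset_mono) auto
    with e show ?case by simp
  qed
qed

lemma exit_time_tendsto_left:
  assumes "continuous_on {0..} (\<lambda>t. X t \<omega>)"
  shows "((\<lambda>a. exit_time X a z \<omega>) \<longlongrightarrow> exit_time X \<alpha> z \<omega>) (at_right \<alpha>)"
  by (rule exit_time_tendsto_aux[where X = X and \<omega> = \<omega>, OF assms]) (auto simp: eventually_at_filter)

lemma exit_time_tendsto_right:
  assumes "continuous_on {0..} (\<lambda>t. X t \<omega>)"
  shows "((\<lambda>b. exit_time X z b \<omega>) \<longlongrightarrow> exit_time X z \<beta> \<omega>) (at_left \<beta>)"
  by (rule exit_time_tendsto_aux[where X = X and \<omega> = \<omega>, OF assms]) (auto simp: eventually_at_filter)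

definition boundary_time :: "real \<Rightarrow> real \<Rightarrow> (real \<Rightarrow> 'a \<Rightarrow> real) \<Rightarrow> 'a \<Rightarrow> ennreal" where
  "boundary_time \<alpha> \<beta> X \<omega> = (INF t\<in>{t. 0 \<le> t \<and> (X t \<omega> = \<alpha> \<or> X t \<omega> = \<beta>)}. ennreal t)"

text \<open>The value at time \<open>\<infinity>\<close> is the upper limit of the path at the boundary time \<open>\<zeta>\<close>, taken over
  times \<open>0 \<le> t < \<zeta>\<close>. The detour through \<^typ>\<open>ereal\<close> is harmless for a bounded path.\<close>

definition X_infinity :: "real \<Rightarrow> real \<Rightarrow> (real \<Rightarrow> 'a \<Rightarrow> real) \<Rightarrow> 'a \<Rightarrow> real" where
  "X_infinity \<alpha> \<beta> X \<omega> =
    (let \<zeta> = boundary_time \<alpha> \<beta> X \<omega> in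
     real_of_ereal (Limsup (if \<zeta> = \<top> then at_top else at (enn2real \<zeta>) within {0..<enn2real \<zeta>})
       (\<lambda>t. ereal (X t \<omega>))))"

definition value_at :: "real \<Rightarrow> real \<Rightarrow> (real \<Rightarrow> 'a \<Rightarrow> real) \<Rightarrow> ('a \<Rightarrow> ennreal) \<Rightarrow> 'a \<Rightarrow> real" where
  "value_at \<alpha> \<beta> X \<tau> \<omega> =
    (if \<tau> \<omega> = \<top> then X_infinity \<alpha> \<beta> X \<omega> else X (enn2real (\<tau> \<omega>)) \<omega>)"

section \<open>Linear diffusions\<close>

definition natural_filtration :: "'a set \<Rightarrow> (real \<Rightarrow> 'a \<Rightarrow> real) \<Rightarrow> ennreal \<Rightarrow> 'a measure" where
  "natural_filtration \<Omega> X t =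
    sigma \<Omega> {X s -` B \<inter> \<Omega> | s B. 0 \<le> s \<and> ennreal s \<le> t \<and> B \<in> sets borel}"

definition randomized_filtration ::
    "'a set \<Rightarrow> ('a \<Rightarrow> real) \<Rightarrow> (real \<Rightarrow> 'a \<Rightarrow> real) \<Rightarrow> ennreal \<Rightarrow> 'a measure" where
  "randomized_filtration \<Omega> U X t =
    sigma \<Omega> ({U -` B \<inter> \<Omega> | B. B \<in> sets borel} \<union>
             {X s -` B \<inter> \<Omega> | s B. 0 \<le> s \<and> ennreal s \<le> t \<and> B \<in> sets borel})"

definition path_from :: "(real \<Rightarrow> 'a \<Rightarrow> real) \<Rightarrow> real \<Rightarrow> 'a \<Rightarrow> real \<Rightarrow> real" where
  "path_from X s \<omega> = (\<lambda>t\<in>{0..}. X (s + t) \<omega>)"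

abbreviation path_space :: "(real \<Rightarrow> real) measure" where
  "path_space \<equiv> (\<Pi>\<^sub>M t\<in>{0..}. borel)"

text \<open>A regular diffusion on \<open>(\<alpha>, \<beta>)\<close> with scale function \<open>S\<close> and speed measure \<open>m\<close>; \<open>P y\<close> is the
  law of the process started at \<open>y\<close>. The process does not die inside \<open>(\<alpha>, \<beta>)\<close>. A boundary point need
  not be attainable; if it is attained, the path is continued by this boundary value. This covers
  absorbing and exit boundaries, and killing ones as well, because for the latter the value of the
  process from its lifetime on is, by convention, its last position. Reflection is excluded. In the
  strong Markov property the future is described on the event that the process is still in the
  interior, since the laws \<open>P \<alpha>\<close> and \<open>P \<beta>\<close> play no role. The speed measure is normalized so that the
  generator is \<open>d/dm d/dS\<close>; for Brownian motion with \<open>S(y) = y\<close> it is twice the Lebesgue measure.\<close>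

locale linear_diffusion =
  fixes \<alpha> \<beta> :: real and M :: "'a measure" and P :: "real \<Rightarrow> 'a measure"
    and X :: "real \<Rightarrow> 'a \<Rightarrow> real" and S :: "real \<Rightarrow> real" and m :: "real measure"
  assumes prob_P: "\<And>y. y \<in> {\<alpha><..<\<beta>} \<Longrightarrow> prob_space (P y)"
    and sets_P: "\<And>y. y \<in> {\<alpha><..<\<beta>} \<Longrightarrow> sets (P y) = sets M"
    and X_measurable: "\<And>t. 0 \<le> t \<Longrightarrow> X t \<in> borel_measurable M"
    and X_continuous: "\<And>\<omega>. \<omega> \<in> space M \<Longrightarrow> continuous_on {0..} (\<lambda>t. X t \<omega>)"
    and X_range: "\<And>t \<omega>. 0 \<le> t \<Longrightarrow> \<omega> \<in> space M \<Longrightarrow> X t \<omega> \<in> {\<alpha>..\<beta>}"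
    and X_boundary: "\<And>s t \<omega>. 0 \<le> s \<Longrightarrow> s \<le> t \<Longrightarrow> \<omega> \<in> space M \<Longrightarrow> X s \<omega> \<in> {\<alpha>, \<beta>} \<Longrightarrow> X t \<omega> = X s \<omega>"
    and X_start: "\<And>y. y \<in> {\<alpha><..<\<beta>} \<Longrightarrow> AE \<omega> in P y. X 0 \<omega> = y"
    and P_measurable: "\<And>B. B \<in> sets path_space \<Longrightarrow>
      (\<lambda>y. emeasure (P y) {\<omega> \<in> space M. path_from X 0 \<omega> \<in> B})
        \<in> borel_measurable (restrict_space borel {\<alpha><..<\<beta>})"
    and strong_Markov: "\<And>y T A B. y \<in> {\<alpha><..<\<beta>} \<Longrightarrow>
      stopping_time (natural_filtration (space M) X) T \<Longrightarrow>
      A \<in> sets (filtration.pre_sigma (space M) (natural_filtration (space M) X) T) \<Longrightarrow>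
      B \<in> sets path_space \<Longrightarrow>
      emeasure (P y) {\<omega> \<in> A. T \<omega> < \<top> \<and> X (enn2real (T \<omega>)) \<omega> \<in> {\<alpha><..<\<beta>} \<and>
                             path_from X (enn2real (T \<omega>)) \<omega> \<in> B} =
      (\<integral>\<^sup>+ \<omega>. emeasure (P (X (enn2real (T \<omega>)) \<omega>)) {\<omega>' \<in> space M. path_from X 0 \<omega>' \<in> B} *
            indicator {\<omega> \<in> A. T \<omega> < \<top> \<and> X (enn2real (T \<omega>)) \<omega> \<in> {\<alpha><..<\<beta>}} \<omega> \<partial>P y)"
    and regular: "\<And>y z. y \<in> {\<alpha><..<\<beta>} \<Longrightarrow> z \<in> {\<alpha><..<\<beta>} \<Longrightarrow>
      measure (P y) {\<omega> \<in> space M. hitting_time X z \<omega> < \<top>} > 0"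
    and scale_continuous: "continuous_on {\<alpha><..<\<beta>} S"
    and scale_strict_mono: "strict_mono_on {\<alpha><..<\<beta>} S"
    and scale_hitting: "\<And>a b y. \<alpha> < a \<Longrightarrow> a < y \<Longrightarrow> y < b \<Longrightarrow> b < \<beta> \<Longrightarrow>
      measure (P y) {\<omega> \<in> space M. hitting_time X b \<omega> < hitting_time X a \<omega>} =
        (S y - S a) / (S b - S a)"
    and sets_speed: "sets m = sets borel"
    and speed_interval: "\<And>a b. \<alpha> < a \<Longrightarrow> a < b \<Longrightarrow> b < \<beta> \<Longrightarrow> 0 < emeasure m {a<..<b} \<and> emeasure m {a..b} < \<top>"
    and speed_continuous: "\<And>y. y \<in> {\<alpha><..<\<beta>} \<Longrightarrow> emeasure m {y} = 0"
    and speed_exit: "\<And>a b y. \<alpha> < a \<Longrightarrow> a < y \<Longrightarrow> y < b \<Longrightarrow> b < \<beta> \<Longrightarrow>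
      (\<integral>\<^sup>+ \<omega>. exit_time X a b \<omega> \<partial>P y) =
      (\<integral>\<^sup>+ w\<in>{a<..<b}. ennreal ((S (min y w) - S a) * (S b - S (max y w)) / (S b - S a)) \<partial>m)"

locale randomization =
  fixes \<alpha> \<beta> :: real and M :: "'a measure" and P :: "real \<Rightarrow> 'a measure"
    and X :: "real \<Rightarrow> 'a \<Rightarrow> real" and U :: "'a \<Rightarrow> real"
  assumes U_measurable: "U \<in> borel_measurable M"
    and U_uniform: "\<And>y. y \<in> {\<alpha><..<\<beta>} \<Longrightarrow> distr (P y) borel U = uniform_measure lborel {0..1}"
    and U_indep: "\<And>y. y \<in> {\<alpha><..<\<beta>} \<Longrightarrow>
      prob_space.indep_set (P y) (sets (vimage_algebra (space M) U borel))
        (sets (natural_filtration (space M) X \<top>))"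

section \<open>The variance problem\<close>

definition randomized_stopping_times ::
    "'a measure \<Rightarrow> ('a \<Rightarrow> real) \<Rightarrow> (real \<Rightarrow> 'a \<Rightarrow> real) \<Rightarrow> ('a \<Rightarrow> ennreal) set" where
  "randomized_stopping_times M U X = {\<tau>. stopping_time (randomized_filtration (space M) U X) \<tau>}"

text \<open>\<open>\<xi> \<tau>\<^sub>1 + (1 - \<xi>) \<tau>\<^sub>2\<close> for the Bernoulli variable \<open>\<xi>\<close> indicating the event \<open>U < p\<close>\<close>

definition mixed_time ::
    "('a \<Rightarrow> real) \<Rightarrow> real \<Rightarrow> ('a \<Rightarrow> ennreal) \<Rightarrow> ('a \<Rightarrow> ennreal) \<Rightarrow> 'a \<Rightarrow> ennreal" where
  "mixed_time U p \<tau>\<^sub>1 \<tau>\<^sub>2 \<omega> = (if U \<omega> < p then \<tau>\<^sub>1 \<omega> else \<tau>\<^sub>2 \<omega>)"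

definition mean_at ::
    "real \<Rightarrow> real \<Rightarrow> (real \<Rightarrow> 'a measure) \<Rightarrow> (real \<Rightarrow> 'a \<Rightarrow> real) \<Rightarrow> real \<Rightarrow> ('a \<Rightarrow> ennreal) \<Rightarrow> real" where
  "mean_at \<alpha> \<beta> P X y \<tau> = (\<integral>\<omega>. value_at \<alpha> \<beta> X \<tau> \<omega> \<partial>P y)"

definition variance_at ::
    "real \<Rightarrow> real \<Rightarrow> (real \<Rightarrow> 'a measure) \<Rightarrow> (real \<Rightarrow> 'a \<Rightarrow> real) \<Rightarrow> real \<Rightarrow> ('a \<Rightarrow> ennreal) \<Rightarrow> real" where
  "variance_at \<alpha> \<beta> P X y \<tau> = (\<integral>\<omega>. (value_at \<alpha> \<beta> X \<tau> \<omega> - mean_at \<alpha> \<beta> P X y \<tau>)\<^sup>2 \<partial>P y)"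

definition optimal_variance ::
    "real \<Rightarrow> real \<Rightarrow> 'a measure \<Rightarrow> (real \<Rightarrow> 'a measure) \<Rightarrow> (real \<Rightarrow> 'a \<Rightarrow> real) \<Rightarrow> ('a \<Rightarrow> real) \<Rightarrow> real \<Rightarrow> ereal"
  where
  "optimal_variance \<alpha> \<beta> M P X U x =
    (SUP \<tau>\<in>randomized_stopping_times M U X. ereal (variance_at \<alpha> \<beta> P X x \<tau>))"

definition optimal_time ::
    "real \<Rightarrow> real \<Rightarrow> 'a measure \<Rightarrow> (real \<Rightarrow> 'a measure) \<Rightarrow> (real \<Rightarrow> 'a \<Rightarrow> real) \<Rightarrow> ('a \<Rightarrow> real) \<Rightarrow> real \<Rightarrow>
     ('a \<Rightarrow> ennreal) \<Rightarrow> bool" where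
  "optimal_time \<alpha> \<beta> M P X U x \<tau> \<longleftrightarrow>
    \<tau> \<in> randomized_stopping_times M U X \<and>
    optimal_variance \<alpha> \<beta> M P X U x = ereal (variance_at \<alpha> \<beta> P X x \<tau>)"

section \<open>The auxiliary maximization problems\<close>

text \<open>The ratios are maximized over all points of \<open>[\<alpha>, \<beta>]\<close> at which the denominator does not vanish.\<close>

definition Z_set :: "real \<Rightarrow> real \<Rightarrow> (real \<Rightarrow> real) \<Rightarrow> real \<Rightarrow> real set" where
  "Z_set \<alpha> \<beta> S c =
    {z. is_arg_max (\<lambda>z. (z\<^sup>2 - \<alpha>\<^sup>2 - 2 * c * (z - \<alpha>)) / S z) (\<lambda>z. z \<in> {\<alpha><..\<beta>}) z}"

definition Y_set :: "real \<Rightarrow> real \<Rightarrow> (real \<Rightarrow> real) \<Rightarrow> real \<Rightarrow> real set" where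
  "Y_set \<alpha> \<beta> S c =
    {y. is_arg_max (\<lambda>y. (y\<^sup>2 - \<beta>\<^sup>2 - 2 * c * (y - \<beta>)) / (S \<beta> - S y)) (\<lambda>y. y \<in> {\<alpha>..<\<beta>}) y}"

text \<open>The right-hand condition is the mirror image of the left-hand one: the reflection
  \<open>x \<mapsto> - x\<close> exchanges infima and suprema, turns \<open>c\<close> into \<open>- c\<close> and so also reverses the last
  inequality.\<close>

definition left_condition ::
    "real \<Rightarrow> real \<Rightarrow> (real \<Rightarrow> 'a measure) \<Rightarrow> (real \<Rightarrow> 'a \<Rightarrow> real) \<Rightarrow> (real \<Rightarrow> real) \<Rightarrow> bool" where
  "left_condition \<alpha> \<beta> P X S \<longleftrightarrow>
    (\<forall>c\<in>{\<alpha><..<\<beta>}. (\<exists>u\<in>Z_set \<alpha> \<beta> S c. \<exists>v\<in>Z_set \<alpha> \<beta> S c. u \<noteq> v) \<longrightarrow>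
      mean_at \<alpha> \<beta> P X (Inf (Z_set \<alpha> \<beta> S c)) (exit_time X \<alpha> (Sup (Z_set \<alpha> \<beta> S c))) > c)"

definition right_condition ::
    "real \<Rightarrow> real \<Rightarrow> (real \<Rightarrow> 'a measure) \<Rightarrow> (real \<Rightarrow> 'a \<Rightarrow> real) \<Rightarrow> (real \<Rightarrow> real) \<Rightarrow> bool" where
  "right_condition \<alpha> \<beta> P X S \<longleftrightarrow>
    (\<forall>c\<in>{\<alpha><..<\<beta>}. (\<exists>u\<in>Y_set \<alpha> \<beta> S c. \<exists>v\<in>Y_set \<alpha> \<beta> S c. u \<noteq> v) \<longrightarrow>
      mean_at \<alpha> \<beta> P X (Sup (Y_set \<alpha> \<beta> S c)) (exit_time X (Inf (Y_set \<alpha> \<beta> S c)) \<beta>) < c)"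

definition left_root :: "real \<Rightarrow> real \<Rightarrow> (real \<Rightarrow> real) \<Rightarrow> real \<Rightarrow> real \<Rightarrow> bool" where
  "left_root \<alpha> \<beta> S x z \<longleftrightarrow>
    z \<in> {x<..<\<beta>} \<and> S z / 2 - S x \<noteq> 0 \<and>
    (S z - S x) / (S z / 2 - S x) = deriv S z / S z * (z - \<alpha>)"

definition right_root :: "real \<Rightarrow> real \<Rightarrow> (real \<Rightarrow> real) \<Rightarrow> real \<Rightarrow> real \<Rightarrow> bool" where
  "right_root \<alpha> \<beta> S x y \<longleftrightarrow>
    y \<in> {\<alpha><..<x} \<and> S x - S y / 2 - S \<beta> / 2 \<noteq> 0 \<and>
    (S x - S y) / (S x - S y / 2 - S \<beta> / 2) = deriv S y / (S \<beta> - S y) * (\<beta> - y)"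

end

theory Submission
  imports Defs
begin

text \<open>
  For every stopping time \<open>\<tau>\<close>, \<open>S(X\<^sub>\<tau>)\<close> has mean \<open>S x\<close>, and the variance is the minimum over \<open>c\<close> of the
  second moment about \<open>c\<close>. On the compact convex hull of the curve \<open>z \<mapsto> (S z, z, z\<^sup>2)\<close>, sliced at
  \<open>S x\<close>, the variance \<open>q - p\<^sup>2\<close> is maximal at some \<open>(c, q)\<close>; by convexity this point also maximizes the
  second moment about \<open>c\<close>, so that a line \<open>v + l (S z - S x)\<close> lies above \<open>(z - c)\<^sup>2\<close> and touches it at
  the support of a maximizing law. Mixtures of two-point laws on contact points with mean \<open>c\<close> are
  optimal. If \<open>S x \<le> S \<beta> / 2\<close>, then \<open>c\<close> is at most the midpoint, hence \<open>l \<ge> 0\<close>, and no contact point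
  lies in \<open>(\<alpha>, c]\<close>, so a contact pair with mean at most \<open>c\<close> has left end \<open>\<alpha>\<close>. The other contact points
  are the maximizers \<open>Z(c)\<close>. The case \<open>S x > S \<beta> / 2\<close> follows by reflection.

  That \<open>S(X\<^sub>\<tau>)\<close> has mean \<open>S x\<close> is optional stopping for \<open>S(X\<^sub>t) / S \<beta>\<close>, the conditional probability of the
  event \<open>sup X = \<beta>\<close>: this event is shift invariant because a maximum \<open>\<beta>\<close> is absorbing, and off it the
  path converges to \<open>\<alpha>\<close> almost surely.
\<close>

section \<open>Supporting lines and two-point laws\<close>

text \<open>The variance is not linear in the law of the stopped value. Two atoms suffice to give
  \<open>S\<close> the mean \<open>S x\<close>, but a pair of contact points need not also have the
  mean \<open>c\<close>; this is the obstacle that the randomization by \<open>U\<close> removes.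
  From the finite convex combination that represents the maximizing point, an averaging argument
  extracts one contact pair with mean at most \<open>c\<close> and one with mean at least
  \<open>c\<close>, and an intermediate weight gives exactly \<open>c\<close>. The upper bound for
  an arbitrary stopping time uses only the majorizing line and the mean of \<open>S\<close>, so laws
  of stopped values are never decomposed. The axioms of a diffusion provide hitting probabilities
  and the strong Markov property, but no martingale. Recognizing \<open>S / S \<beta>\<close> as the
  probability of an event of the whole path turns the martingale identity into the Markov property
  at a deterministic time. Since the Markov property speaks only of the interior, the two boundary
  values are treated separately through absorption.\<close>

lemma exists_line_below:
  fixes T \<phi> :: "'b \<Rightarrow> real"
  assumes lo: "\<exists>u\<in>A. T u < s" and hi: "\<exists>v\<in>A. s < T v"
    and mid: "\<And>u. u \<in> A \<Longrightarrow> T u = s \<Longrightarrow> \<kappa> \<le> \<phi> u"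
    and chord: "\<And>u v. u \<in> A \<Longrightarrow> v \<in> A \<Longrightarrow> T u < s \<Longrightarrow> s < T v \<Longrightarrow>
      \<kappa> * (T v - T u) \<le> \<phi> u * (T v - s) + \<phi> v * (s - T u)"
  shows "\<exists>l. \<forall>z\<in>A. \<kappa> + l * (T z - s) \<le> \<phi> z"
proof -
  \<comment> \<open>\<open>Q\<close> collects the lower bounds that points left of \<open>s\<close>
    impose on the slope. By \<open>chord\<close> each of them is at most every upper bound imposed
    from the right, so \<open>Sup Q\<close> meets both.\<close>
  define Q where "Q = (\<lambda>u. (\<kappa> - \<phi> u) / (s - T u)) ` {u\<in>A. T u < s}"
  have Qle: "r \<le> (\<phi> v - \<kappa>) / (T v - s)" if "r \<in> Q" "v \<in> A" "s < T v" for r v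
  proof -
    obtain u where u: "u \<in> A" "T u < s" "r = (\<kappa> - \<phi> u) / (s - T u)"
      using \<open>r \<in> Q\<close> by (auto simp: Q_def)
    have "(\<kappa> - \<phi> u) * (T v - s) \<le> (\<phi> v - \<kappa>) * (s - T u)"
      using chord[OF u(1) that(2) u(2) that(3)] by (simp add: algebra_simps)
    then show ?thesis
      unfolding u(3) using u(2) that(3) by (simp add: pos_divide_le_eq pos_le_divide_eq)
  qed
  have ne: "Q \<noteq> {}" using lo by (auto simp: Q_def)
  obtain v0 where v0: "v0 \<in> A" "s < T v0" using hi by auto
  have bdd: "bdd_above Q" using Qle[OF _ v0] by (rule bdd_aboveI)
  have "\<kappa> + Sup Q * (T z - s) \<le> \<phi> z" if z: "z \<in> A" for z
  proof (cases "T z" s rule: linorder_cases)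
    case less
    then have "(\<kappa> - \<phi> z) / (s - T z) \<le> Sup Q"
      using z by (intro cSup_upper bdd) (auto simp: Q_def)
    then show ?thesis using less by (simp add: field_simps)
  next
    case equal
    then show ?thesis using mid[OF z] by simp
  next
    case greater
    then have "Sup Q \<le> (\<phi> z - \<kappa>) / (T z - s)"
      using z ne Qle by (intro cSup_least) auto
    then show ?thesis using greater by (simp add: field_simps)
  qed
  then show ?thesis by blast
qed

text \<open>If every point and every chord over \<open>s\<close> were strictly above \<kappa>, a
  line through \<open>(s, \<kappa>)\<close> would lie below \<phi> on \<open>A\<close>. Averaging
  with the weights forces equality on all of \<open>A\<close>, and then any chord passes exactly
  through \<open>(s, \<kappa>)\<close>.\<close>

lemma exists_chord_below:
  fixes T \<phi> w :: "'b \<Rightarrow> real"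
  assumes fin: "finite A" and w: "\<And>u. u \<in> A \<Longrightarrow> 0 < w u" and w1: "sum w A = 1"
    and wT: "(\<Sum>u\<in>A. w u * T u) = s" and w\<phi>: "(\<Sum>u\<in>A. w u * \<phi> u) = \<kappa>"
  shows "(\<exists>u\<in>A. T u = s \<and> \<phi> u \<le> \<kappa>) \<or>
    (\<exists>u\<in>A. \<exists>v\<in>A. T u < s \<and> s < T v \<and>
      \<phi> u * (T v - s) + \<phi> v * (s - T u) \<le> \<kappa> * (T v - T u))"
proof (rule ccontr)
  assume neg: "\<not> ?thesis"
  have zero: "f u = 0" if "\<And>u. u \<in> A \<Longrightarrow> 0 \<le> f u" "(\<Sum>u\<in>A. w u * f u) = 0" "u \<in> A" for f u
  proof -
    have "\<forall>u\<in>A. w u * f u = 0"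
      using that(1,2) w fin by (subst sum_nonneg_eq_0_iff[symmetric]) (auto simp: less_imp_le)
    then show ?thesis using w[OF that(3)] that(3) by auto
  qed
  have ne: "A \<noteq> {}" using w1 by auto
  have centred: "(\<Sum>u\<in>A. w u * (T u - s)) = 0" "(\<Sum>u\<in>A. w u * (\<phi> u - \<kappa>)) = 0"
    using w1 wT w\<phi> by (simp_all add: right_diff_distrib sum_subtractf flip: sum_distrib_right)
  have at_s: "\<exists>u\<in>A. T u \<noteq> s"
  proof (rule ccontr)
    assume "\<not> ?thesis"
    then have pos: "0 < \<phi> u - \<kappa>" if "u \<in> A" for u using neg that by force
    then have "\<phi> u - \<kappa> = 0" if "u \<in> A" for u
      using zero[of "\<lambda>u. \<phi> u - \<kappa>"] centred(2) that less_imp_le by blast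
    then show False using ne pos by fastforce
  qed
  have lo: "\<exists>u\<in>A. T u < s"
  proof (rule ccontr)
    assume "\<not> ?thesis"
    then have "\<forall>u\<in>A. T u - s = 0" using zero[of "\<lambda>u. T u - s"] centred(1) by force
    then show False using at_s by auto
  qed
  have hi: "\<exists>u\<in>A. s < T u"
  proof (rule ccontr)
    assume *: "\<not> ?thesis"
    have "(\<Sum>u\<in>A. w u * (s - T u)) = 0"
      using centred(1) by (simp add: right_diff_distrib sum_subtractf)
    then have "\<forall>u\<in>A. s - T u = 0" using zero[of "\<lambda>u. s - T u"] * by force
    then show False using at_s by auto
  qed
  have "\<exists>l. \<forall>z\<in>A. \<kappa> + l * (T z - s) \<le> \<phi> z"
  proof (rule exists_line_below[OF lo hi])
    show "\<kappa> \<le> \<phi> u" if "u \<in> A" "T u = s" for u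
      using neg that by (metis linear)
    show "\<kappa> * (T v - T u) \<le> \<phi> u * (T v - s) + \<phi> v * (s - T u)"
      if "u \<in> A" "v \<in> A" "T u < s" "s < T v" for u v
      using neg that by (metis linear)
  qed
  then obtain l where l: "\<And>z. z \<in> A \<Longrightarrow> \<kappa> + l * (T z - s) \<le> \<phi> z" by blast
  have "(\<Sum>u\<in>A. w u * (\<phi> u - (\<kappa> + l * (T u - s)))) =
      (\<Sum>u\<in>A. w u * (\<phi> u - \<kappa>)) - l * (\<Sum>u\<in>A. w u * (T u - s))"
    by (simp add: sum_distrib_left algebra_simps flip: sum_subtractf)
  then have eq: "\<phi> u = \<kappa> + l * (T u - s)" if "u \<in> A" for u
    using zero[of "\<lambda>u. \<phi> u - (\<kappa> + l * (T u - s))" u] l that centred by force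
  obtain u v where uv: "u \<in> A" "v \<in> A" "T u < s" "s < T v" using lo hi by auto
  have "\<phi> u * (T v - s) + \<phi> v * (s - T u) = \<kappa> * (T v - T u)"
    unfolding eq[OF uv(1)] eq[OF uv(2)] by (simp add: algebra_simps)
  then show False using neg uv by (metis order_refl)
qed

text \<open>\<open>mean_exit S x a b\<close> is the mean of the law on \<open>{a, b}\<close> under which \<open>S\<close> has mean \<open>S x\<close>; when
  \<open>x\<close> is an end point, it is the point mass at \<open>x\<close>.\<close>

definition mean_exit :: "(real \<Rightarrow> real) \<Rightarrow> real \<Rightarrow> real \<Rightarrow> real \<Rightarrow> real" where
  "mean_exit S x a b =
    (if a < x \<and> x < b then (a * (S b - S x) + b * (S x - S a)) / (S b - S a) else x)"

text \<open>In the variable \<open>S z\<close> the right-hand side is a line with slope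
  \<open>l\<close> and value \<open>v\<close> at \<open>S x\<close>. Its average is therefore
  \<open>v\<close> under every law that gives \<open>S\<close> the mean \<open>S x\<close>.\<close>

definition contact :: "(real \<Rightarrow> real) \<Rightarrow> real \<Rightarrow> real \<Rightarrow> real \<Rightarrow> real \<Rightarrow> real \<Rightarrow> bool" where
  "contact S x c v l z \<longleftrightarrow> (z - c)\<^sup>2 = v + l * (S z - S x)"

definition majorant :: "real \<Rightarrow> real \<Rightarrow> (real \<Rightarrow> real) \<Rightarrow> real \<Rightarrow> real \<Rightarrow> real \<Rightarrow> real \<Rightarrow> bool" where
  "majorant \<alpha> \<beta> S x c v l \<longleftrightarrow> (\<forall>z\<in>{\<alpha>..\<beta>}. (z - c)\<^sup>2 \<le> v + l * (S z - S x))"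

section \<open>Moment curve, convex hull and saddle point\<close>

locale scale =
  fixes \<alpha> \<beta> :: real and S :: "real \<Rightarrow> real" and x :: real
  assumes x_in: "x \<in> {\<alpha><..<\<beta>}"
    and cont_S: "continuous_on {\<alpha>..\<beta>} S"
    and S_less: "\<And>y z. \<alpha> \<le> y \<Longrightarrow> y < z \<Longrightarrow> z \<le> \<beta> \<Longrightarrow> S y < S z"
    and S_left: "S \<alpha> = 0"
begin

lemma S_le: "\<alpha> \<le> y \<Longrightarrow> y \<le> z \<Longrightarrow> z \<le> \<beta> \<Longrightarrow> S y \<le> S z"
  using S_less[of y z] by (cases "y = z") auto

lemma S_less_iff: "y \<in> {\<alpha>..\<beta>} \<Longrightarrow> z \<in> {\<alpha>..\<beta>} \<Longrightarrow> S y < S z \<longleftrightarrow> y < z"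
  using S_less[of y z] S_le[of z y] by force

lemma S_eq_iff: "y \<in> {\<alpha>..\<beta>} \<Longrightarrow> z \<in> {\<alpha>..\<beta>} \<Longrightarrow> S y = S z \<longleftrightarrow> y = z"
  using S_less[of y z] S_less[of z y] by (cases y z rule: linorder_cases) auto

lemma S_pos: "\<alpha> < z \<Longrightarrow> z \<le> \<beta> \<Longrightarrow> 0 < S z"
  using S_less[of \<alpha> z] S_left by auto

lemma S_nonzero: "\<alpha> < z \<Longrightarrow> z \<le> \<beta> \<Longrightarrow> S z \<noteq> 0"
  using S_pos[of z] by auto

lemma \<alpha>_less_\<beta>: "\<alpha> < \<beta>" using x_in by auto

lemma mean_exit_inner:
  assumes "\<alpha> \<le> a" "a < x" "x < b" "b \<le> \<beta>"
  shows "S a < S x" "S x < S b"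
    "mean_exit S x a b * (S b - S a) = a * (S b - S x) + b * (S x - S a)"
  using assms S_less[of a x] S_less[of x b] by (auto simp: mean_exit_def)

lemma mean_exit_strict:
  assumes "\<alpha> \<le> a" "a < x" "x < b" "b \<le> \<beta>"
  shows "a < mean_exit S x a b" "mean_exit S x a b < b"
proof -
  note m = mean_exit_inner[OF assms]
  have "a * (S b - S a) < mean_exit S x a b * (S b - S a)"
  proof -
    have "0 < (b - a) * (S x - S a)" using m assms by simp
    then show ?thesis unfolding m(3) by (simp add: algebra_simps)
  qed
  from mult_right_less_imp_less[OF this] m(1,2) show "a < mean_exit S x a b" by simp
  have "mean_exit S x a b * (S b - S a) < b * (S b - S a)"
  proof -
    have "0 < (b - a) * (S b - S x)" using m assms by simp
    then show ?thesis unfolding m(3) by (simp add: algebra_simps)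
  qed
  from mult_right_less_imp_less[OF this] m(1,2) show "mean_exit S x a b < b" by simp
qed

text \<open>The last two conclusions only bracket \<open>c\<close>, because a maximizing law may
  have several atoms on either side of \<open>x\<close>; if it charges \<open>x\<close> itself, the
  pair may be \<open>a = b = x\<close>.\<close>

lemma saddle_point:
  obtains c v l where "majorant \<alpha> \<beta> S x c v l" "\<alpha> < c" "c < \<beta>"
    "\<exists>a\<in>{\<alpha>..x}. \<exists>b\<in>{x..\<beta>}. contact S x c v l a \<and> contact S x c v l b \<and> mean_exit S x a b \<le> c"
    "\<exists>a\<in>{\<alpha>..x}. \<exists>b\<in>{x..\<beta>}. contact S x c v l a \<and> contact S x c v l b \<and> c \<le> mean_exit S x a b"
proof -
  define \<gamma> where "\<gamma> = (\<lambda>z. (S z, z, z\<^sup>2))"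
  define K where "K = convex hull (\<gamma> ` {\<alpha>..\<beta>})"
  define K' where "K' = K \<inter> {k. fst k = S x}"
  have "compact (\<gamma> ` {\<alpha>..\<beta>})"
    unfolding \<gamma>_def by (intro compact_continuous_image continuous_intros cont_S) auto
  then have "compact K" unfolding K_def by (rule compact_convex_hull)
  moreover have "closed {k :: real \<times> real \<times> real. fst k = S x}"
    by (intro closed_Collect_eq continuous_intros)
  ultimately have comp: "compact K'" unfolding K'_def by (rule compact_Int_closed)
  have \<gamma>K: "\<gamma> z \<in> K" if "z \<in> {\<alpha>..\<beta>}" for z
    unfolding K_def using that by (intro hull_inc) auto
  have "convex K" by (simp add: K_def)
  then have conv: "(1 - t) *\<^sub>R k + t *\<^sub>R k' \<in> K" if "k \<in> K" "k' \<in> K" "0 \<le> t" "t \<le> 1" for k k' t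
    using that convexD[of K k k' "1 - t" t] by auto
  have "\<gamma> x \<in> K'" using \<gamma>K x_in by (auto simp: K'_def \<gamma>_def)
  then have "\<exists>k\<in>K'. \<forall>k'\<in>K'. snd (snd k') - (fst (snd k'))\<^sup>2 \<le> snd (snd k) - (fst (snd k))\<^sup>2"
    by (intro continuous_attains_sup comp continuous_intros) auto
  then obtain k0 where k0: "k0 \<in> K'"
      "\<And>k. k \<in> K' \<Longrightarrow> snd (snd k) - (fst (snd k))\<^sup>2 \<le> snd (snd k0) - (fst (snd k0))\<^sup>2"
    by blast
  define c where "c = fst (snd k0)"
  define q where "q = snd (snd k0)"
  define v where "v = q - c\<^sup>2"
  have k0_eq: "k0 = (S x, c, q)" using k0(1) by (auto simp: K'_def c_def q_def prod_eq_iff)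
  have opt: "q' - 2 * c * p' + c\<^sup>2 \<le> v" if k: "(S x, p', q') \<in> K" for p' q'
  proof -
    \<comment> \<open>Moving from \<open>k0\<close> towards a competitor by the fraction
      \<open>e\<close> changes the linear terms at order \<open>e\<close> and adds a square only at
      second order. Division by \<open>e\<close> and \<open>e\<close> tending to \<open>0\<close>
      leave the linearized inequality.\<close>
    have "(q' - q) - 2 * c * (p' - c) \<le> e * (p' - c)\<^sup>2" if e: "0 < e" "e \<le> 1" for e
    proof -
      have "(1 - e) *\<^sub>R k0 + e *\<^sub>R (S x, p', q') \<in> K'"
        using conv[of k0 "(S x, p', q')" e] k k0(1) e by (auto simp: K'_def algebra_simps)
      from k0(2)[OF this]
      have "((1 - e) * q + e * q') - ((1 - e) * c + e * p')\<^sup>2 \<le> q - c\<^sup>2"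
        by (simp add: k0_eq)
      then have "e * ((q' - q) - 2 * c * (p' - c)) \<le> e * (e * (p' - c)\<^sup>2)"
        by (simp add: algebra_simps power2_eq_square)
      then show ?thesis using e by simp
    qed
    moreover have "((\<lambda>e. e * (p' - c)\<^sup>2) \<longlongrightarrow> 0 * (p' - c)\<^sup>2) (at_right 0)"
      by (intro tendsto_intros)
    moreover have "\<forall>\<^sub>F e in at_right (0::real). 0 < e \<and> e \<le> 1"
      by (auto simp: eventually_at_right_field intro!: exI[of _ 1])
    ultimately have "(q' - q) - 2 * c * (p' - c) \<le> 0 * (p' - c)\<^sup>2"
      by (intro tendsto_lowerbound[where F = "at_right (0::real)" and f = "\<lambda>e. e * (p' - c)\<^sup>2"])
        (auto elim: eventually_mono)
    then show ?thesis by (simp add: v_def algebra_simps power2_eq_square)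
  qed
  have chord: "(u - c)\<^sup>2 * (S w - S x) + (w - c)\<^sup>2 * (S x - S u) \<le> v * (S w - S u)"
    if uw: "u \<in> {\<alpha>..\<beta>}" "w \<in> {\<alpha>..\<beta>}" "S u < S x" "S x < S w" for u w
  proof -
    \<comment> \<open>The weight of \<open>w\<close> for which the first coordinate of the
      combination is \<open>S x\<close>.\<close>
    define t where "t = (S x - S u) / (S w - S u)"
    have t: "0 \<le> t" "t \<le> 1" "t * (S w - S u) = S x - S u"
      using uw by (auto simp: t_def)
    have "(1 - t) *\<^sub>R \<gamma> u + t *\<^sub>R \<gamma> w \<in> K" using conv[OF \<gamma>K \<gamma>K] uw t by blast
    moreover have "(1 - t) *\<^sub>R \<gamma> u + t *\<^sub>R \<gamma> w =
        (S x, (1 - t) * u + t * w, (1 - t) * u\<^sup>2 + t * w\<^sup>2)"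
      using t(3) by (simp add: \<gamma>_def algebra_simps)
    ultimately have "((1 - t) * u\<^sup>2 + t * w\<^sup>2) - 2 * c * ((1 - t) * u + t * w) + c\<^sup>2 \<le> v"
      using opt by simp
    then have "(1 - t) * (u - c)\<^sup>2 + t * (w - c)\<^sup>2 \<le> v"
      by (simp add: algebra_simps power2_eq_square)
    then have "((1 - t) * (u - c)\<^sup>2 + t * (w - c)\<^sup>2) * (S w - S u) \<le> v * (S w - S u)"
      using uw by (intro mult_right_mono) auto
    moreover have "((1 - t) * (u - c)\<^sup>2 + t * (w - c)\<^sup>2) * (S w - S u) =
        (u - c)\<^sup>2 * ((S w - S u) - t * (S w - S u)) + (w - c)\<^sup>2 * (t * (S w - S u))"
      by (simp add: algebra_simps)
    ultimately show ?thesis unfolding t(3) by simp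
  qed
  \<comment> \<open>Lines are produced from below, so the negated square is used, and the slope
    changes sign afterwards.\<close>
  have "\<exists>l. \<forall>z\<in>{\<alpha>..\<beta>}. - v + l * (S z - S x) \<le> - (z - c)\<^sup>2"
  proof (rule exists_line_below)
    show "\<exists>u\<in>{\<alpha>..\<beta>}. S u < S x" "\<exists>v\<in>{\<alpha>..\<beta>}. S x < S v"
      using S_less[of \<alpha> x] S_less[of x \<beta>] x_in by (auto intro: bexI[of _ \<alpha>] bexI[of _ \<beta>])
    show "- v \<le> - (u - c)\<^sup>2" if "u \<in> {\<alpha>..\<beta>}" "S u = S x" for u
      using opt[of u "u\<^sup>2"] \<gamma>K[of u] that by (simp add: \<gamma>_def power2_eq_square algebra_simps)
    show "- v * (S w - S u) \<le> - (u - c)\<^sup>2 * (S w - S x) + - (w - c)\<^sup>2 * (S x - S u)"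
      if "u \<in> {\<alpha>..\<beta>}" "w \<in> {\<alpha>..\<beta>}" "S u < S x" "S x < S w" for u w
      using chord[OF that] by simp
  qed
  then obtain l' where l': "\<And>z. z \<in> {\<alpha>..\<beta>} \<Longrightarrow> - v + l' * (S z - S x) \<le> - (z - c)\<^sup>2" by blast
  define l where "l = - l'"
  have maj: "majorant \<alpha> \<beta> S x c v l"
    unfolding majorant_def
  proof
    fix z assume "z \<in> {\<alpha>..\<beta>}"
    from l'[OF this] show "(z - c)\<^sup>2 \<le> v + l * (S z - S x)" by (simp add: l_def)
  qed
  from k0(1) have "k0 \<in> convex hull (\<gamma> ` {\<alpha>..\<beta>})" by (simp add: K'_def K_def)
  then obtain F w where F: "finite F" "F \<subseteq> \<gamma> ` {\<alpha>..\<beta>}" "\<And>k. k \<in> F \<Longrightarrow> 0 \<le> w k"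
      "sum w F = 1" "(\<Sum>k\<in>F. w k *\<^sub>R k) = k0"
    unfolding convex_hull_explicit by blast
  \<comment> \<open>Points of weight zero are dropped, since averaging yields contact only where the
    weight is positive.\<close>
  define A where "A = {k\<in>F. 0 < w k}"
  have A0: "(\<Sum>k\<in>A. w k * f k) = (\<Sum>k\<in>F. w k * f k)" for f
    unfolding A_def using F(1,3) by (intro sum.mono_neutral_left) (auto simp: order.order_iff_strict)
  have A_form: "fst (snd k) \<in> {\<alpha>..\<beta>}" "k = \<gamma> (fst (snd k))" if "k \<in> A" for k
    using that F(2) by (auto simp: A_def \<gamma>_def)
  have A: "finite A" "\<And>k. k \<in> A \<Longrightarrow> 0 < w k" "sum w A = 1"
      "(\<Sum>k\<in>A. w k * fst k) = S x" "(\<Sum>k\<in>A. w k * fst (snd k)) = c"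
      "(\<Sum>k\<in>A. w k * snd (snd k)) = q"
  proof -
    show "sum w A = 1" using A0[of "\<lambda>_. 1"] F(4) by simp
    have k0_sum: "k0 = (\<Sum>k\<in>F. w k *\<^sub>R k)" using F(5) by simp
    show "(\<Sum>k\<in>A. w k * fst k) = S x"
      using arg_cong[OF k0_sum, of fst] by (simp add: A0 k0_eq fst_sum)
    show "(\<Sum>k\<in>A. w k * fst (snd k)) = c"
      using arg_cong[OF k0_sum, of "\<lambda>k. fst (snd k)"] by (simp add: A0 k0_eq fst_sum snd_sum)
    show "(\<Sum>k\<in>A. w k * snd (snd k)) = q"
      using arg_cong[OF k0_sum, of "\<lambda>k. snd (snd k)"] by (simp add: A0 k0_eq snd_sum)
  qed (use F(1) in \<open>auto simp: A_def\<close>)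
  have A_contact: "contact S x c v l (fst (snd k))" if k: "k \<in> A" for k
  proof -
    \<comment> \<open>The gap between line and squared distance, written affinely in the coordinates
      of the hull. Its weighted sum is zero because \<open>k0\<close> attains \<open>v\<close>, so
      the nonnegative gap vanishes at every atom.\<close>
    define f where "f k = v + l * (fst k - S x) - (snd (snd k) - 2 * c * fst (snd k) + c\<^sup>2)" for k
    have "(\<Sum>k\<in>A. w k * f k) = v * sum w A + l * ((\<Sum>k\<in>A. w k * fst k) - S x * sum w A) -
       ((\<Sum>k\<in>A. w k * snd (snd k)) - 2 * c * (\<Sum>k\<in>A. w k * fst (snd k)) + c\<^sup>2 * sum w A)"
      unfolding f_def
      by (simp add: sum_distrib_left sum_distrib_right sum_subtractf sum.distrib algebra_simps)
    also have "\<dots> = 0" by (simp add: A v_def power2_eq_square)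
    finally have sum0: "(\<Sum>k\<in>A. w k * f k) = 0" .
    have f_eq: "f k = v + l * (S (fst (snd k)) - S x) - (fst (snd k) - c)\<^sup>2" if "k \<in> A" for k
      using arg_cong[OF A_form(2)[OF that], of fst] arg_cong[OF A_form(2)[OF that], of "\<lambda>k. snd (snd k)"]
      by (simp add: f_def \<gamma>_def power2_eq_square algebra_simps)
    have "f k \<ge> 0" if "k \<in> A" for k
      using maj A_form(1)[OF that] f_eq[OF that] by (auto simp: majorant_def)
    then have "\<forall>k\<in>A. w k * f k = 0"
      using sum0 A(1,2) by (subst sum_nonneg_eq_0_iff[symmetric]) (auto simp: less_imp_le)
    then have "f k = 0" using A(2)[OF k] k by auto
    then show ?thesis using f_eq[OF k] by (simp add: contact_def)
  qed
  have A_S: "fst k = S (fst (snd k))" if "k \<in> A" for k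
    using arg_cong[OF A_form(2)[OF that], of fst] by (simp add: \<gamma>_def)
  have A_between: "fst (snd k) < x" "x < fst (snd k')"
    if k: "k \<in> A" "k' \<in> A" "fst k < S x" "S x < fst k'" for k k'
    using S_less_iff[OF A_form(1)[OF k(1)], of x] S_less_iff[OF _ A_form(1)[OF k(2)], of x]
      A_S[OF k(1)] A_S[OF k(2)] x_in k(3,4) by auto
  let ?pair = "\<lambda>P. \<exists>a\<in>{\<alpha>..x}. \<exists>b\<in>{x..\<beta>}. contact S x c v l a \<and> contact S x c v l b \<and> P (mean_exit S x a b)"
  have pair: "?pair P"
    if cond: "(\<exists>k\<in>A. fst k = S x \<and> P (fst (snd k))) \<or> (\<exists>k\<in>A. \<exists>k'\<in>A. fst k < S x \<and> S x < fst k' \<and>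
        P (mean_exit S x (fst (snd k)) (fst (snd k'))))" for P
    using cond
  proof (elim disjE bexE conjE)
    fix k assume k: "k \<in> A" "fst k = S x" "P (fst (snd k))"
    then have "fst (snd k) = x" using S_eq_iff[OF A_form(1)[OF k(1)], of x] A_S[OF k(1)] x_in by auto
    then show ?thesis using k A_contact[OF k(1)] x_in
      by (intro bexI[of _ x]) (auto simp: mean_exit_def)
  next
    fix k k' assume k: "k \<in> A" "k' \<in> A" "fst k < S x" "S x < fst k'"
        "P (mean_exit S x (fst (snd k)) (fst (snd k')))"
    then show ?thesis
      using A_between[OF k(1-4)] A_contact[OF k(1)] A_contact[OF k(2)] A_form(1)[OF k(1)] A_form(1)[OF k(2)]
      by (intro bexI[of _ "fst (snd k)"] bexI[of _ "fst (snd k')"]) auto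
  qed
  have lower: "?pair (\<lambda>m. m \<le> c)"
  proof (rule pair)
    have me: "mean_exit S x (fst (snd k)) (fst (snd k')) \<le> c"
      if k: "k \<in> A" "k' \<in> A" "fst k < S x" "S x < fst k'"
        "fst (snd k) * (fst k' - S x) + fst (snd k') * (S x - fst k) \<le> c * (fst k' - fst k)" for k k'
      using A_between[OF k(1-4)] k A_S[OF k(1)] A_S[OF k(2)] by (simp add: mean_exit_def divide_le_eq)
    show "(\<exists>k\<in>A. fst k = S x \<and> fst (snd k) \<le> c) \<or> (\<exists>k\<in>A. \<exists>k'\<in>A. fst k < S x \<and> S x < fst k' \<and>
        mean_exit S x (fst (snd k)) (fst (snd k')) \<le> c)"
      using exists_chord_below[OF A(1-3) A(4) A(5)] me by blast
  qed
  have upper: "?pair (\<lambda>m. c \<le> m)"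
  proof (rule pair)
    have me: "c \<le> mean_exit S x (fst (snd k)) (fst (snd k'))"
      if k: "k \<in> A" "k' \<in> A" "fst k < S x" "S x < fst k'"
        "- fst (snd k) * (fst k' - S x) + - fst (snd k') * (S x - fst k) \<le> - c * (fst k' - fst k)" for k k'
      using A_between[OF k(1-4)] k A_S[OF k(1)] A_S[OF k(2)] by (simp add: mean_exit_def le_divide_eq)
    \<comment> \<open>Negating the middle coordinate turns the selection of a small mean into that
      of a large one.\<close>
    have "(\<Sum>k\<in>A. w k * - fst (snd k)) = - c" using A(5) by (simp add: sum_negf)
    from exists_chord_below[OF A(1-3) A(4) this] 
    show "(\<exists>k\<in>A. fst k = S x \<and> c \<le> fst (snd k)) \<or> (\<exists>k\<in>A. \<exists>k'\<in>A. fst k < S x \<and> S x < fst k' \<and>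
        c \<le> mean_exit S x (fst (snd k)) (fst (snd k')))"
      using me by (metis neg_le_iff_le)
  qed
  \<comment> \<open>The mean of a pair lies strictly above its left end, so \<open>c\<close> stays
    off \<alpha> even if that end is \<alpha>.\<close>
  have "\<alpha> < c"
  proof -
    from lower obtain a b where ab: "a \<in> {\<alpha>..x}" "b \<in> {x..\<beta>}" "mean_exit S x a b \<le> c" by blast
    then show ?thesis using mean_exit_strict(1)[of a b] x_in by (cases "a < x \<and> x < b") (auto simp: mean_exit_def)
  qed
  moreover have "c < \<beta>"
  proof -
    from upper obtain a b where ab: "a \<in> {\<alpha>..x}" "b \<in> {x..\<beta>}" "c \<le> mean_exit S x a b" by blast
    then show ?thesis using mean_exit_strict(2)[of a b] x_in by (cases "a < x \<and> x < b") (auto simp: mean_exit_def)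
  qed
  ultimately show ?thesis using that maj lower upper by blast
qed

end

text \<open>The mixture, with weights \<open>p\<close> and \<open>1 - p\<close>, of the two-point laws on \<open>{a1, b1}\<close> and
  \<open>{a2, b2}\<close> has mean \<open>c\<close> and second moment \<open>v\<close> about \<open>c\<close>, and no law under which \<open>S\<close> has
  mean \<open>S x\<close> has a larger one.\<close>

definition optimal_mixture ::
    "real \<Rightarrow> real \<Rightarrow> (real \<Rightarrow> real) \<Rightarrow> real \<Rightarrow> real \<Rightarrow> real \<Rightarrow> real \<Rightarrow> real \<Rightarrow> real \<Rightarrow> real \<Rightarrow> bool" where
  "optimal_mixture \<alpha> \<beta> S x v p a1 b1 a2 b2 \<longleftrightarrow>
    p \<in> {0..1} \<and> a1 \<in> {\<alpha>..x} \<and> b1 \<in> {x..\<beta>} \<and> a2 \<in> {\<alpha>..x} \<and> b2 \<in> {x..\<beta>} \<and>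
    (\<exists>c l. majorant \<alpha> \<beta> S x c v l \<and> (\<forall>z\<in>{a1, b1, a2, b2}. contact S x c v l z) \<and>
      p * mean_exit S x a1 b1 + (1 - p) * mean_exit S x a2 b2 = c)"

lemma optimal_mixture_swap:
  "optimal_mixture \<alpha> \<beta> S x v p a1 b1 a2 b2 \<Longrightarrow> optimal_mixture \<alpha> \<beta> S x v (1 - p) a2 b2 a1 b1"
  unfolding optimal_mixture_def by (auto simp: add.commute)

lemma convex_weight_between:
  fixes c m1 m2 :: real
  assumes "m2 \<le> c" "c \<le> m1"
  shows "\<exists>p\<in>{0..1}. p * m1 + (1 - p) * m2 = c"
proof (cases "m1 = m2")
  case True
  then show ?thesis using assms by (intro bexI[of _ 1]) auto
next
  case False
  define p where "p = (c - m2) / (m1 - m2)"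
  have "p * (m1 - m2) = c - m2" "p \<in> {0..1}" using assms False by (auto simp: p_def)
  then show ?thesis by (intro bexI[of _ p]) (auto simp: algebra_simps)
qed

section \<open>Location of contact points and sign of the slope\<close>

context scale
begin

context
  fixes c v l
  assumes maj: "majorant \<alpha> \<beta> S x c v l" and c_in: "\<alpha> < c" "c < \<beta>"
begin

lemma majorantD: "\<alpha> \<le> z \<Longrightarrow> z \<le> \<beta> \<Longrightarrow> (z - c)\<^sup>2 \<le> v + l * (S z - S x)"
  using maj by (auto simp: majorant_def)

text \<open>Left of \<open>c\<close> the parabola decreases strictly, while the line does not
  decrease when \<open>l \<ge> 0\<close>. Contact at \<open>t\<close> would thus leave the parabola
  strictly above the line at \<alpha>.\<close>

lemma no_contact_below:
  assumes "0 \<le> l" "\<alpha> < t" "t \<le> c"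
  shows "\<not> contact S x c v l t"
proof
  assume "contact S x c v l t"
  then have "(t - c)\<^sup>2 = v + l * (S t - S x)" by (simp add: contact_def)
  moreover have "(c - t)\<^sup>2 < (c - \<alpha>)\<^sup>2" using assms by (intro power_strict_mono) auto
  moreover have "l * (S \<alpha> - S x) \<le> l * (S t - S x)"
    using assms c_in S_le[of \<alpha> t] by (intro mult_left_mono) auto
  ultimately show False
    using majorantD[of \<alpha>] \<alpha>_less_\<beta> by (simp add: power2_commute)
qed

lemma no_contact_above:
  assumes "l \<le> 0" "c \<le> t" "t < \<beta>"
  shows "\<not> contact S x c v l t"
proof
  assume "contact S x c v l t"
  then have "(t - c)\<^sup>2 = v + l * (S t - S x)" by (simp add: contact_def)
  moreover have "(t - c)\<^sup>2 < (\<beta> - c)\<^sup>2" using assms by (intro power_strict_mono) auto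
  moreover have "l * (S \<beta> - S x) \<le> l * (S t - S x)"
    using assms c_in S_le[of t \<beta>] by (intro mult_left_mono_neg) auto
  ultimately show False
    using majorantD[of \<beta>] \<alpha>_less_\<beta> by simp
qed

context
  fixes a1 b1 a2 b2
  assumes ab1: "a1 \<in> {\<alpha>..x}" "b1 \<in> {x..\<beta>}" "contact S x c v l a1" "contact S x c v l b1"
      "c \<le> mean_exit S x a1 b1"
    and ab2: "a2 \<in> {\<alpha>..x}" "b2 \<in> {x..\<beta>}" "contact S x c v l a2" "contact S x c v l b2"
      "mean_exit S x a2 b2 \<le> c"
begin

lemma b1_ge: "c \<le> b1"
  using ab1 mean_exit_strict(2)[of a1 b1]
  by (cases "a1 < x \<and> x < b1") (auto simp: mean_exit_def)

lemma a2_le: "a2 \<le> c"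
  using ab2 mean_exit_strict(1)[of a2 b2]
  by (cases "a2 < x \<and> x < b2") (auto simp: mean_exit_def)

text \<open>The left end of a pair with mean at most \<open>c\<close> lies in
  \<open>[\<alpha>, c]\<close>, where only \<alpha> can be a contact point.\<close>

lemma a2_eq: "0 \<le> l \<Longrightarrow> a2 = \<alpha>"
  using no_contact_below[of a2] a2_le ab2 by fastforce

lemma b1_eq: "l \<le> 0 \<Longrightarrow> b1 = \<beta>"
  using no_contact_above[of b1] b1_ge ab1 by fastforce

text \<open>If \<open>b2 = x\<close>, the mean of the pair is \<open>x\<close>, and
  \<open>x \<le> c\<close> would be a contact point in the excluded range.\<close>

lemma b2_gr: "0 \<le> l \<Longrightarrow> x < b2"
  using a2_eq ab2 no_contact_below[of b2] x_in by (cases "b2 = x") (auto simp: mean_exit_def)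

lemma a1_less: "l \<le> 0 \<Longrightarrow> a1 < x"
  using b1_eq ab1 no_contact_above[of a1] x_in by (cases "a1 = x") (auto simp: mean_exit_def)

text \<open>Beyond the midpoint, \<alpha> would be the end point farther from \<open>c\<close>,
  which rules out an increasing line. Otherwise the upper pair is \<open>(a1, \<beta>)\<close>, and
  \<beta> carries weight at most 1/2. A mean of at least \<open>c\<close> then makes
  \<open>a1\<close> no farther from \<open>c\<close> than \<beta>; comparing the two contacts leaves
  a constant line, and \<alpha> violates it.\<close>

lemma centre_le_mid:
  assumes Sx: "S x \<le> S \<beta> / 2"
  shows "c \<le> (\<alpha> + \<beta>) / 2"
proof (rule ccontr)
  assume "\<not> ?thesis"
  then have mid: "\<beta> - c < c - \<alpha>" by argo
  then have f: "(\<beta> - c)\<^sup>2 < (c - \<alpha>)\<^sup>2" using c_in by (intro power_strict_mono) auto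
  have l: "l \<le> 0"
  proof (rule ccontr)
    assume "\<not> l \<le> 0"
    then have l: "0 < l" by simp
    \<comment> \<open>The contact at \<open>b2\<close> is no higher than the parabola at \<beta>,
      hence lower than the one at \<alpha>, although the line increases.\<close>
    have b2: "c < b2" using no_contact_below[of b2] b2_gr ab2 l x_in by force
    then have "(b2 - c)\<^sup>2 \<le> (\<beta> - c)\<^sup>2" using ab2 by (intro power_mono) auto
    moreover have "l * S \<alpha> < l * S b2"
      using l S_less[of \<alpha> b2] ab2 b2 c_in by (intro mult_strict_left_mono) auto
    moreover have "(c - \<alpha>)\<^sup>2 = v + (l * S \<alpha> - l * S x)" "(b2 - c)\<^sup>2 = v + (l * S b2 - l * S x)"
      using ab2(3,4) a2_eq l by (simp_all add: contact_def power2_commute right_diff_distrib)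
    ultimately show False using f by linarith
  qed
  note b1 = b1_eq[OF l] and a1 = a1_less[OF l]
  have m: "S a1 < S x" "S x < S \<beta>"
      "mean_exit S x a1 \<beta> * (S \<beta> - S a1) = a1 * (S \<beta> - S x) + \<beta> * (S x - S a1)"
    using mean_exit_inner[of a1 \<beta>] a1 ab1 x_in by auto
  have "c * (S \<beta> - S a1) \<le> mean_exit S x a1 \<beta> * (S \<beta> - S a1)"
    using ab1 b1 m by (intro mult_right_mono) auto
  then have "(c - a1) * (S \<beta> - S x) \<le> (\<beta> - c) * (S x - S a1)"
    unfolding m(3) by (simp add: algebra_simps)
  \<comment> \<open>The bound on \<open>S x\<close> enters here:
    \<open>S x - S a1 \<le> S x \<le> S \<beta> - S x\<close>.\<close>
  also have "\<dots> \<le> (\<beta> - c) * (S \<beta> - S x)"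
    using c_in Sx S_le[of \<alpha> a1] S_left ab1 a1 x_in by (intro mult_left_mono) auto
  finally have "c - a1 \<le> \<beta> - c" using m(2) by simp
  have "a1 < c"
    using no_contact_above[OF l, of a1] ab1 a1 x_in by force
  then have "(c - a1)\<^sup>2 \<le> (\<beta> - c)\<^sup>2" using \<open>c - a1 \<le> \<beta> - c\<close> by (intro power_mono) auto
  then have "v + l * (S a1 - S x) \<le> v + l * (S \<beta> - S x)"
    using ab1(3,4) b1 by (simp add: contact_def power2_commute)
  then have "l * S a1 \<le> l * S \<beta>" by (simp add: algebra_simps)
  moreover have "l * S \<beta> < l * S a1" if "l < 0"
    using that m by (intro mult_strict_left_mono_neg) auto
  ultimately have "l = 0" using l by fastforce
  moreover have "(\<beta> - c)\<^sup>2 = v + l * (S \<beta> - S x)" using ab1(4) b1 by (simp add: contact_def)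
  ultimately show False
    using f majorantD[of \<alpha>] \<alpha>_less_\<beta> by (simp add: power2_commute)
qed

text \<open>A decreasing line would touch at \<beta> and at some \<open>a1 < c\<close>. With
  \<open>c\<close> not beyond the midpoint, \<beta> is at least as far from \<open>c\<close> as
  \<open>a1\<close>, so its contact is no lower, against the decrease.\<close>

lemma slope_nonneg:
  assumes mid: "c \<le> (\<alpha> + \<beta>) / 2"
  shows "0 \<le> l"
proof (rule ccontr)
  assume "\<not> ?thesis"
  then have l: "l < 0" by simp
  then have b1: "b1 = \<beta>" and a1: "a1 < x" using b1_eq a1_less by auto
  then have a1c: "a1 < c"
    using no_contact_above[of a1] l ab1 x_in by force
  have "c - a1 \<le> \<beta> - c" using mid ab1 by (simp add: field_simps)
  then have "(c - a1)\<^sup>2 \<le> (\<beta> - c)\<^sup>2" using a1c by (intro power_mono) auto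
  moreover have "l * S \<beta> < l * S a1" using l S_less[of a1 \<beta>] ab1 a1 x_in by simp
  ultimately show False
    using ab1(3,4) b1 by (simp add: contact_def power2_commute algebra_simps)
qed

end

text \<open>The numerator is \<open>(z - c)\<^sup>2 - (\<alpha> - c)\<^sup>2\<close>, so contact at
  \<alpha> makes the ratio a chord slope from \<alpha> in the variable \<open>S\<close>. The
  majorant bounds it by \<open>l\<close>, with equality exactly at contact points; the given
  \<open>z\<close> shows that the value \<open>l\<close> is attained.\<close>

lemma Z_set_eq:
  assumes \<alpha>: "contact S x c v l \<alpha>" and z: "\<alpha> < z" "z \<le> \<beta>" "contact S x c v l z"
  shows "Z_set \<alpha> \<beta> S c = {z\<in>{\<alpha><..\<beta>}. contact S x c v l z}"
proof -
  let ?R = "\<lambda>z. (z\<^sup>2 - \<alpha>\<^sup>2 - 2 * c * (z - \<alpha>)) / S z"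
  have num: "z\<^sup>2 - \<alpha>\<^sup>2 - 2 * c * (z - \<alpha>) = (z - c)\<^sup>2 - (v - l * S x)" for z
    using \<alpha> S_left by (simp add: contact_def power2_eq_square algebra_simps)
  have le: "?R z \<le> l" if "z \<in> {\<alpha><..\<beta>}" for z
    unfolding num using that majorantD[of z] S_pos[of z] by (simp add: divide_le_eq algebra_simps)
  have eq: "?R z = l \<longleftrightarrow> contact S x c v l z" if "z \<in> {\<alpha><..\<beta>}" for z
    unfolding num contact_def using that S_pos[of z] by (auto simp: divide_eq_eq algebra_simps)
  show ?thesis
  proof (intro set_eqI iffI)
    fix w assume w: "w \<in> Z_set \<alpha> \<beta> S c"
    then have "w \<in> {\<alpha><..\<beta>}" "\<not> ?R w < ?R z" using z by (auto simp: Z_set_def is_arg_max_def)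
    then show "w \<in> {z\<in>{\<alpha><..\<beta>}. contact S x c v l z}"
      using le[of w] eq[of w] eq[of z] z by auto
  next
    fix w assume w: "w \<in> {z\<in>{\<alpha><..\<beta>}. contact S x c v l z}"
    then have "?R w = l" using eq by auto
    then have "\<not> ?R w < ?R y" if "y \<in> {\<alpha><..\<beta>}" for y using le[OF that] by simp
    then show "w \<in> Z_set \<alpha> \<beta> S c" using w unfolding Z_set_def is_arg_max_def by blast
  qed
qed

end

section \<open>Optimal mixtures for \<open>S x \<le> S \<beta> / 2\<close>\<close>

lemma left_saddle:
  assumes "S x \<le> S \<beta> / 2"
  obtains c v l a b z where "majorant \<alpha> \<beta> S x c v l" "\<alpha> < c" "c < \<beta>" "0 \<le> l"
    "x < z" "z \<le> \<beta>" "contact S x c v l \<alpha>" "contact S x c v l z" "mean_exit S x \<alpha> z \<le> c"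
    "a \<in> {\<alpha>..x}" "b \<in> {x..\<beta>}" "contact S x c v l a" "contact S x c v l b" "c \<le> mean_exit S x a b"
proof -
  obtain c v l a1 b1 a2 b2 where *: "majorant \<alpha> \<beta> S x c v l" "\<alpha> < c" "c < \<beta>"
    "a1 \<in> {\<alpha>..x}" "b1 \<in> {x..\<beta>}" "contact S x c v l a1" "contact S x c v l b1" "c \<le> mean_exit S x a1 b1"
    "a2 \<in> {\<alpha>..x}" "b2 \<in> {x..\<beta>}" "contact S x c v l a2" "contact S x c v l b2" "mean_exit S x a2 b2 \<le> c"
    using saddle_point by metis
  have l: "0 \<le> l" using slope_nonneg[OF *] centre_le_mid[OF * assms] by simp
  note a2_eq[OF * l] b2_gr[OF * l]
  then show ?thesis using that[OF *(1-3) l, of b2 a1 b1] * by auto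
qed

lemma optimal_left_mixture:
  assumes "S x \<le> S \<beta> / 2"
  shows "\<exists>v p a b z. optimal_mixture \<alpha> \<beta> S x v p a b \<alpha> z"
proof -
  obtain c v l a b z where *: "majorant \<alpha> \<beta> S x c v l" "\<alpha> < c" "c < \<beta>" "0 \<le> l"
    "x < z" "z \<le> \<beta>" "contact S x c v l \<alpha>" "contact S x c v l z" "mean_exit S x \<alpha> z \<le> c"
    "a \<in> {\<alpha>..x}" "b \<in> {x..\<beta>}" "contact S x c v l a" "contact S x c v l b" "c \<le> mean_exit S x a b"
    using left_saddle[OF assms] by metis
  obtain p where "p \<in> {0..1}" "p * mean_exit S x a b + (1 - p) * mean_exit S x \<alpha> z = c"
    using convex_weight_between[OF *(9,14)] by blast
  then have "optimal_mixture \<alpha> \<beta> S x v p a b \<alpha> z"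
    unfolding optimal_mixture_def using * x_in by auto
  then show ?thesis by blast
qed

text \<open>Only the pair \<open>(a, b)\<close> may fail to start at \<alpha>. In that case
  \<open>a\<close> and \<open>z\<close> are distinct members of \<open>Z(c)\<close>, and by the
  condition the exit from \<alpha> and \<open>Sup Z\<close> has mean above \<open>c\<close> when
  started at \<open>Inf Z\<close>. This mean grows with the starting point and
  \<open>Inf Z \<le> x\<close>, so \<open>(\<alpha>, Sup Z)\<close> can replace
  \<open>(a, b)\<close>.\<close>

lemma optimal_left_mixture_one_sided:
  assumes Sx: "S x \<le> S \<beta> / 2"
    and cond: "\<And>c. c \<in> {\<alpha><..<\<beta>} \<Longrightarrow> \<exists>u\<in>Z_set \<alpha> \<beta> S c. \<exists>v\<in>Z_set \<alpha> \<beta> S c. u \<noteq> v \<Longrightarrow>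
      Inf (Z_set \<alpha> \<beta> S c) \<in> {\<alpha><..<\<beta>} \<Longrightarrow>
      c < mean_exit S (Inf (Z_set \<alpha> \<beta> S c)) \<alpha> (Sup (Z_set \<alpha> \<beta> S c))"
  shows "\<exists>v p z1 z2. optimal_mixture \<alpha> \<beta> S x v p \<alpha> z1 \<alpha> z2"
proof -
  obtain c v l a b z where *: "majorant \<alpha> \<beta> S x c v l" "\<alpha> < c" "c < \<beta>" "0 \<le> l"
    "x < z" "z \<le> \<beta>" "contact S x c v l \<alpha>" "contact S x c v l z" "mean_exit S x \<alpha> z \<le> c"
    "a \<in> {\<alpha>..x}" "b \<in> {x..\<beta>}" "contact S x c v l a" "contact S x c v l b" "c \<le> mean_exit S x a b"
    using left_saddle[OF Sx] by metis
  have "\<exists>k\<in>{x..\<beta>}. contact S x c v l k \<and> c \<le> mean_exit S x \<alpha> k"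
  proof (cases "a = \<alpha>")
    case True
    then show ?thesis using * by blast
  next
    case False
    define Z where "Z = Z_set \<alpha> \<beta> S c"
    have Z: "Z = {z\<in>{\<alpha><..\<beta>}. contact S x c v l z}"
      unfolding Z_def using * x_in by (intro Z_set_eq[of c v l z]) auto
    \<comment> \<open>Contacts in \<open>(\<alpha>, c]\<close> are excluded, so the half-open range
      may be replaced by a compact one. This makes \<open>Z\<close> closed and its supremum a
      contact point.\<close>
    have Z': "Z = {z\<in>{c..\<beta>}. (z - c)\<^sup>2 - (v + l * (S z - S x)) = 0}"
      unfolding Z using no_contact_below[OF *(1-4)] *(2) by (force simp: contact_def)
    have "continuous_on {c..\<beta>} S" by (rule continuous_on_subset[OF cont_S]) (use *(2) in auto)
    then have "closed Z"
      unfolding Z' by (intro continuous_closed_preimage_constant continuous_intros) auto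
    have aZ: "a \<in> Z" and zZ: "z \<in> Z" using * False x_in by (auto simp: Z)
    have bdd: "bdd_above Z" "bdd_below Z" by (auto simp: Z' intro: bdd_aboveI[of _ \<beta>] bdd_belowI[of _ c])
    define k where "k = Sup Z"
    define i where "i = Inf Z"
    have "k \<in> Z" unfolding k_def using \<open>closed Z\<close> zZ bdd by (intro closed_contains_Sup) auto
    have "z \<le> k" unfolding k_def using zZ bdd by (intro cSup_upper) auto
    have "i \<le> a" unfolding i_def using aZ bdd by (intro cInf_lower) auto
    have "c \<le> i" unfolding i_def using aZ by (intro cInf_greatest) (auto simp: Z')
    have o: "\<alpha> < i" "i \<le> x" "x < k" "k \<le> \<beta>" "contact S x c v l k"
      using * \<open>c \<le> i\<close> \<open>i \<le> a\<close> \<open>z \<le> k\<close> \<open>k \<in> Z\<close> by (auto simp: Z)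
    have "a \<noteq> z" using * by auto
    then have "c < mean_exit S i \<alpha> k"
      using aZ zZ *(2,3) o(1,2) x_in unfolding Z_def i_def k_def by (intro cond) auto
    also have "mean_exit S i \<alpha> k = \<alpha> + (k - \<alpha>) * S i / S k"
      using o S_pos[of k] by (simp add: mean_exit_def S_left field_simps)
    also have "\<dots> \<le> \<alpha> + (k - \<alpha>) * S x / S k"
      using o S_pos[of k] S_le[of i x] by (intro add_left_mono divide_right_mono mult_left_mono) auto
    also have "\<dots> = mean_exit S x \<alpha> k"
      using o x_in S_pos[of k] by (simp add: mean_exit_def S_left field_simps)
    finally show ?thesis using o by (intro bexI[of _ k]) auto
  qed
  then obtain k where k: "k \<in> {x..\<beta>}" "contact S x c v l k" "c \<le> mean_exit S x \<alpha> k" by blast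
  obtain p where "p \<in> {0..1}" "p * mean_exit S x \<alpha> k + (1 - p) * mean_exit S x \<alpha> z = c"
    using convex_weight_between[OF *(9) k(3)] by blast
  then have "optimal_mixture \<alpha> \<beta> S x v p \<alpha> k \<alpha> z"
    unfolding optimal_mixture_def using * k x_in by auto
  then show ?thesis by blast
qed

section \<open>Two-point laws on \<alpha> and \<open>z\<close>, and the monotonicity
  condition\<close>

lemma two_point_variance:
  fixes c v l z :: real
  defines "\<theta> \<equiv> S x / S z" and "m \<equiv> \<alpha> + (z - \<alpha>) * (S x / S z)"
  assumes z: "x < z" "z \<le> \<beta>"
  shows "mean_exit S x \<alpha> z = m"
    "majorant \<alpha> \<beta> S x c v l \<Longrightarrow> (z - \<alpha>)\<^sup>2 * \<theta> * (1 - \<theta>) \<le> v"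
    "contact S x c v l \<alpha> \<Longrightarrow> contact S x c v l z \<Longrightarrow> m = c \<Longrightarrow> (z - \<alpha>)\<^sup>2 * \<theta> * (1 - \<theta>) = v"
proof -
  have S: "0 < S x" "S x < S z" using S_pos[of x] S_less[of x z] x_in z by auto
  then have \<theta>: "0 \<le> \<theta>" "\<theta> \<le> 1" "\<theta> * S z = S x" by (auto simp: \<theta>_def)
  show "mean_exit S x \<alpha> z = m"
    using z x_in S by (simp add: mean_exit_def m_def S_left field_simps)
  \<comment> \<open>Steiner's identity for the law with weight \<theta> at \<open>z\<close>.\<close>
  have eq: "(1 - \<theta>) * (\<alpha> - c)\<^sup>2 + \<theta> * (z - c)\<^sup>2 = (z - \<alpha>)\<^sup>2 * \<theta> * (1 - \<theta>) + (m - c)\<^sup>2"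
    unfolding m_def \<theta>_def[symmetric] by (simp add: algebra_simps power2_eq_square)
  have line: "(1 - \<theta>) * (v + l * (S \<alpha> - S x)) + \<theta> * (v + l * (S z - S x)) = v + l * (\<theta> * S z - S x)"
    by (simp add: S_left algebra_simps)
  { assume "majorant \<alpha> \<beta> S x c v l"
    then have "(\<alpha> - c)\<^sup>2 \<le> v + l * (S \<alpha> - S x)" "(z - c)\<^sup>2 \<le> v + l * (S z - S x)"
      using z x_in by (auto simp: majorant_def)
    then have "(1 - \<theta>) * (\<alpha> - c)\<^sup>2 + \<theta> * (z - c)\<^sup>2 \<le>
        (1 - \<theta>) * (v + l * (S \<alpha> - S x)) + \<theta> * (v + l * (S z - S x))"
      using \<theta> by (intro add_mono mult_left_mono) auto
    then have "(z - \<alpha>)\<^sup>2 * \<theta> * (1 - \<theta>) + (m - c)\<^sup>2 \<le> v" unfolding eq line \<theta>(3) by simp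
    then show "(z - \<alpha>)\<^sup>2 * \<theta> * (1 - \<theta>) \<le> v"
      using zero_le_power2[of "m - c"] by linarith }
  { assume "contact S x c v l \<alpha>" "contact S x c v l z" "m = c"
    then show "(z - \<alpha>)\<^sup>2 * \<theta> * (1 - \<theta>) = v"
      using eq line \<theta>(3) by (simp add: contact_def) }
qed

text \<open>Monotonicity makes the contact point in \<open>(\<alpha>, \<beta>]\<close> unique, so
  both pairs are \<open>(\<alpha>, z)\<close> and no mixing remains. The root equation is the
  stationarity condition for the variance \<open>W\<close> of these two-point laws, and
  \<open>W\<close> decreases strictly beyond any root.\<close>

lemma optimal_left_interval:
  assumes Sx: "S x \<le> S \<beta> / 2"
    and diff: "\<And>z. z \<in> {\<alpha><..<\<beta>} \<Longrightarrow> S differentiable (at z)"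
    and mono: "mono_on {\<alpha><..<\<beta>} (\<lambda>z. deriv S z / S z * (z - \<alpha>))"
  shows "\<exists>z. (left_root \<alpha> \<beta> S x z \<and> (\<forall>w. left_root \<alpha> \<beta> S x w \<longrightarrow> w = z) \<or>
               (\<nexists>w. left_root \<alpha> \<beta> S x w) \<and> z = \<beta>) \<and>
      optimal_mixture \<alpha> \<beta> S x ((z - \<alpha>)\<^sup>2 * (S x / S z) * (1 - S x / S z)) 1 \<alpha> z \<alpha> z"
proof -
  define h where "h z = deriv S z / S z * (z - \<alpha>)" for z
  have D: "(S has_real_derivative deriv S z) (at z)" if "z \<in> {\<alpha><..<\<beta>}" for z
    using diff[OF that] by (simp add: DERIV_deriv_iff_real_differentiable)
  have h_mono: "h y \<le> h z" if "\<alpha> < y" "y \<le> z" "z < \<beta>" for y z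
    using mono_onD[OF mono, of y z] that by (auto simp: h_def)
  have h_eq: "deriv S z * (z - \<alpha>) = h z * S z" if "z \<in> {\<alpha><..<\<beta>}" for z
    using S_pos[of z] that by (simp add: h_def)
  have h_nonneg: "0 \<le> h z" if z: "z \<in> {\<alpha><..<\<beta>}" for z
  proof -
    have "0 \<le> deriv S z"
      by (rule mono_on_imp_deriv_nonneg[of "{\<alpha><..<\<beta>}" S _ z])
        (use D z S_le in \<open>auto intro!: mono_onI\<close>)
    then show ?thesis using S_pos[of z] z by (simp add: h_def)
  qed
  obtain c v l a b z where *: "majorant \<alpha> \<beta> S x c v l" "\<alpha> < c" "c < \<beta>" "0 \<le> l"
    "x < z" "z \<le> \<beta>" "contact S x c v l \<alpha>" "contact S x c v l z" "mean_exit S x \<alpha> z \<le> c"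
    "a \<in> {\<alpha>..x}" "b \<in> {x..\<beta>}" "contact S x c v l a" "contact S x c v l b" "c \<le> mean_exit S x a b"
    using left_saddle[OF Sx] by metis

  \<comment> \<open>The ratio defining \<open>Z(c)\<close>, with its numerator factored; it equals
    \<open>l\<close> precisely at contact points.\<close>
  define R where "R z = (z - \<alpha>) * (z + \<alpha> - 2 * c) / S z" for z
  have num: "(z - \<alpha>) * (z + \<alpha> - 2 * c) = (z - c)\<^sup>2 - (v - l * S x)" for z
    using *(7) S_left by (simp add: contact_def power2_eq_square algebra_simps)
  have R_le: "R z \<le> l" if "\<alpha> < z" "z \<le> \<beta>" for z
    using majorantD[OF *(1-3), of z] S_pos[of z] that
    unfolding R_def num by (simp add: divide_le_eq algebra_simps)
  have R_eq: "R z = l" if "\<alpha> < z" "z \<le> \<beta>" "contact S x c v l z" for z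
    using S_pos[of z] that unfolding R_def num by (simp add: contact_def divide_eq_eq algebra_simps)
  have R_deriv: "(R has_real_derivative (2 * (z - c) - (z + \<alpha> - 2 * c) * h z) / S z) (at z)"
    if z: "z \<in> {\<alpha><..<\<beta>}" for z
  proof -
    have "0 < S z" using S_pos z by auto
    have "(R has_real_derivative
        ((z - \<alpha>) * 1 + 1 * (z + \<alpha> - 2 * c)) * S z / (S z * S z) -
        (z + \<alpha> - 2 * c) * (deriv S z * (z - \<alpha>)) / (S z * S z)) (at z)"
      unfolding R_def using \<open>0 < S z\<close>
      by (auto intro!: derivative_eq_intros D[OF z] simp: diff_divide_distrib algebra_simps)
    then show ?thesis
      unfolding h_eq[OF z] by (rule DERIV_cong) (use \<open>0 < S z\<close> in \<open>simp add: field_simps\<close>)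
  qed
  \<comment> \<open>At an interior contact \<open>y\<close> the ratio is maximal, which forces
    \<open>h y = 2 * (y - c) / (y + \<alpha> - 2 * c)\<close>. The quotient decreases strictly in
    \<open>y\<close> because \<alpha> is less than \<open>c\<close>, whereas \<open>h\<close> does
    not decrease. Hence \<open>R\<close> falls strictly after \<open>y\<close> and cannot be
    \<open>l\<close> again at \<open>w\<close>.\<close>
  have unique: False if y: "\<alpha> < y" "y < w" "w \<le> \<beta>" "contact S x c v l y" "contact S x c v l w" for y w
  proof -
    have pos: "0 \<le> (y - \<alpha>) * (y + \<alpha> - 2 * c) / S y"
      using R_eq[of y] y *(4) by (auto simp: R_def)
    have Sy: "0 < S y" "0 < S w" using S_pos y by auto
    have "0 \<le> y + \<alpha> - 2 * c"
      using pos Sy y by (auto simp: zero_le_divide_iff zero_le_mult_iff)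
    \<comment> \<open>Otherwise \<open>l = 0\<close>, and both contact points would be
      \<open>2 * c - \<alpha>\<close>.\<close>
    moreover have "y + \<alpha> - 2 * c \<noteq> 0"
    proof
      assume 0: "y + \<alpha> - 2 * c = 0"
      then have "l = 0" using R_eq[of y] y by (simp add: R_def)
      then have "w + \<alpha> - 2 * c = 0" using R_eq[of w] y Sy by (simp add: R_def)
      then show False using 0 y by simp
    qed
    ultimately have dy: "0 < y + \<alpha> - 2 * c" by simp
    have y_in: "y \<in> {\<alpha><..<\<beta>}" using y by auto
    define e where "e = min (y - \<alpha>) (\<beta> - y)"
    have "(2 * (y - c) - (y + \<alpha> - 2 * c) * h y) / S y = 0"
    proof (rule DERIV_local_max[OF R_deriv[OF y_in]])
      show "0 < e" using y by (simp add: e_def)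
      show "\<forall>t. \<bar>y - t\<bar> < e \<longrightarrow> R t \<le> R y"
        using R_le R_eq[of y] y by (auto simp: e_def)
    qed
    then have hy: "(y + \<alpha> - 2 * c) * h y = 2 * (y - c)" using Sy by simp
    have "R w < R y"
    proof (rule DERIV_neg_imp_decreasing_open[OF y(2)])
      fix t assume t: "y < t" "t < w"
      then have t_in: "t \<in> {\<alpha><..<\<beta>}" using y by auto
      have "(2 * (t - c)) * (y + \<alpha> - 2 * c) - (2 * (y - c)) * (t + \<alpha> - 2 * c) = 2 * ((c - \<alpha>) * (y - t))"
        by (simp add: algebra_simps)
      moreover have "(c - \<alpha>) * (y - t) < 0" using t *(2) by (intro mult_pos_neg) auto
      ultimately have "(2 * (t - c)) * (y + \<alpha> - 2 * c) < (y + \<alpha> - 2 * c) * h y * (t + \<alpha> - 2 * c)"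
        unfolding hy by linarith
      also have "\<dots> = (t + \<alpha> - 2 * c) * h y * (y + \<alpha> - 2 * c)" by simp
      finally have "2 * (t - c) < (t + \<alpha> - 2 * c) * h y" using dy by simp
      also have "\<dots> \<le> (t + \<alpha> - 2 * c) * h t"
        using h_mono[of y t] t t_in y dy by (intro mult_left_mono) auto
      finally have "(2 * (t - c) - (t + \<alpha> - 2 * c) * h t) / S t < 0"
        using S_pos[of t] t_in by (simp add: divide_less_0_iff)
      then show "\<exists>d. (R has_real_derivative d) (at t) \<and> d < 0" using R_deriv[OF t_in] by blast
    next
      have "continuous_on {y..w} S" by (rule continuous_on_subset[OF cont_S]) (use y in auto)
      then show "continuous_on {y..w} R"
        unfolding R_def using y by (intro continuous_intros) (auto simp: S_nonzero)
    qed
    then show False using R_eq[of y] R_eq[of w] y by auto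
  qed
  have "a = \<alpha>" using unique[of a z] * by fastforce
  moreover have "b = z" using unique[of b z] unique[of z b] * x_in by fastforce
  ultimately have mean: "mean_exit S x \<alpha> z = c" using *(9,14) by simp
  \<comment> \<open>The variance of the two-point law on \<alpha> and \<open>z\<close>. It is
    bounded by \<open>v\<close> on \<open>(x, \<beta>]\<close> and equals \<open>v\<close> at the
    contact point, so that point maximizes \<open>W\<close>.\<close>
  define W where "W z = (z - \<alpha>)\<^sup>2 * (S x / S z) * (1 - S x / S z)" for z
  have W_le: "W w \<le> v" if "x < w" "w \<le> \<beta>" for w
    unfolding W_def using two_point_variance(2)[OF that] *(1) by blast
  have W_eq: "W z = v"
    unfolding W_def
    using two_point_variance(3)[OF *(5,6) *(7,8)] two_point_variance(1)[OF *(5,6)] mean by simp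
  have "optimal_mixture \<alpha> \<beta> S x (W z) 1 \<alpha> z \<alpha> z"
    unfolding optimal_mixture_def W_eq using * mean x_in by auto

  \<comment> \<open>\<open>B\<close> carries the sign of the derivative of \<open>W\<close>, and
    \<open>B w = 0\<close> is the root equation with denominators cleared. Clearing them adds no
    solution: if \<open>S w = 2 * S x\<close>, then \<open>B w = 2 * S x\<close> is
    positive.\<close>
  define B where "B w = 2 * (S w - S x) - h w * (S w - 2 * S x)" for w
  have W_deriv: "(W has_real_derivative (S x * (w - \<alpha>) / (S w)\<^sup>2) * B w) (at w)"
    if w: "w \<in> {x<..<\<beta>}" for w
  proof -
    have w': "w \<in> {\<alpha><..<\<beta>}" and "0 < S w" using S_pos w x_in by auto
    have W: "W = (\<lambda>w. (w - \<alpha>)\<^sup>2 * (S x * inverse (S w) - (S x * inverse (S w))\<^sup>2))"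
      by (auto simp: W_def fun_eq_iff power2_eq_square divide_inverse algebra_simps)
    have "(W has_real_derivative
        2 * (w - \<alpha>) * (S x * inverse (S w) - (S x * inverse (S w))\<^sup>2) +
        (w - \<alpha>) * (- S x * (inverse (S w))\<^sup>2 + 2 * (S x)\<^sup>2 * (inverse (S w))^3) *
          (deriv S w * (w - \<alpha>))) (at w)"
      unfolding W using \<open>0 < S w\<close>
      by (auto intro!: derivative_eq_intros D[OF w'] simp: power2_eq_square power3_eq_cube algebra_simps)
    then show ?thesis
      unfolding h_eq[OF w'] B_def
      by (rule DERIV_cong)
        (use \<open>0 < S w\<close> in \<open>simp add: field_simps power2_eq_square power3_eq_cube\<close>)
  qed
  let ?root = "left_root \<alpha> \<beta> S x"
  have root_iff: "?root w \<longleftrightarrow> w \<in> {x<..<\<beta>} \<and> B w = 0" for w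
  proof (cases "w \<in> {x<..<\<beta>}")
    case True
    have "0 < S x" using S_pos[of x] x_in by auto
    have "S w / 2 - S x \<noteq> 0 \<and> (S w - S x) / (S w / 2 - S x) = h w \<longleftrightarrow> B w = 0"
    proof (cases "S w / 2 - S x = 0")
      case True
      then have "S w = 2 * S x" by simp
      then show ?thesis using \<open>0 < S x\<close> by (simp add: B_def)
    next
      case False
      then show ?thesis by (simp add: divide_eq_eq B_def algebra_simps)
    qed
    then show ?thesis using True by (auto simp: left_root_def h_def)
  qed (auto simp: left_root_def)
  \<comment> \<open>A root \<open>r\<close> satisfies
    \<open>h r = 2 * (S r - S x) / (S r - 2 * S x)\<close>, with positive denominator since
    \<open>h\<close> is nonnegative. The quotient decreases strictly as \<open>S r\<close> grows
    while \<open>h\<close> does not decrease.\<close>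
  have B_neg: "B w < 0" if r: "?root r" and w: "r < w" "w < \<beta>" for r w
  proof -
    have r: "x < r" "B r = 0" using r by (auto simp: root_iff)
    have S: "0 < S x" "S x < S r" "S r < S w" using S_pos[of x] S_less[of x r] S_less[of r w] r w x_in by auto
    have hr: "h r * (S r - 2 * S x) = 2 * (S r - S x)" using r by (simp add: B_def)
    have "0 \<le> h r" using h_nonneg[of r] r w x_in by auto
    have Sr: "0 < S r - 2 * S x"
    proof (rule ccontr)
      assume "\<not> ?thesis"
      then have "h r * (S r - 2 * S x) \<le> 0" using \<open>0 \<le> h r\<close> by (intro mult_nonneg_nonpos) auto
      then show False using hr S by simp
    qed
    have "(2 * (S w - S x)) * (S r - 2 * S x) - (2 * (S r - S x)) * (S w - 2 * S x) = 2 * (S x * (S r - S w))"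
      by (simp add: algebra_simps)
    moreover have "S x * (S r - S w) < 0" using S by (intro mult_pos_neg) auto
    ultimately have "(2 * (S w - S x)) * (S r - 2 * S x) < h r * (S r - 2 * S x) * (S w - 2 * S x)"
      unfolding hr by linarith
    also have "\<dots> = h r * (S w - 2 * S x) * (S r - 2 * S x)" by simp
    finally have "2 * (S w - S x) < h r * (S w - 2 * S x)" using Sr by simp
    also have "\<dots> \<le> h w * (S w - 2 * S x)"
      using h_mono[of r w] r w x_in Sr S by (intro mult_right_mono) auto
    finally show ?thesis by (simp add: B_def)
  qed
  have root_unique: "w = r" if "?root r" "?root w" for r w
    using B_neg[OF that(1), of w] B_neg[OF that(2), of r] that
    by (cases r w rule: linorder_cases) (auto simp: root_iff)
  have "?root z \<and> (\<forall>w. ?root w \<longrightarrow> w = z) \<or> (\<nexists>w. ?root w) \<and> z = \<beta>"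
  proof (cases "z < \<beta>")
    case True
    define e where "e = min (z - x) (\<beta> - z)"
    have "(S x * (z - \<alpha>) / (S z)\<^sup>2) * B z = 0"
    proof (rule DERIV_local_max[OF W_deriv])
      show "z \<in> {x<..<\<beta>}" using True * by auto
      show "0 < e" using True * by (simp add: e_def)
      show "\<forall>t. \<bar>z - t\<bar> < e \<longrightarrow> W t \<le> W z"
        unfolding W_eq using W_le by (auto simp: e_def)
    qed
    then have "B z = 0" using S_pos[of x] S_pos[of z] x_in * by auto
    then have "?root z" using True * by (simp add: root_iff)
    then show ?thesis using root_unique by blast
  next
    case False
    then have z: "z = \<beta>" using * by simp
    \<comment> \<open>A root would make \<open>W\<close> decrease strictly from there to \<beta>,
      against the maximality of \<open>W \<beta>\<close>.\<close>
    have "\<not> ?root r" for r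
    proof
      assume r: "?root r"
      then have r': "x < r" "r < \<beta>" by (auto simp: root_iff)
      have "W \<beta> < W r"
      proof (rule DERIV_neg_imp_decreasing_open[OF r'(2)])
        fix t assume t: "r < t" "t < \<beta>"
        have "(S x * (t - \<alpha>) / (S t)\<^sup>2) * B t < 0"
          using S_pos[of x] S_pos[of t] t r' x_in B_neg[OF r t] by (intro mult_pos_neg divide_pos_pos) auto
        then show "\<exists>d. (W has_real_derivative d) (at t) \<and> d < 0" using W_deriv[of t] t r' by auto
      next
        have "continuous_on {r..\<beta>} S" by (rule continuous_on_subset[OF cont_S]) (use r' x_in in auto)
        then show "continuous_on {r..\<beta>} W"
          unfolding W_def using r' x_in by (intro continuous_intros) (auto simp: S_nonzero)
      qed
      then show False using W_le[of r] W_eq r' z by simp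
    qed
    then show ?thesis using z by blast
  qed
  then show ?thesis using \<open>optimal_mixture \<alpha> \<beta> S x (W z) 1 \<alpha> z \<alpha> z\<close> unfolding W_def by blast
qed

end

section \<open>Reflection\<close>

text \<open>The constant \<open>k\<close> cancels from all two-point weights. It is taken to be
  \<open>S \<beta>\<close> below, so that the reflected scale vanishes at the new left end.\<close>

lemma mean_exit_reflect:
  "mean_exit (\<lambda>z. k - S (- z)) (- x) a b = - mean_exit S x (- b) (- a)"
proof (cases "a < - x \<and> - x < b")
  case True
  then have "- b < x \<and> x < - a" by auto
  then have "- mean_exit S x (- b) (- a) = - ((- b * (S (- a) - S x) + - a * (S x - S (- b))) / (S (- a) - S (- b)))"
    by (simp add: mean_exit_def)
  also have "\<dots> = (a * (S x - S (- b)) + b * (S (- a) - S x)) / (S (- a) - S (- b))"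
    unfolding minus_divide_left by (rule arg_cong2[where f = "(/)"]) (simp_all add: algebra_simps)
  finally show ?thesis using True by (simp add: mean_exit_def)
next
  case False
  then have "\<not> (- b < x \<and> x < - a)" by auto
  with False show ?thesis by (auto simp: mean_exit_def)
qed

lemma contact_reflect:
  "contact (\<lambda>z. k - S (- z)) (- x) c v l a \<longleftrightarrow> contact S x (- c) v (- l) (- a)"
proof -
  have "(a - c)\<^sup>2 = (- a - - c)\<^sup>2" by (simp add: power2_commute)
  moreover have "v + l * ((k - S (- a)) - (k - S (- (- x)))) = v + - l * (S (- a) - S x)"
    by (simp add: algebra_simps)
  ultimately show ?thesis unfolding contact_def by simp
qed

lemma optimal_mixture_reflect:
  assumes "optimal_mixture (- \<beta>) (- \<alpha>) (\<lambda>z. k - S (- z)) (- x) v p a1 b1 a2 b2"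
  shows "optimal_mixture \<alpha> \<beta> S x v p (- b1) (- a1) (- b2) (- a2)"
proof -
  obtain c l where *: "p \<in> {0..1}" "a1 \<in> {-\<beta>..-x}" "b1 \<in> {-x..-\<alpha>}" "a2 \<in> {-\<beta>..-x}" "b2 \<in> {-x..-\<alpha>}"
      "majorant (- \<beta>) (- \<alpha>) (\<lambda>z. k - S (- z)) (- x) c v l"
      "\<forall>z\<in>{a1, b1, a2, b2}. contact (\<lambda>z. k - S (- z)) (- x) c v l z"
      "p * mean_exit (\<lambda>z. k - S (- z)) (- x) a1 b1 + (1 - p) * mean_exit (\<lambda>z. k - S (- z)) (- x) a2 b2 = c"
    using assms unfolding optimal_mixture_def by blast
  have "majorant \<alpha> \<beta> S x (- c) v (- l)"
    unfolding majorant_def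
  proof
    fix z assume "z \<in> {\<alpha>..\<beta>}"
    then have "(- z - c)\<^sup>2 \<le> v + l * ((k - S (- (- z))) - (k - S (- (- x))))"
      using *(6) unfolding majorant_def by (meson atLeastAtMost_iff neg_le_iff_le)
    moreover have "(- z - c)\<^sup>2 = (z - - c)\<^sup>2" by (simp add: power2_eq_square algebra_simps)
    moreover have "l * ((k - S (- (- z))) - (k - S (- (- x)))) = - l * (S z - S x)" by (simp add: algebra_simps)
    ultimately show "(z - - c)\<^sup>2 \<le> v + - l * (S z - S x)" by simp
  qed
  moreover have "p * mean_exit S x (- b1) (- a1) + (1 - p) * mean_exit S x (- b2) (- a2) = - c"
    using *(8) by (simp add: mean_exit_reflect)
  moreover have "\<forall>z\<in>{- b1, - a1, - b2, - a2}. contact S x (- c) v (- l) z"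
    using *(7) by (simp add: contact_reflect)
  ultimately show ?thesis
    unfolding optimal_mixture_def using *(1-5) by (intro conjI exI[of _ "- c"] exI[of _ "- l"]) auto
qed

lemma Z_set_reflect:
  "Z_set (- \<beta>) (- \<alpha>) (\<lambda>z. S \<beta> - S (- z)) (- c) = uminus ` Y_set \<alpha> \<beta> S c"
proof -
  let ?f = "\<lambda>z. (z\<^sup>2 - (- \<beta>)\<^sup>2 - 2 * - c * (z - - \<beta>)) / (S \<beta> - S (- z))"
  let ?g = "\<lambda>y. (y\<^sup>2 - \<beta>\<^sup>2 - 2 * c * (y - \<beta>)) / (S \<beta> - S y)"
  have fg: "?f (- y) = ?g y" for y by (simp add: algebra_simps)
  have "is_arg_max ?f (\<lambda>z. z \<in> {-\<beta><..-\<alpha>}) (- y) \<longleftrightarrow> is_arg_max ?g (\<lambda>y. y \<in> {\<alpha>..<\<beta>}) y" for y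
  proof -
    have "(\<exists>w. w \<in> {-\<beta><..-\<alpha>} \<and> ?f (- y) < ?f w) \<longleftrightarrow> (\<exists>w. w \<in> {\<alpha>..<\<beta>} \<and> ?g y < ?g w)"
    proof
      assume "\<exists>w. w \<in> {-\<beta><..-\<alpha>} \<and> ?f (- y) < ?f w"
      then obtain w where "w \<in> {-\<beta><..-\<alpha>}" "?f (- y) < ?f (- (- w))" by auto
      then show "\<exists>w. w \<in> {\<alpha>..<\<beta>} \<and> ?g y < ?g w"
        unfolding fg by (intro exI[of _ "- w"]) auto
    next
      assume "\<exists>w. w \<in> {\<alpha>..<\<beta>} \<and> ?g y < ?g w"
      then obtain w where "w \<in> {\<alpha>..<\<beta>}" "?g y < ?g w" by blast
      then show "\<exists>w. w \<in> {-\<beta><..-\<alpha>} \<and> ?f (- y) < ?f w"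
        unfolding fg[symmetric] by (intro exI[of _ "- w"]) auto
    qed
    then show ?thesis unfolding is_arg_max_def by auto
  qed
  then have "- y \<in> Z_set (- \<beta>) (- \<alpha>) (\<lambda>z. S \<beta> - S (- z)) (- c) \<longleftrightarrow> y \<in> Y_set \<alpha> \<beta> S c" for y
    unfolding Z_set_def Y_set_def by simp
  note iff = this
  show ?thesis
  proof (rule set_eqI)
    fix z
    show "z \<in> Z_set (- \<beta>) (- \<alpha>) (\<lambda>z. S \<beta> - S (- z)) (- c) \<longleftrightarrow> z \<in> uminus ` Y_set \<alpha> \<beta> S c"
      using iff[of "- z"] by (auto simp: image_iff intro: bexI[of _ "- z"])
  qed
qed

lemma deriv_reflect:
  fixes S :: "real \<Rightarrow> real"
  assumes "S differentiable (at (- z))"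
  shows "((\<lambda>z. k - S (- z)) has_real_derivative deriv S (- z)) (at z)"
proof -
  have "(S has_real_derivative deriv S (- z)) (at (- z))"
    using assms by (simp add: DERIV_deriv_iff_real_differentiable)
  from DERIV_mirror[THEN iffD1, OF this] show ?thesis
    by (auto intro!: derivative_eq_intros)
qed

lemma left_root_reflect:
  assumes "\<And>z. z \<in> {\<alpha><..<\<beta>} \<Longrightarrow> S differentiable (at z)" and "x < \<beta>"
  shows "left_root (- \<beta>) (- \<alpha>) (\<lambda>z. S \<beta> - S (- z)) (- x) z \<longleftrightarrow> right_root \<alpha> \<beta> S x (- z)"
proof (cases "- z \<in> {\<alpha><..<x}")
  case True
  then have d: "deriv (\<lambda>z. S \<beta> - S (- z)) z = deriv S (- z)"
    using assms by (intro DERIV_imp_deriv deriv_reflect) auto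
  have e: "(S \<beta> - S (- z)) / 2 - (S \<beta> - S (- (- x))) = S x - S (- z) / 2 - S \<beta> / 2"
    "(S \<beta> - S (- z)) - (S \<beta> - S (- (- x))) = S x - S (- z)" "z - - \<beta> = \<beta> - - z" by (simp_all add: field_simps)
  have "z \<in> {- x<..<- \<alpha>}" using True by auto
  then show ?thesis using True unfolding left_root_def right_root_def d e by (simp only: simp_thms)
next
  case False
  then show ?thesis by (auto simp: left_root_def right_root_def)
qed

section \<open>The case \<open>S \<beta> / 2 < S x\<close>\<close>

context scale
begin

abbreviation S' :: "real \<Rightarrow> real" where
  "S' \<equiv> \<lambda>z. S \<beta> - S (- z)"

lemma scale_reflect: "scale (- \<beta>) (- \<alpha>) S' (- x)"
proof
  show "continuous_on {- \<beta>..- \<alpha>} S'"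
    by (intro continuous_intros continuous_on_compose2[OF cont_S]) auto
  show "S \<beta> - S (- y) < S \<beta> - S (- z)" if "- \<beta> \<le> y" "y < z" "z \<le> - \<alpha>" for y z
    using S_less[of "- z" "- y"] that by simp
qed (use x_in in auto)

lemma optimal_right_mixture:
  assumes "S \<beta> / 2 < S x"
  shows "\<exists>v p y a b. optimal_mixture \<alpha> \<beta> S x v p y \<beta> a b"
proof -
  interpret r: scale "- \<beta>" "- \<alpha>" S' "- x" by (rule scale_reflect)
  have "S \<beta> - S (- (- x)) \<le> (S \<beta> - S (- (- \<alpha>))) / 2" using assms by (simp add: S_left)
  from r.optimal_left_mixture[OF this] obtain v p a b z where
    "optimal_mixture (- \<beta>) (- \<alpha>) S' (- x) v p a b (- \<beta>) z" by blast
  \<comment> \<open>Reflection leaves the one-sided interval in second place; the swap moves it to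
    the first, with weight \<open>1 - p\<close>.\<close>
  from optimal_mixture_swap[OF optimal_mixture_reflect[OF this]]
  have "optimal_mixture \<alpha> \<beta> S x v (1 - p) (- z) \<beta> (- b) (- a)" by simp
  then show ?thesis by blast
qed

lemma optimal_right_mixture_one_sided:
  assumes Sx: "S \<beta> / 2 < S x"
    and cond: "\<And>c. c \<in> {\<alpha><..<\<beta>} \<Longrightarrow> \<exists>u\<in>Y_set \<alpha> \<beta> S c. \<exists>v\<in>Y_set \<alpha> \<beta> S c. u \<noteq> v \<Longrightarrow>
      Sup (Y_set \<alpha> \<beta> S c) \<in> {\<alpha><..<\<beta>} \<Longrightarrow>
      mean_exit S (Sup (Y_set \<alpha> \<beta> S c)) (Inf (Y_set \<alpha> \<beta> S c)) \<beta> < c"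
  shows "\<exists>v p y1 y2. optimal_mixture \<alpha> \<beta> S x v p y1 \<beta> y2 \<beta>"
proof -
  interpret r: scale "- \<beta>" "- \<alpha>" S' "- x" by (rule scale_reflect)
  let ?Z = "Z_set (- \<beta>) (- \<alpha>) S'"
  have Sx': "S \<beta> - S (- (- x)) \<le> (S \<beta> - S (- (- \<alpha>))) / 2" using Sx by (simp add: S_left)
  have "c < mean_exit S' (Inf (?Z c)) (- \<beta>) (Sup (?Z c))"
    if c: "c \<in> {- \<beta><..<- \<alpha>}" and uv: "\<exists>u\<in>?Z c. \<exists>v\<in>?Z c. u \<noteq> v"
      and inf: "Inf (?Z c) \<in> {- \<beta><..<- \<alpha>}" for c
  proof -
    define Y where "Y = Y_set \<alpha> \<beta> S (- c)"
    have Z: "?Z c = uminus ` Y" using Z_set_reflect[of \<beta> \<alpha> S "- c"] by (simp add: Y_def)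
    have "\<exists>u\<in>Y. \<exists>v\<in>Y. u \<noteq> v" using uv unfolding Z by auto
    \<comment> \<open>The infimum of a set of reals is defined as the negated supremum of the
      negated set, so both equations hold without boundedness.\<close>
    moreover have Inf_Sup: "Inf (?Z c) = - Sup Y" "Sup (?Z c) = - Inf Y"
      unfolding Z by (simp_all add: Inf_real_def image_image)
    ultimately have "mean_exit S (Sup Y) (Inf Y) \<beta> < - c"
      using cond[of "- c"] c inf by (auto simp: Y_def)
    with Inf_Sup show ?thesis by (simp add: mean_exit_reflect)
  qed
  from r.optimal_left_mixture_one_sided[OF Sx' this] obtain v p z1 z2 where
    "optimal_mixture (- \<beta>) (- \<alpha>) S' (- x) v p (- \<beta>) z1 (- \<beta>) z2" by blast
  from optimal_mixture_reflect[OF this] show ?thesis by auto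
qed

lemma optimal_right_interval:
  assumes Sx: "S \<beta> / 2 < S x"
    and diff: "\<And>z. z \<in> {\<alpha><..<\<beta>} \<Longrightarrow> S differentiable (at z)"
    and mono: "antimono_on {\<alpha><..<\<beta>} (\<lambda>y. deriv S y / (S \<beta> - S y) * (\<beta> - y))"
  shows "\<exists>y. (right_root \<alpha> \<beta> S x y \<and> (\<forall>w. right_root \<alpha> \<beta> S x w \<longrightarrow> w = y) \<or>
               (\<nexists>w. right_root \<alpha> \<beta> S x w) \<and> y = \<alpha>) \<and>
      optimal_mixture \<alpha> \<beta> S x
        ((\<beta> - y)\<^sup>2 * ((S \<beta> - S x) / (S \<beta> - S y)) * ((S x - S y) / (S \<beta> - S y))) 1 y \<beta> y \<beta>"
proof -
  interpret r: scale "- \<beta>" "- \<alpha>" S' "- x" by (rule scale_reflect)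
  have Sx': "S \<beta> - S (- (- x)) \<le> (S \<beta> - S (- (- \<alpha>))) / 2" using Sx by (simp add: S_left)
  have D: "(S' has_real_derivative deriv S (- z)) (at z)" if "z \<in> {- \<beta><..<- \<alpha>}" for z
    using diff that by (intro deriv_reflect) auto
  have diff': "S' differentiable (at z)" if "z \<in> {- \<beta><..<- \<alpha>}" for z
    using D[OF that] real_differentiable_def by blast
  have mono': "mono_on {- \<beta><..<- \<alpha>}
      (\<lambda>z. deriv S' z / (S \<beta> - S (- z)) * (z - - \<beta>))"
  proof (rule mono_onI)
    fix y z assume yz: "y \<in> {- \<beta><..<- \<alpha>}" "z \<in> {- \<beta><..<- \<alpha>}" "y \<le> z"
    then have "deriv S (- y) / (S \<beta> - S (- y)) * (\<beta> - - y) \<le> deriv S (- z) / (S \<beta> - S (- z)) * (\<beta> - - z)"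
      using monotone_onD[OF mono, of "- z" "- y"] by auto
    then show "deriv S' y / (S \<beta> - S (- y)) * (y - - \<beta>) \<le>
        deriv S' z / (S \<beta> - S (- z)) * (z - - \<beta>)"
      using DERIV_imp_deriv[OF D] yz by (simp add: add.commute)
  qed
  note root = left_root_reflect[of \<alpha> \<beta> S x, OF diff]
  from r.optimal_left_interval[OF Sx' diff' mono'] obtain z where
    z: "left_root (- \<beta>) (- \<alpha>) S' (- x) z \<and>
        (\<forall>w. left_root (- \<beta>) (- \<alpha>) S' (- x) w \<longrightarrow> w = z) \<or>
       (\<nexists>w. left_root (- \<beta>) (- \<alpha>) S' (- x) w) \<and> z = - \<alpha>"
    and opt: "optimal_mixture (- \<beta>) (- \<alpha>) S' (- x)
       ((z - - \<beta>)\<^sup>2 * ((S \<beta> - S (- (- x))) / (S \<beta> - S (- z))) *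
         (1 - (S \<beta> - S (- (- x))) / (S \<beta> - S (- z)))) 1 (- \<beta>) z (- \<beta>) z"
    by blast
  have root': "left_root (- \<beta>) (- \<alpha>) S' (- x) w \<longleftrightarrow> right_root \<alpha> \<beta> S x (- w)" for w
    using root x_in by auto
  from optimal_mixture_reflect[OF opt]
  have opt': "optimal_mixture \<alpha> \<beta> S x
       ((\<beta> - - z)\<^sup>2 * ((S \<beta> - S x) / (S \<beta> - S (- z))) *
         (1 - (S \<beta> - S x) / (S \<beta> - S (- z)))) 1 (- z) \<beta> (- z) \<beta>" by (simp add: add.commute)
  then have "- z \<in> {\<alpha>..x}" by (simp add: optimal_mixture_def)
  then have "S (- z) < S \<beta>" using x_in by (intro S_less) auto
  then have "1 - (S \<beta> - S x) / (S \<beta> - S (- z)) = (S x - S (- z)) / (S \<beta> - S (- z))"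
    by (simp add: field_simps)
  moreover have "right_root \<alpha> \<beta> S x (- z) \<and> (\<forall>w. right_root \<alpha> \<beta> S x w \<longrightarrow> w = - z) \<or>
      (\<nexists>w. right_root \<alpha> \<beta> S x w) \<and> - z = \<alpha>"
    using z unfolding root' by (metis minus_minus)
  ultimately show ?thesis using opt' by (intro exI[of _ "- z"]) simp
qed

end

section \<open>Entry times and measurability\<close>

text \<open>Lets statements about real times be tested at countably many rational ones.\<close>

lemma continuous_near_rational:
  fixes f :: "real \<Rightarrow> real"
  assumes cont: "continuous_on {0..} f" and U: "open U" "f s \<in> U" and s: "0 \<le> s" "s < t"
  shows "\<exists>q\<in>\<rat>. s < q \<and> q < t \<and> f q \<in> U"
proof -
  have "(f \<longlongrightarrow> f s) (at s within {0..})" using cont s by (auto simp: continuous_on)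
  then have "\<forall>\<^sub>F r in at s within {0..}. f r \<in> U" using U by (rule topological_tendstoD)
  then obtain d where d: "d > 0" "\<And>r. 0 \<le> r \<Longrightarrow> dist r s < d \<Longrightarrow> r \<noteq> s \<Longrightarrow> f r \<in> U"
    unfolding eventually_at by auto
  obtain q where q: "q \<in> \<rat>" "s < q" "q < min t (s + d)"
    using Rats_dense_in_real[of s "min t (s + d)"] s d(1) by auto
  then show ?thesis using d(2)[of q] s by (intro bexI[of _ q]) (auto simp: dist_real_def)
qed

text \<open>A common form of hitting, exit and boundary times, so that attainment and measurability
  are proved once, for closed \<open>C\<close>.\<close>

definition entry_time :: "(real \<Rightarrow> 'a \<Rightarrow> real) \<Rightarrow> real set \<Rightarrow> 'a \<Rightarrow> ennreal" where
  "entry_time X C w = (INF t\<in>{t. 0 \<le> t \<and> X t w \<in> C}. ennreal t)"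

lemma hitting_time_eq_entry: "hitting_time X z = entry_time X {z}"
  by (auto simp: hitting_time_def entry_time_def fun_eq_iff)

lemma exit_time_eq_entry: "exit_time X z y = entry_time X (- {z<..<y})"
  by (auto simp: exit_time_def entry_time_def fun_eq_iff)

lemma boundary_time_eq_entry: "boundary_time \<alpha> \<beta> X = entry_time X {\<alpha>, \<beta>}"
  by (auto simp: boundary_time_def entry_time_def fun_eq_iff)

lemma entry_time_le: "0 \<le> t \<Longrightarrow> X t w \<in> C \<Longrightarrow> entry_time X C w \<le> ennreal t"
  unfolding entry_time_def by (intro INF_lower) auto

text \<open>The infimum is attained: a path that avoids a closed set up to \<open>t\<close> avoids
  it for a short while longer, which puts the entry time strictly beyond \<open>t\<close>.\<close>

lemma entry_time_le_iff:
  assumes cont: "continuous_on {0..} (\<lambda>t. X t w)" and C: "closed C" and t: "0 \<le> t"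
  shows "entry_time X C w \<le> ennreal t \<longleftrightarrow> (\<exists>s\<in>{0..t}. X s w \<in> C)"
proof
  assume le: "entry_time X C w \<le> ennreal t"
  show "\<exists>s\<in>{0..t}. X s w \<in> C"
  proof (rule ccontr)
    assume no: "\<not> ?thesis"
    have "((\<lambda>t. X t w) \<longlongrightarrow> X t w) (at t within {0..})"
      using cont t by (auto simp: continuous_on)
    then have "\<forall>\<^sub>F r in at t within {0..}. X r w \<in> - C"
      by (rule topological_tendstoD) (use C no t in auto)
    then obtain d where d: "d > 0" "\<And>r. 0 \<le> r \<Longrightarrow> dist r t < d \<Longrightarrow> r \<noteq> t \<Longrightarrow> X r w \<notin> C"
      unfolding eventually_at by auto
    have "t + d \<le> r" if "0 \<le> r" "X r w \<in> C" for r
      using no d(2)[of r] that by (force simp: dist_real_def)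
    then have "ennreal (t + d) \<le> entry_time X C w"
      unfolding entry_time_def by (intro INF_greatest ennreal_leI) auto
    with le have "ennreal (t + d) \<le> ennreal t" by (rule order_trans[rotated])
    then show False using d(1) t by simp
  qed
next
  assume "\<exists>s\<in>{0..t}. X s w \<in> C"
  then obtain s where s: "s \<in> {0..t}" "X s w \<in> C" by blast
  then have "entry_time X C w \<le> ennreal s" by (intro entry_time_le) auto
  also have "\<dots> \<le> ennreal t" using s by (intro ennreal_leI) auto
  finally show "entry_time X C w \<le> ennreal t" .
qed

lemma entry_time_finiteE:
  assumes cont: "continuous_on {0..} (\<lambda>t. X t w)" and C: "closed C" and fin: "entry_time X C w < \<top>"
  obtains t where "0 \<le> t" "entry_time X C w = ennreal t" "X t w \<in> C"
    "\<And>s. 0 \<le> s \<Longrightarrow> s < t \<Longrightarrow> X s w \<notin> C"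
proof -
  obtain t where t: "0 \<le> t" "entry_time X C w = ennreal t"
    using fin by (cases "entry_time X C w") auto
  have before: "t \<le> s" if "0 \<le> s" "X s w \<in> C" for s
    using entry_time_le[of s X w C] that t by simp
  obtain s where "s \<in> {0..t}" "X s w \<in> C"
    using entry_time_le_iff[where X = X and w = w, OF cont C t(1)] t(2) by auto
  then have "X t w \<in> C" using before[of s] by auto
  then show ?thesis using that[OF t] before by fastforce
qed

lemma entry_time_top_iff: "entry_time X C w = \<top> \<longleftrightarrow> (\<forall>t\<ge>0. X t w \<notin> C)"
proof
  assume "entry_time X C w = \<top>"
  then show "\<forall>t\<ge>0. X t w \<notin> C"
    using entry_time_le[of _ X w C] by (metis ennreal_neq_top neq_top_trans)
next
  assume "\<forall>t\<ge>0. X t w \<notin> C"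
  then have "{t. 0 \<le> t \<and> X t w \<in> C} = {}" by auto
  then show "entry_time X C w = \<top>" unfolding entry_time_def by simp
qed

lemma entry_time_finite_iff: "entry_time X C w < \<top> \<longleftrightarrow> (\<exists>t\<ge>0. X t w \<in> C)"
  using entry_time_top_iff[of X C w] by (auto simp: less_top[symmetric])

section \<open>Filtrations and stopping times\<close>

lemma space_natural_filtration: "space (natural_filtration \<Omega> X t) = \<Omega>"
  unfolding natural_filtration_def by (rule space_measure_of) auto

lemma space_randomized_filtration: "space (randomized_filtration \<Omega> U X t) = \<Omega>"
  unfolding randomized_filtration_def by (rule space_measure_of) auto

lemma sets_natural_filtration: "sets (natural_filtration \<Omega> X t) =
    sigma_sets \<Omega> {X s -` B \<inter> \<Omega> | s B. 0 \<le> s \<and> ennreal s \<le> t \<and> B \<in> sets borel}"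
  unfolding natural_filtration_def by (rule sets_measure_of) auto

lemma sets_randomized_filtration: "sets (randomized_filtration \<Omega> U X t) =
    sigma_sets \<Omega> ({U -` B \<inter> \<Omega> | B. B \<in> sets borel} \<union>
             {X s -` B \<inter> \<Omega> | s B. 0 \<le> s \<and> ennreal s \<le> t \<and> B \<in> sets borel})"
  unfolding randomized_filtration_def by (rule sets_measure_of) auto

lemma measurable_natural_filtration:
  "0 \<le> s \<Longrightarrow> ennreal s \<le> t \<Longrightarrow> X s \<in> borel_measurable (natural_filtration \<Omega> X t)"
  by (rule measurableI) (auto simp: space_natural_filtration sets_natural_filtration)

lemma measurable_randomized_filtration:
  "0 \<le> s \<Longrightarrow> ennreal s \<le> t \<Longrightarrow> X s \<in> borel_measurable (randomized_filtration \<Omega> U X t)"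
  by (rule measurableI) (auto simp: space_randomized_filtration sets_randomized_filtration)

lemma measurable_U_randomized_filtration: "U \<in> borel_measurable (randomized_filtration \<Omega> U X t)"
  by (rule measurableI)
    (auto simp: space_randomized_filtration sets_randomized_filtration intro!: sigma_sets.Basic)

lemma filtration_natural: "filtration \<Omega> (natural_filtration \<Omega> X)"
proof
  show "sets (natural_filtration \<Omega> X i) \<subseteq> sets (natural_filtration \<Omega> X j)" if "i \<le> j" for i j
    unfolding sets_natural_filtration using that by (intro sigma_sets_mono') (auto intro: order_trans)
qed (rule space_natural_filtration)

lemma filtration_randomized: "filtration \<Omega> (randomized_filtration \<Omega> U X)"
proof
  show "sets (randomized_filtration \<Omega> U X i) \<subseteq> sets (randomized_filtration \<Omega> U X j)" if "i \<le> j" for i j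
    unfolding sets_randomized_filtration using that
    by (intro sigma_sets_mono' Un_mono) (auto intro: order_trans)
qed (rule space_randomized_filtration)

context linear_diffusion
begin

abbreviation "I \<equiv> {\<alpha><..<\<beta>}"
abbreviation "natural \<equiv> natural_filtration (space M) X"
abbreviation "stopped \<equiv> value_at \<alpha> \<beta> X"
abbreviation "limit \<equiv> X_infinity \<alpha> \<beta> X"

lemma sets_natural_le: "sets (natural t) \<subseteq> sets M"
  unfolding sets_natural_filtration
  by (intro sets.sigma_sets_subset) (auto intro: measurable_sets[OF X_measurable])

lemma natural_measurable_M:
  "f \<in> measurable (natural t) N \<Longrightarrow> f \<in> measurable M N"
  using sets_natural_le[of t] by (auto simp: measurable_def space_natural_filtration)

text \<open>On the compact interval \<open>[0, t]\<close> the path meets \<open>C\<close> if and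
  only if its distance to \<open>C\<close> has infimum zero, and by continuity this infimum is
  visible at countably many times.\<close>

lemma entry_pred:
  assumes N: "space N = space M" "\<And>s. 0 \<le> s \<Longrightarrow> s \<le> t \<Longrightarrow> X s \<in> borel_measurable N"
    and C: "closed C" and t: "0 \<le> t"
  shows "Measurable.pred N (\<lambda>w. \<exists>s\<in>{0..t}. X s w \<in> C)"
proof (cases "C = {}")
  case False
  \<comment> \<open>The horizon is added by hand: a visit exactly at \<open>t\<close> may not be
    seen at rational times up to \<open>t\<close> through approximation from the right.\<close>
  define Q where "Q = insert t (\<rat> \<inter> {0..t})"
  have Q: "countable Q" "Q \<subseteq> {0..t}"
    using t by (auto simp: Q_def intro: countable_rat countable_Int1)
  have eq: "(\<exists>s\<in>{0..t}. X s w \<in> C) \<longleftrightarrow> (\<forall>n. \<exists>q\<in>Q. infdist (X q w) C < inverse (real (Suc n)))"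
    if w: "w \<in> space N" for w
  proof
    assume "\<exists>s\<in>{0..t}. X s w \<in> C"
    then obtain s where s: "0 \<le> s" "s \<le> t" "X s w \<in> C" by auto
    show "\<forall>n. \<exists>q\<in>Q. infdist (X q w) C < inverse (real (Suc n))"
    proof
      fix n
      let ?V = "{y. infdist y C < inverse (real (Suc n))}"
      have V: "open ?V" "X s w \<in> ?V"
        using s by (auto intro!: open_Collect_less continuous_intros)
      show "\<exists>q\<in>Q. infdist (X q w) C < inverse (real (Suc n))"
      proof (cases "s = t")
        case True
        then show ?thesis using V by (auto simp: Q_def)
      next
        case False
        then obtain q where "q \<in> \<rat>" "s < q" "q < t" "X q w \<in> ?V"
          using continuous_near_rational[OF X_continuous V(1), of w s t] V(2) s w N(1) by auto
        then show ?thesis using s by (intro bexI[of _ q]) (auto simp: Q_def)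
      qed
    qed
  next
    assume near: "\<forall>n. \<exists>q\<in>Q. infdist (X q w) C < inverse (real (Suc n))"
    have "continuous_on {0..t} (\<lambda>s. infdist (X s w) C)"
      using X_continuous[of w] w N(1) by (intro continuous_intros) (auto intro: continuous_on_subset)
    then obtain s where s: "s \<in> {0..t}" "\<And>r. r \<in> {0..t} \<Longrightarrow> infdist (X s w) C \<le> infdist (X r w) C"
      using continuous_attains_inf[of "{0..t}" "\<lambda>s. infdist (X s w) C"] t by auto
    have "infdist (X s w) C < inverse (real (Suc n))" for n
      using near s(2) Q(2) by (meson le_less_trans subsetD)
    then have "infdist (X s w) C \<le> 0"
      by (metis less_eq_real_def not_less reals_Archimedean)
    then have "infdist (X s w) C = 0" using infdist_nonneg[of "X s w" C] by simp
    then show "\<exists>s\<in>{0..t}. X s w \<in> C" using in_closed_iff_infdist_zero[OF C False] s(1) by auto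
  qed
  have [measurable]: "(\<lambda>w. infdist (X q w) C) \<in> borel_measurable N" if "q \<in> Q" for q
    using N(2)[of q] Q(2) that
    by (intro borel_measurable_continuous_on[where f = "\<lambda>y. infdist y C"] continuous_intros) auto
  have "Measurable.pred N (\<lambda>w. \<forall>n. \<exists>q\<in>Q. infdist (X q w) C < inverse (real (Suc n)))"
    using Q(1) by measurable
  then show ?thesis using measurable_cong[of N, OF eq] by (subst measurable_cong[OF eq]) auto
qed simp

lemma entry_stopping_time:
  assumes F: "\<And>t. space (F t) = space M"
      "\<And>s t. 0 \<le> s \<Longrightarrow> ennreal s \<le> t \<Longrightarrow> X s \<in> borel_measurable (F t)" and C: "closed C"
  shows "stopping_time F (entry_time X C)"
proof
  fix t :: ennreal
  show "Measurable.pred (F t) (\<lambda>w. entry_time X C w \<le> t)"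
  proof (cases t)
    case (real r)
    have "Measurable.pred (F t) (\<lambda>w. \<exists>s\<in>{0..r}. X s w \<in> C)"
      using F real C by (intro entry_pred) (auto simp: ennreal_leI)
    then show ?thesis
      unfolding real using entry_time_le_iff[where X = X, OF X_continuous C] real F(1)
      by (subst measurable_cong[where g = "\<lambda>w. \<exists>s\<in>{0..r}. X s w \<in> C"]) auto
  qed simp
qed

lemma entry_stopping_time_natural:
  "closed C \<Longrightarrow> stopping_time (natural) (entry_time X C)"
  by (rule entry_stopping_time) (auto intro: measurable_natural_filtration simp: space_natural_filtration)

lemma entry_stopping_time_randomized:
  "closed C \<Longrightarrow> stopping_time (randomized_filtration (space M) U X) (entry_time X C)"
  by (rule entry_stopping_time) (auto intro: measurable_randomized_filtration simp: space_randomized_filtration)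

lemma entry_measurable_natural:
  "closed C \<Longrightarrow> entry_time X C \<in> borel_measurable (natural \<top>)"
  using measurable_stopping_time[OF entry_stopping_time_natural, of C "natural \<top>"]
    filtration.sets_F_mono[OF filtration_natural, of _ \<top>] by (auto simp: space_natural_filtration)

lemma entry_measurable: "closed C \<Longrightarrow> entry_time X C \<in> borel_measurable M"
  using entry_measurable_natural natural_measurable_M by blast

section \<open>Measurability of terminal and stopped values\<close>

lemma X_infinity_eq:
  assumes w: "w \<in> space M"
  shows "limit w =
    (if X 0 w \<in> {\<alpha>, \<beta>} then 0 else real_of_ereal (Limsup at_top (\<lambda>t. ereal (X t w))))"
proof (cases "boundary_time \<alpha> \<beta> X w = \<top>")
  case True
  then have "X 0 w \<notin> {\<alpha>, \<beta>}" unfolding boundary_time_eq_entry entry_time_top_iff by blast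
  then show ?thesis using True by (simp add: X_infinity_def)
next
  case False
  then obtain r where r: "0 \<le> r" "boundary_time \<alpha> \<beta> X w = ennreal r" "X r w \<in> {\<alpha>, \<beta>}"
      "\<And>s. 0 \<le> s \<Longrightarrow> s < r \<Longrightarrow> X s w \<notin> {\<alpha>, \<beta>}"
    unfolding boundary_time_eq_entry
    using entry_time_finiteE[of X w "{\<alpha>, \<beta>}"] X_continuous[OF w]
    by (metis closed_insert closed_singleton less_top)
  show ?thesis
  proof (cases "r = 0")
    case True
    \<comment> \<open>For a start on the boundary the filter lives on the empty interval
      \<open>{0..<0}\<close>; its upper limit is minus infinity, which \<open>real_of_ereal\<close>
      sends to \<open>0\<close>.\<close>
    then show ?thesis using r by (simp add: X_infinity_def bot_ereal_def)
  next
    case False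
    then have X0: "X 0 w \<notin> {\<alpha>, \<beta>}" using r(1,4) by simp
    have "((\<lambda>t. X t w) \<longlongrightarrow> X r w) (at r within {0..})"
      using X_continuous[OF w] r(1) by (simp add: continuous_on)
    then have "((\<lambda>t. X t w) \<longlongrightarrow> X r w) (at r within {0..<r})"
      by (rule tendsto_within_subset) auto
    then have "((\<lambda>t. ereal (X t w)) \<longlongrightarrow> ereal (X r w)) (at r within {0..<r})"
      by (rule tendsto_ereal)
    moreover have "{0..<r} - {r} = {0..<r}" by auto
    then have "at r within {0..<r} \<noteq> bot"
      using False r(1) by (simp add: at_within_eq_bot_iff)
    ultimately have "Limsup (at r within {0..<r}) (\<lambda>t. ereal (X t w)) = ereal (X r w)"
      by (intro lim_imp_Limsup) auto
    \<comment> \<open>After the boundary time the path is constant, so the limit there and the limit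
      at infinity agree.\<close>
    moreover have "\<forall>\<^sub>F t in at_top. ereal (X t w) = ereal (X r w)"
      using eventually_ge_at_top[of r] by eventually_elim (rule arg_cong[where f = ereal], rule X_boundary, use r w in auto)
    then have "((\<lambda>t. ereal (X t w)) \<longlongrightarrow> ereal (X r w)) at_top"
      by (rule tendsto_eventually)
    then have "Limsup at_top (\<lambda>t. ereal (X t w)) = ereal (X r w)"
      by (intro lim_imp_Limsup) auto
    ultimately show ?thesis using X0 r(1,2) by (simp add: X_infinity_def)
  qed
qed

text \<open>Countable infima and suprema replace the uncountable ones, which gives measurability of
  the terminal value.\<close>

lemma Limsup_path_eq:
  assumes w: "w \<in> space M"
  shows "Limsup at_top (\<lambda>t. ereal (X t w)) = (INF n. SUP q\<in>\<rat> \<inter> {real n..}. ereal (X q w))"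
proof (rule antisym)
  show "Limsup at_top (\<lambda>t. ereal (X t w)) \<le> (INF n. SUP q\<in>\<rat> \<inter> {real n..}. ereal (X q w))"
  proof (rule INF_greatest)
    fix n
    have "ereal (X t w) \<le> (SUP q\<in>\<rat> \<inter> {real n..}. ereal (X q w))" if t: "real n \<le> t" for t
    proof (rule ereal_le_epsilon2)
      fix e :: real assume e: "0 < e"
      obtain q where q: "q \<in> \<rat>" "t < q" "X q w \<in> {X t w - e<..}"
        using continuous_near_rational[OF X_continuous[OF w], of "{X t w - e<..}" t "t + 1"] t e by auto
      have "ereal (X t w) \<le> ereal (X q w) + ereal e" using q by simp
      also have "\<dots> \<le> (SUP q\<in>\<rat> \<inter> {real n..}. ereal (X q w)) + ereal e"
        using q t by (intro add_right_mono SUP_upper) auto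
      finally show "ereal (X t w) \<le> (SUP q\<in>\<rat> \<inter> {real n..}. ereal (X q w)) + ereal e" .
    qed
    then show "Limsup at_top (\<lambda>t. ereal (X t w)) \<le> (SUP q\<in>\<rat> \<inter> {real n..}. ereal (X q w))"
      by (intro Limsup_bounded) (auto intro: eventually_mono[OF eventually_ge_at_top[of "real n"]])
  qed
  show "(INF n. SUP q\<in>\<rat> \<inter> {real n..}. ereal (X q w)) \<le> Limsup at_top (\<lambda>t. ereal (X t w))"
    unfolding Limsup_def
  proof (rule INF_greatest)
    fix P assume "P \<in> {P. eventually P (at_top :: real filter)}"
    then obtain r where r: "\<And>t. r \<le> t \<Longrightarrow> P t" by (auto simp: eventually_at_top_linorder)
    obtain n where "r \<le> real n" using real_arch_simple by blast
    have "(INF n. SUP q\<in>\<rat> \<inter> {real n..}. ereal (X q w)) \<le> (SUP q\<in>\<rat> \<inter> {real n..}. ereal (X q w))"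
      by (rule INF_lower) simp
    also have "\<dots> \<le> (SUP t\<in>Collect P. ereal (X t w))"
      using r \<open>r \<le> real n\<close> by (intro SUP_subset_mono) auto
    finally show "(INF n. SUP q\<in>\<rat> \<inter> {real n..}. ereal (X q w)) \<le> (SUP t\<in>Collect P. ereal (X t w))" .
  qed
qed

context
  fixes N :: "'a measure"
  assumes N: "space N = space M" "\<And>s. 0 \<le> s \<Longrightarrow> X s \<in> borel_measurable N"
begin

lemma measurable_X_infinity: "limit \<in> borel_measurable N"
proof -
  have [measurable]: "X 0 \<in> borel_measurable N" using N by simp
  have "(\<lambda>w. INF n. SUP q\<in>\<rat> \<inter> {real n..}. ereal (X q w)) \<in> borel_measurable N"
    using N(2) by (intro borel_measurable_INF borel_measurable_SUP borel_measurable_ereal countable_Int1 countable_rat)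
      auto
  then have [measurable]: "(\<lambda>w. Limsup at_top (\<lambda>t. ereal (X t w))) \<in> borel_measurable N"
    using Limsup_path_eq N(1) by (subst measurable_cong) auto
  have "(\<lambda>w. if X 0 w \<in> {\<alpha>, \<beta>} then 0 else real_of_ereal (Limsup at_top (\<lambda>t. ereal (X t w))))
      \<in> borel_measurable N"
    by measurable
  then show ?thesis using X_infinity_eq N(1) by (subst measurable_cong) auto
qed

end

text \<open>Locates the first point not before \<open>t\<close> on the grid of mesh
  \<open>1 / (n + 1)\<close>. Rounding up keeps grid times compatible with the filtration. Since
  \<open>enn2real\<close> sends \<top> to \<open>0\<close>, so does the index, and infinite times
  have to be treated apart.\<close>

definition grid_index :: "nat \<Rightarrow> ennreal \<Rightarrow> nat" where
  "grid_index n t = nat \<lceil>real (Suc n) * enn2real t\<rceil>"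

lemma grid_index_le_iff:
  assumes "t < \<top>"
  shows "grid_index n t \<le> k \<longleftrightarrow> t \<le> ennreal (real k / real (Suc n))"
proof -
  obtain r where r: "0 \<le> r" "t = ennreal r" using assms by (cases t) auto
  have "grid_index n t \<le> k \<longleftrightarrow> real (Suc n) * r \<le> real k"
    using r by (simp add: grid_index_def nat_le_iff ceiling_le_iff)
  also have "\<dots> \<longleftrightarrow> r \<le> real k / real (Suc n)" by (simp add: field_simps)
  finally show ?thesis using r by (simp add: ennreal_le_iff)
qed

lemma grid_index_tendsto:
  assumes "t < \<top>"
  shows "(\<lambda>n. real (grid_index n t) / real (Suc n)) \<longlonglongrightarrow> enn2real t"
proof (rule tendsto_sandwich)
  define r where "r = enn2real t"
  have r: "0 \<le> r" by (simp add: r_def)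
  have g: "real (grid_index n t) = of_int \<lceil>real (Suc n) * r\<rceil>" for n
    using r by (simp add: grid_index_def r_def)
  show "\<forall>\<^sub>F n in sequentially. enn2real t \<le> real (grid_index n t) / real (Suc n)"
    unfolding g by (intro always_eventually allI) (simp add: r_def field_simps)
  have "real (grid_index n t) / real (Suc n) \<le> (real (Suc n) * r + 1) / real (Suc n)" for n
    unfolding g by (intro divide_right_mono) linarith+
  also have "(real (Suc n) * r + 1) / real (Suc n) = r + inverse (real (Suc n))" for n
    by (simp add: field_simps)
  finally show "\<forall>\<^sub>F n in sequentially. real (grid_index n t) / real (Suc n) \<le> enn2real t + inverse (real (Suc n))"
    unfolding r_def by (intro always_eventually allI)
  show "(\<lambda>n. enn2real t + inverse (real (Suc n))) \<longlonglongrightarrow> enn2real t"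
    using tendsto_add[OF tendsto_const LIMSEQ_inverse_real_of_nat, of "enn2real t"] by simp
qed simp

lemma X_grid_tendsto:
  assumes "w \<in> space M" "t < \<top>"
  shows "(\<lambda>n. X (real (grid_index n t) / real (Suc n)) w) \<longlonglongrightarrow> X (enn2real t) w"
proof -
  have "continuous_on {0..} (\<lambda>s. X s w)" by (rule X_continuous) fact
  then show ?thesis
    by (rule continuous_on_tendsto_compose[OF _ grid_index_tendsto]) (use assms in auto)
qed

text \<open>By path continuity the value at a finite time is the limit of values at grid times, each
  of which selects among countably many variables.\<close>

lemma measurable_value_at:
  assumes N: "space N = space M" "\<And>s. 0 \<le> s \<Longrightarrow> X s \<in> borel_measurable N"
    and \<tau>: "\<tau> \<in> borel_measurable N"
  shows "stopped \<tau> \<in> borel_measurable N"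
proof -
  note [measurable] = \<tau> measurable_X_infinity[OF N]
  have "grid_index n \<in> measurable borel (count_space UNIV)" for n
    unfolding grid_index_def by measurable
  then have [measurable]: "(\<lambda>w. grid_index n (\<tau> w)) \<in> measurable N (count_space UNIV)" for n
    using \<tau> by (rule measurable_compose[rotated])
  have [measurable]: "(\<lambda>w. X (real (grid_index n (\<tau> w)) / real (Suc n)) w) \<in> borel_measurable N" for n
    by (rule measurable_compose_countable[where f = "\<lambda>k. X (real k / real (Suc n))"]) (auto intro: N(2))
  have "(\<lambda>w. if \<tau> w = \<top> then limit w else X (enn2real (\<tau> w)) w) \<in> borel_measurable N"
  proof (rule borel_measurable_LIMSEQ_real)
    fix w assume "w \<in> space N"
    then show "(\<lambda>n. if \<tau> w = \<top> then limit w
        else X (real (grid_index n (\<tau> w)) / real (Suc n)) w) \<longlonglongrightarrow>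
      (if \<tau> w = \<top> then limit w else X (enn2real (\<tau> w)) w)"
      using X_grid_tendsto[of w "\<tau> w"] N(1)
      by (cases "\<tau> w = \<top>") (simp_all add: top.not_eq_extremum order.strict_implies_not_eq del: of_nat_Suc)
  qed measurable
  then show ?thesis by (simp add: value_at_def[abs_def])
qed

end

section \<open>Long-time behaviour of the paths\<close>

locale attractive_diffusion = linear_diffusion +
  assumes \<alpha>_less_\<beta>: "\<alpha> < \<beta>"
    and S_\<alpha>: "S \<alpha> = 0"
    and S_tendsto_\<alpha>: "(S \<longlongrightarrow> S \<alpha>) (at_right \<alpha>)"
    and S_tendsto_\<beta>: "(S \<longlongrightarrow> S \<beta>) (at_left \<beta>)"
begin

lemma scale_continuous_closed: "continuous_on {\<alpha>..\<beta>} S"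
proof (rule continuous_on_IccI[OF S_tendsto_\<alpha> S_tendsto_\<beta> _ \<alpha>_less_\<beta>])
  show "S \<midarrow>z\<rightarrow> S z" if "\<alpha> < z" "z < \<beta>" for z
    using scale_continuous that by (simp add: continuous_on_eq_continuous_at isCont_def)
qed

lemma scale_less:
  assumes "\<alpha> \<le> y" "y < z" "z \<le> \<beta>"
  shows "S y < S z"
proof -
  have inner: "S a < S b" if "\<alpha> < a" "a < b" "b < \<beta>" for a b
    using scale_strict_mono that by (auto simp: strict_mono_on_def)
  have left: "S \<alpha> < S b" if "\<alpha> < b" "b < \<beta>" for b
  proof -
    obtain a where a: "\<alpha> < a" "a < b" using dense \<open>\<alpha> < b\<close> by blast
    have "\<forall>\<^sub>F t in at_right \<alpha>. S t \<le> S a"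
      using eventually_at_right_real[OF a(1)] by eventually_elim (use inner a that in \<open>auto intro: less_imp_le\<close>)
    then have "S \<alpha> \<le> S a"
      by (intro tendsto_upperbound[OF S_tendsto_\<alpha>]) auto
    then show ?thesis using inner[of a b] a that by simp
  qed
  have right: "S a < S \<beta>" if "\<alpha> < a" "a < \<beta>" for a
  proof -
    obtain b where b: "a < b" "b < \<beta>" using dense \<open>a < \<beta>\<close> by blast
    have "\<forall>\<^sub>F t in at_left \<beta>. S b \<le> S t"
      using eventually_at_left_real[OF b(2)] by eventually_elim (use inner b that in \<open>auto intro: less_imp_le\<close>)
    then have "S b \<le> S \<beta>"
      by (intro tendsto_lowerbound[OF S_tendsto_\<beta>]) auto
    then show ?thesis using inner[of a b] b that by simp
  qed
  obtain w where w: "y < w" "w < z" using dense \<open>y < z\<close> by blast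
  have "S y < S w" using inner[of y w] left[of w] w assms by (cases "y = \<alpha>") auto
  moreover have "S w < S z" using inner[of w z] right[of w] w assms by (cases "z = \<beta>") auto
  ultimately show ?thesis by simp
qed

lemma scale_le: "\<alpha> \<le> y \<Longrightarrow> y \<le> z \<Longrightarrow> z \<le> \<beta> \<Longrightarrow> S y \<le> S z"
  using scale_less[of y z] by (cases "y = z") auto

lemma scale_pos: "\<alpha> < z \<Longrightarrow> z \<le> \<beta> \<Longrightarrow> 0 < S z"
  using scale_less[of \<alpha> z] S_\<alpha> by simp

lemma scale_nonneg: "\<alpha> \<le> z \<Longrightarrow> z \<le> \<beta> \<Longrightarrow> 0 \<le> S z"
  using scale_le[of \<alpha> z] S_\<alpha> by simp

lemma scale_tendsto:
  assumes "f \<longlonglongrightarrow> z" "\<And>n. f n \<in> {\<alpha>..\<beta>}"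
  shows "(\<lambda>n. S (f n)) \<longlonglongrightarrow> S z"
proof -
  have "z \<in> {\<alpha>..\<beta>}" using closed_sequentially[of "{\<alpha>..\<beta>}" f z] assms by auto
  then show ?thesis
    using assms by (intro continuous_on_tendsto_compose[OF scale_continuous_closed]) auto
qed

text \<open>The divisor \<open>n + 2\<close> keeps every term strictly between \<alpha> and
  \<open>y\<close>, also for \<open>n = 0\<close>.\<close>

definition low :: "real \<Rightarrow> nat \<Rightarrow> real" where
  "low y n = \<alpha> + (y - \<alpha>) / real (n + 2)"

definition high :: "real \<Rightarrow> nat \<Rightarrow> real" where
  "high y n = \<beta> - (\<beta> - y) / real (n + 2)"

lemma divide_shift_less: "0 < c \<Longrightarrow> c / real (n + 2) < c"
  using divide_strict_left_mono[of 1 "real (n + 2)" c] by simp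

lemma low_bounds: "\<alpha> < y \<Longrightarrow> \<alpha> < low y n" "\<alpha> < y \<Longrightarrow> low y n < y"
  using divide_shift_less[of "y - \<alpha>" n] by (simp_all add: low_def)

lemma high_bounds: "y < \<beta> \<Longrightarrow> high y n < \<beta>" "y < \<beta> \<Longrightarrow> y < high y n"
  using divide_shift_less[of "\<beta> - y" n] by (simp_all add: high_def)

lemma low_in: "y \<in> I \<Longrightarrow> low y n \<in> {\<alpha>..\<beta>}"
  using low_bounds[of y n] by auto

lemma high_in: "y \<in> I \<Longrightarrow> high y n \<in> {\<alpha>..\<beta>}"
  using high_bounds[of y n] by auto

lemma low_decseq: "\<alpha> < y \<Longrightarrow> k \<le> n \<Longrightarrow> low y n \<le> low y k"
  by (auto simp: low_def intro!: divide_left_mono)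

lemma high_incseq: "y < \<beta> \<Longrightarrow> k \<le> n \<Longrightarrow> high y k \<le> high y n"
  by (auto simp: high_def intro!: divide_left_mono)

lemma tendsto_const_over_nat: "(\<lambda>n. c / real (n + 2)) \<longlonglongrightarrow> 0"
  using LIMSEQ_ignore_initial_segment[OF lim_const_over_n[of c], of 2] by simp

lemma low_tendsto: "low y \<longlonglongrightarrow> \<alpha>"
  unfolding low_def[abs_def] using tendsto_add[OF tendsto_const tendsto_const_over_nat[of "y - \<alpha>"], of \<alpha>] by simp

lemma high_tendsto: "high y \<longlonglongrightarrow> \<beta>"
  unfolding high_def[abs_def] using tendsto_diff[OF tendsto_const tendsto_const_over_nat[of "\<beta> - y"], of \<beta>] by simp

lemma path_hits:
  assumes w: "w \<in> space M" and t: "0 \<le> s" "0 \<le> t" "X s w \<le> z" "z \<le> X t w"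
  shows "\<exists>r\<in>{min s t..max s t}. X r w = z"
proof -
  have cont: "continuous_on {min s t..max s t} (\<lambda>t. X t w)"
    using X_continuous[OF w] by (rule continuous_on_subset) (use t in auto)
  show ?thesis
  proof (cases "s \<le> t")
    case True
    then show ?thesis
      using IVT'[of "\<lambda>t. X t w" s z t] cont t by auto
  next
    case False
    then show ?thesis
      using IVT2'[of "\<lambda>t. X t w" s z t] cont t by auto
  qed
qed

lemma path_attains_sup:
  assumes "w \<in> space M" "0 \<le> t"
  obtains s where "0 \<le> s" "s \<le> t" "\<And>r. 0 \<le> r \<Longrightarrow> r \<le> t \<Longrightarrow> X r w \<le> X s w"
proof -
  have "continuous_on {0..t} (\<lambda>t. X t w)"
    using X_continuous[OF assms(1)] by (rule continuous_on_subset) auto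
  then show ?thesis using that continuous_attains_sup[of "{0..t}" "\<lambda>t. X t w"] assms by auto
qed

lemma path_attains_inf:
  assumes "w \<in> space M" "0 \<le> t"
  obtains s where "0 \<le> s" "s \<le> t" "\<And>r. 0 \<le> r \<Longrightarrow> r \<le> t \<Longrightarrow> X s w \<le> X r w"
proof -
  have "continuous_on {0..t} (\<lambda>t. X t w)"
    using X_continuous[OF assms(1)] by (rule continuous_on_subset) auto
  then show ?thesis using that continuous_attains_inf[of "{0..t}" "\<lambda>t. X t w"] assms by auto
qed

lemma hitting_time_finite_iff: "hitting_time X z w < \<top> \<longleftrightarrow> (\<exists>t\<ge>0. X t w = z)"
  unfolding hitting_time_eq_entry entry_time_finite_iff by auto

lemma hitting_time_measurable [measurable]: "hitting_time X z \<in> borel_measurable M"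
  unfolding hitting_time_eq_entry by (rule entry_measurable) simp

lemma exit_time_measurable [measurable]: "exit_time X a b \<in> borel_measurable M"
  unfolding exit_time_eq_entry by (rule entry_measurable) (simp add: closed_Compl)

lemma X0_measurable [measurable]: "X 0 \<in> borel_measurable M"
  by (rule X_measurable) simp

lemma space_P: "y \<in> I \<Longrightarrow> space (P y) = space M"
  using sets_P by (rule sets_eq_imp_space_eq)

lemma measurable_P: "y \<in> I \<Longrightarrow> measurable (P y) N = measurable M N"
  by (intro measurable_cong_sets sets_P) auto

text \<open>In this pathwise form the event visibly grows as the lower level \<open>a\<close>
  decreases.\<close>

lemma hitting_order_iff:
  assumes w: "w \<in> space M" and ab: "a < X 0 w" "a < b"
  shows "hitting_time X b w < hitting_time X a w \<longleftrightarrow> (\<exists>t\<ge>0. X t w = b \<and> (\<forall>s\<in>{0..t}. a < X s w))"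
proof
  assume less: "hitting_time X b w < hitting_time X a w"
  then obtain t where t: "0 \<le> t" "hitting_time X b w = ennreal t" "X t w = b"
    unfolding hitting_time_eq_entry
    using entry_time_finiteE[where X = X and w = w and C = "{b}"] X_continuous[OF w]
    by (metis closed_singleton order_less_le_trans singletonD top_greatest)
  have "a < X s w" if s: "s \<in> {0..t}" for s
  proof (rule ccontr)
    assume "\<not> a < X s w"
    then obtain r where "r \<in> {0..s}" "X r w = a" using path_hits[OF w, of s 0 a] s ab by auto
    then have "hitting_time X a w \<le> ennreal t"
      unfolding hitting_time_eq_entry
      using entry_time_le_iff[where X = X and w = w and C = "{a}"] X_continuous[OF w] s t(1) by auto
    then show False using less t(2) by simp
  qed
  then show "\<exists>t\<ge>0. X t w = b \<and> (\<forall>s\<in>{0..t}. a < X s w)" using t by auto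
next
  assume "\<exists>t\<ge>0. X t w = b \<and> (\<forall>s\<in>{0..t}. a < X s w)"
  then obtain t where t: "0 \<le> t" "X t w = b" "\<forall>s\<in>{0..t}. a < X s w" by blast
  have "hitting_time X b w \<le> ennreal t"
    unfolding hitting_time_eq_entry using t by (intro entry_time_le) auto
  also have "\<not> hitting_time X a w \<le> ennreal t"
    unfolding hitting_time_eq_entry
    using entry_time_le_iff[where X = X and w = w and C = "{a}"] X_continuous[OF w] t by auto
  then have "ennreal t < hitting_time X a w" by simp
  finally show "hitting_time X b w < hitting_time X a w" .
qed

section \<open>Paths with supremum \<beta>, and hitting probabilities\<close>

definition rising :: "'a set" where
  "rising = {w \<in> space M. \<forall>b<\<beta>. \<exists>t\<ge>0. b < X t w}"

definition falling :: "'a set" where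
  "falling = {w \<in> space M. \<forall>a>\<alpha>. \<exists>t\<ge>0. X t w < a}"

text \<open>\<open>\<beta>\<close> is absorbing, so a path which is below \<open>\<beta>\<close> has not visited it before.\<close>

lemma interior_bounded_above:
  assumes "w \<in> space M" "0 \<le> t" "X t w < \<beta>"
  shows "\<exists>b<\<beta>. \<forall>s\<in>{0..t}. X s w \<le> b"
proof -
  obtain s where s: "0 \<le> s" "s \<le> t" "\<And>r. 0 \<le> r \<Longrightarrow> r \<le> t \<Longrightarrow> X r w \<le> X s w"
    using path_attains_sup[OF assms(1,2)] by metis
  have "X s w \<noteq> \<beta>" using X_boundary[of s t w] s assms by auto
  then have "X s w < \<beta>" using X_range[OF s(1) assms(1)] by auto
  then show ?thesis using s by auto
qed

lemma interior_bounded_below: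
  assumes "w \<in> space M" "0 \<le> t" "\<alpha> < X t w"
  shows "\<exists>a>\<alpha>. \<forall>s\<in>{0..t}. a \<le> X s w"
proof -
  obtain s where s: "0 \<le> s" "s \<le> t" "\<And>r. 0 \<le> r \<Longrightarrow> r \<le> t \<Longrightarrow> X s w \<le> X r w"
    using path_attains_inf[OF assms(1,2)] by metis
  have "X s w \<noteq> \<alpha>" using X_boundary[of s t w] s assms by auto
  then have "\<alpha> < X s w" using X_range[OF s(1) assms(1)] by auto
  then show ?thesis using s by auto
qed

text \<open>Until a time at which it is below \<beta> the path stays bounded away from \<beta>, so
  values close to \<beta> must come later. This makes rising a property of the future path.\<close>

lemma rising_later:
  assumes w: "w \<in> rising" and t: "0 \<le> t" "X t w < \<beta>" and b: "b < \<beta>"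
  shows "\<exists>s>t. b < X s w"
proof -
  have w': "w \<in> space M" using w by (simp add: rising_def)
  obtain d where d: "d < \<beta>" "\<forall>s\<in>{0..t}. X s w \<le> d" using interior_bounded_above[OF w' t] by blast
  have "max b d < \<beta>" using b d(1) by simp
  then obtain s where s: "0 \<le> s" "max b d < X s w" using w unfolding rising_def by blast
  then have "t < s" using d(2) by force
  then show ?thesis using s by auto
qed

text \<open>The lower level in \<open>scale_hitting\<close> tends to \<alpha>: because \<alpha> is
  absorbing, a path that reaches \<open>b\<close> has until then stayed above some level greater
  than \<alpha>.\<close>

lemma prob_hits_above:
  assumes y: "y \<in> I" and b: "y < b" "b < \<beta>"
  shows "measure (P y) {w \<in> space M. hitting_time X b w < \<top>} = S y / S b"
proof -
  interpret prob_space "P y" by (rule prob_P) fact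
  note sets_P[OF y, measurable_cong] and space = space_P[OF y]
  \<comment> \<open>The almost sure start at \<open>y\<close> is built into the events, so that
    monotonicity and union hold path by path.\<close>
  define D where "D n = {w \<in> space M. X 0 w = y \<and> hitting_time X b w < hitting_time X (low y n) w}" for n
  have D_eq: "D n = {w \<in> space M. X 0 w = y \<and> (\<exists>t\<ge>0. X t w = b \<and> (\<forall>s\<in>{0..t}. low y n < X s w))}" for n
    unfolding D_def using hitting_order_iff low_bounds[of y n] y b by (force intro!: Collect_cong conj_cong)
  have D_sets: "D n \<in> sets (P y)" for n
    unfolding D_def sets_P[OF y] by measurable
  have "incseq D"
    unfolding D_eq using low_decseq[of y] y by (fastforce simp: incseq_def)
  then have "(\<lambda>n. measure (P y) (D n)) \<longlonglongrightarrow> measure (P y) (\<Union>n. D n)"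
    using D_sets by (intro finite_Lim_measure_incseq) auto
  moreover have "(\<Union>n. D n) = {w \<in> space M. X 0 w = y \<and> hitting_time X b w < \<top>}"
  proof safe
    fix w assume w: "w \<in> space M" "y = X 0 w" "hitting_time X b w < \<top>"
    then obtain t where t: "0 \<le> t" "X t w = b" by (auto simp: hitting_time_finite_iff)
    obtain a where a: "\<alpha> < a" "\<forall>s\<in>{0..t}. a \<le> X s w"
      using interior_bounded_below[OF w(1) t(1)] t(2) b y by auto
    have "\<forall>\<^sub>F n in sequentially. low y n < a" using low_tendsto a(1) by (rule order_tendstoD)
    then obtain n where "low y n < a" by (auto simp: eventually_sequentially)
    then have "w \<in> D n" unfolding D_eq using w t a by fastforce
    then show "w \<in> (\<Union>n. D n)" by blast
  qed (auto simp: D_def intro: order_less_le_trans)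
  moreover have "measure (P y) {w \<in> space M. X 0 w = y \<and> hitting_time X b w < \<top>} =
      measure (P y) {w \<in> space M. hitting_time X b w < \<top>}"
    using X_start[OF y] by (intro finite_measure_eq_AE) (auto simp: sets_P[OF y])
  moreover have "measure (P y) (D n) = (S y - S (low y n)) / (S b - S (low y n))" for n
  proof -
    have "measure (P y) (D n) = measure (P y) {w \<in> space M. hitting_time X b w < hitting_time X (low y n) w}"
      unfolding D_def using X_start[OF y] by (intro finite_measure_eq_AE) (auto simp: sets_P[OF y])
    then show ?thesis using scale_hitting[of "low y n" y b] low_bounds[of y n] y b by simp
  qed
  moreover have "(\<lambda>n. (S y - S (low y n)) / (S b - S (low y n))) \<longlonglongrightarrow> (S y - S \<alpha>) / (S b - S \<alpha>)"
    using low_in[OF y] y b scale_pos[of b] S_\<alpha>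
    by (intro tendsto_intros scale_tendsto low_tendsto) auto
  ultimately show ?thesis
    using LIMSEQ_unique S_\<alpha> by fastforce
qed

text \<open>The speed measure of \<open>[a, b]\<close> is finite and the kernel in the formula for
  the mean exit time is at most \<open>S b - S a\<close>, so the mean is finite.\<close>

lemma exit_time_finite_AE:
  assumes "\<alpha> < a" "a < y" "y < b" "b < \<beta>"
  shows "AE w in P y. exit_time X a b w < \<top>"
proof -
  have y: "y \<in> I" using assms by auto
  have Sab: "S a < S b" using scale_less assms by auto
  have "(\<integral>\<^sup>+ w. exit_time X a b w \<partial>P y) =
      (\<integral>\<^sup>+ w\<in>{a<..<b}. ennreal ((S (min y w) - S a) * (S b - S (max y w)) / (S b - S a)) \<partial>m)"
    using speed_exit assms by simp
  also have "\<dots> \<le> (\<integral>\<^sup>+ w. ennreal (S b - S a) * indicator {a..b} w \<partial>m)"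
  proof (intro nn_integral_mono)
    fix w assume "w \<in> space m"
    show "ennreal ((S (min y w) - S a) * (S b - S (max y w)) / (S b - S a)) * indicator {a<..<b} w
        \<le> ennreal (S b - S a) * indicator {a..b} w"
    proof (cases "w \<in> {a<..<b}")
      case True
      have "(S (min y w) - S a) * (S b - S (max y w)) \<le> (S b - S a) * (S b - S a)"
        using True assms scale_le[of a "min y w"] scale_le[of "min y w" b] scale_le[of a "max y w"]
          scale_le[of "max y w" b] Sab by (intro mult_mono) auto
      then have "(S (min y w) - S a) * (S b - S (max y w)) / (S b - S a) \<le> S b - S a"
        using Sab by (simp add: divide_le_eq)
      then show ?thesis using True by (simp add: ennreal_leI)
    qed simp
  qed
  also have "\<dots> = ennreal (S b - S a) * emeasure m {a..b}"
    by (rule nn_integral_cmult_indicator) (simp add: sets_speed)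
  also have "\<dots> < \<top>"
    using speed_interval[of a b] assms by (auto simp: ennreal_mult_less_top)
  finally have "AE w in P y. exit_time X a b w \<noteq> \<infinity>"
    by (intro nn_integral_PInf_AE) (auto simp: measurable_P[OF y])
  then show ?thesis by eventually_elim (simp add: less_top)
qed

text \<open>A path that leaves \<open>(a, b)\<close> without reaching \<open>b\<close> before
  \<open>a\<close> must reach \<open>a\<close>; then \<open>b\<close> tends to \<beta>. The lower
  bound suffices, as it already complements the probability of rising.\<close>

lemma prob_hits_below:
  assumes y: "y \<in> I" and a: "\<alpha> < a" "a < y"
  shows "1 - S y / S \<beta> \<le> measure (P y) {w \<in> space M. hitting_time X a w < \<top>}"
proof -
  interpret prob_space "P y" by (rule prob_P) fact
  note sets_P[OF y, measurable_cong] and space = space_P[OF y]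
  have "1 - S y / S b \<le> measure (P y) {w \<in> space M. hitting_time X a w < \<top>}" if b: "y < b" "b < \<beta>" for b
  proof -
    have "AE w in P y. w \<in> space (P y) - {w \<in> space M. hitting_time X b w < hitting_time X a w} \<longrightarrow>
        w \<in> {w \<in> space M. hitting_time X a w < \<top>}"
      using exit_time_finite_AE[OF a b] X_start[OF y] AE_space
    proof eventually_elim
      case (elim w)
      have "hitting_time X a w < \<top>" if ge: "\<not> hitting_time X b w < hitting_time X a w"
      proof -
        have w: "w \<in> space M" using elim space by simp
        obtain t where t: "0 \<le> t" "X t w \<notin> {a<..<b}"
          using elim(1) unfolding exit_time_eq_entry entry_time_finite_iff by auto
        show ?thesis
        proof (cases "X t w \<le> a")
          case True
          then show ?thesis using path_hits[OF w, of t 0 a] t elim a by (auto simp: hitting_time_finite_iff)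
        next
          case False
          then have "b \<le> X t w" using t by auto
          then have "hitting_time X b w < \<top>"
            using path_hits[OF w, of 0 t b] t elim b by (auto simp: hitting_time_finite_iff)
          then show ?thesis using ge by simp
        qed
      qed
      then show ?case using space by auto
    qed
    then have "measure (P y) (space (P y) - {w \<in> space M. hitting_time X b w < hitting_time X a w}) \<le>
        measure (P y) {w \<in> space M. hitting_time X a w < \<top>}"
      by (intro finite_measure_mono_AE) (auto simp: sets_P[OF y])
    moreover have "measure (P y) (space (P y) - {w \<in> space M. hitting_time X b w < hitting_time X a w}) =
        1 - (S y - S a) / (S b - S a)"
      using scale_hitting[of a y b] a b by (subst prob_compl) (auto simp: sets_P[OF y])
    moreover have "(S y - S a) / (S b - S a) \<le> S y / S b"
    proof -
      have "S a < S b" "0 < S b" "0 \<le> S a" "S y < S b"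
        using scale_less[of a b] scale_less[of y b] scale_pos[of b] scale_nonneg[of a] a b y by auto
      then have "S a * S y \<le> S a * S b" by (intro mult_left_mono) auto
      then show ?thesis using \<open>S a < S b\<close> \<open>0 < S b\<close> by (simp add: field_simps)
    qed
    ultimately show ?thesis by simp
  qed
  moreover have "(\<lambda>n. 1 - S y / S (high y n)) \<longlonglongrightarrow> 1 - S y / S \<beta>"
    using scale_pos[of \<beta>] \<alpha>_less_\<beta> high_in[OF y]
    by (intro tendsto_intros scale_tendsto high_tendsto) auto
  ultimately show ?thesis
    using high_bounds[of y] y by (intro LIMSEQ_le_const2) auto
qed

lemma prob_rising_aux:
  assumes y: "y \<in> I"
  shows "{w \<in> rising. X 0 w = y} = (\<Inter>n. {w \<in> space M. X 0 w = y \<and> hitting_time X (high y n) w < \<top>})"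
proof (intro equalityI subsetI)
  fix w assume w: "w \<in> {w \<in> rising. X 0 w = y}"
  have "hitting_time X (high y n) w < \<top>" for n
  proof -
    obtain t where "0 \<le> t" "high y n < X t w"
      using w high_bounds[of y n] y by (auto simp: rising_def)
    then show ?thesis using path_hits[of w 0 t "high y n"] w high_bounds[of y n] y
      by (auto simp: rising_def hitting_time_finite_iff)
  qed
  then show "w \<in> (\<Inter>n. {w \<in> space M. X 0 w = y \<and> hitting_time X (high y n) w < \<top>})"
    using w by (auto simp: rising_def)
next
  fix w assume w: "w \<in> (\<Inter>n. {w \<in> space M. X 0 w = y \<and> hitting_time X (high y n) w < \<top>})"
  have "\<exists>t\<ge>0. b < X t w" if "b < \<beta>" for b
  proof -
    have "\<forall>\<^sub>F n in sequentially. b < high y n" using high_tendsto that by (rule order_tendstoD)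
    then obtain n where "b < high y n" by (auto simp: eventually_sequentially)
    moreover have "hitting_time X (high y n) w < \<top>" using w by auto
    ultimately show ?thesis by (auto simp: hitting_time_finite_iff)
  qed
  then show "w \<in> {w \<in> rising. X 0 w = y}" using w by (auto simp: rising_def)
qed

lemma falling_superset:
  assumes y: "y \<in> I"
  shows "(\<Inter>n. {w \<in> space M. X 0 w = y \<and> hitting_time X (low y n) w < \<top>}) \<subseteq> {w \<in> falling. X 0 w = y}"
proof
  fix w assume w: "w \<in> (\<Inter>n. {w \<in> space M. X 0 w = y \<and> hitting_time X (low y n) w < \<top>})"
  have "\<exists>t\<ge>0. X t w < a" if "\<alpha> < a" for a
  proof -
    have "\<forall>\<^sub>F n in sequentially. low y n < a" using low_tendsto that by (rule order_tendstoD)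
    then obtain n where "low y n < a" by (auto simp: eventually_sequentially)
    moreover have "hitting_time X (low y n) w < \<top>" using w by auto
    ultimately show ?thesis by (auto simp: hitting_time_finite_iff)
  qed
  then show "w \<in> {w \<in> falling. X 0 w = y}" using w by (auto simp: falling_def)
qed

lemma rising_alt:
  "rising = {w \<in> space M. \<forall>n. \<exists>q\<in>\<rat> \<inter> {0..}. \<beta> - inverse (real (Suc n)) < X q w}"
proof (intro equalityI subsetI)
  fix w assume w: "w \<in> rising"
  have "\<exists>q\<in>\<rat> \<inter> {0..}. b < X q w" if b: "b < \<beta>" for b
  proof -
    obtain t where t: "0 \<le> t" "X t w \<in> {b<..}" using w b by (auto simp: rising_def)
    then show ?thesis
      using continuous_near_rational[OF X_continuous, of w "{b<..}" t "t + 1"] w by (force simp: rising_def)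
  qed
  then show "w \<in> {w \<in> space M. \<forall>n. \<exists>q\<in>\<rat> \<inter> {0..}. \<beta> - inverse (real (Suc n)) < X q w}"
    using w by (auto simp: rising_def)
next
  fix w assume w: "w \<in> {w \<in> space M. \<forall>n. \<exists>q\<in>\<rat> \<inter> {0..}. \<beta> - inverse (real (Suc n)) < X q w}"
  have "\<exists>t\<ge>0. b < X t w" if b: "b < \<beta>" for b
  proof -
    obtain n where "inverse (real (Suc n)) < \<beta> - b" using reals_Archimedean[of "\<beta> - b"] b by auto
    moreover obtain q where "0 \<le> q" "\<beta> - inverse (real (Suc n)) < X q w" using w by auto
    ultimately show ?thesis by (intro exI[of _ q]) auto
  qed
  then show "w \<in> rising" using w by (auto simp: rising_def)
qed

lemma rising_natural: "rising \<in> sets (natural \<top>)"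
proof -
  have [measurable]: "X q \<in> borel_measurable (natural \<top>)" if "q \<in> \<rat> \<inter> {0..}" for q
    using that by (intro measurable_natural_filtration) auto
  have [simp]: "countable (\<rat> \<inter> {0::real..})" by (intro countable_Int1 countable_rat)
  have "{w \<in> space (natural \<top>).
      \<forall>n. \<exists>q\<in>\<rat> \<inter> {0..}. \<beta> - inverse (real (Suc n)) < X q w} \<in> sets (natural \<top>)"
    by measurable
  then show ?thesis unfolding rising_alt space_natural_filtration .
qed

lemma rising_sets [measurable]: "rising \<in> sets M"
  using rising_natural sets_natural_le by blast

text \<open>For paths started at \<open>y\<close> the event is the decreasing intersection of the
  events of hitting \<open>high y n\<close>, whether \<beta> is reached or only approached.\<close>

lemma prob_rising:
  assumes y: "y \<in> I"
  shows "measure (P y) rising = S y / S \<beta>"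
proof -
  interpret prob_space "P y" by (rule prob_P) fact
  note sets_P[OF y, measurable_cong] and space = space_P[OF y]
  define H where "H n = {w \<in> space M. X 0 w = y \<and> hitting_time X (high y n) w < \<top>}" for n
  have H_sets: "H n \<in> sets (P y)" for n unfolding H_def sets_P[OF y] by measurable
  have "H n \<subseteq> H k" if "k \<le> n" for k n
  proof
    fix w assume "w \<in> H n"
    then obtain t where t: "w \<in> space M" "X 0 w = y" "0 \<le> t" "X t w = high y n"
      by (auto simp: H_def hitting_time_finite_iff)
    then show "w \<in> H k"
      using path_hits[of w 0 t "high y k"] high_incseq[of y k n] high_bounds[of y k] that y
      by (auto simp: H_def hitting_time_finite_iff)
  qed
  then have "decseq H" by (auto simp: decseq_def)
  then have "(\<lambda>n. measure (P y) (H n)) \<longlonglongrightarrow> measure (P y) (\<Inter>n. H n)"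
    using H_sets by (intro finite_Lim_measure_decseq) auto
  moreover have "measure (P y) (H n) = S y / S (high y n)" for n
  proof -
    have "measure (P y) (H n) = measure (P y) {w \<in> space M. hitting_time X (high y n) w < \<top>}"
      unfolding H_def using X_start[OF y] by (intro finite_measure_eq_AE) (auto simp: sets_P[OF y])
    then show ?thesis using prob_hits_above[OF y] high_bounds[of y n] y by simp
  qed
  moreover have "(\<lambda>n. S y / S (high y n)) \<longlonglongrightarrow> S y / S \<beta>"
    using scale_pos[of \<beta>] \<alpha>_less_\<beta> high_in[OF y]
    by (intro tendsto_intros scale_tendsto high_tendsto) auto
  moreover have "measure (P y) (\<Inter>n. H n) = measure (P y) rising"
    unfolding H_def prob_rising_aux[OF y, symmetric]
    using X_start[OF y] by (intro finite_measure_eq_AE) (auto simp: sets_P[OF y])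
  ultimately show ?thesis using LIMSEQ_unique by fastforce
qed

end

lemma path_from_in_space: "path_from X s w \<in> space path_space"
  by (simp add: path_from_def space_PiM)

lemma path_from_apply: "0 \<le> q \<Longrightarrow> path_from X s w q = X (s + q) w"
  by (simp add: path_from_def)

lemma countable_nonneg_rats: "countable (\<rat> \<inter> {0::real..})"
  by (intro countable_Int1 countable_rat)

lemma evaluation_measurable: "q \<in> \<rat> \<inter> {0..} \<Longrightarrow> (\<lambda>w. w q) \<in> borel_measurable path_space"
  by (rule measurable_component_singleton) auto

text \<open>Uniqueness of finite measures on the sigma-algebra generated by \<open>E\<close>, which
  may be smaller than the one carrying the measures.\<close>

lemma emeasure_eq_on_sigma_sets:
  assumes E: "Int_stable E" "E \<subseteq> sets M1" and sets: "sets M1 = sets M2"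
    and fin: "finite_measure M1" "finite_measure M2"
    and eq: "\<And>A. A \<in> E \<Longrightarrow> emeasure M1 A = emeasure M2 A"
      "emeasure M1 (space M1) = emeasure M2 (space M2)"
    and A: "A \<in> sigma_sets (space M1) E"
  shows "emeasure M1 A = emeasure M2 A"
proof -
  have space: "space M1 = space M2" using sets by (rule sets_eq_imp_space_eq)
  have sub: "sigma_sets (space M1) E \<subseteq> sets M1" using E(2) by (rule sets.sigma_sets_subset)
  have "E \<subseteq> Pow (space M1)" using E(2) sets.space_closed by blast
  from E(1) this A show ?thesis
  proof (induction rule: sigma_sets_induct_disjoint)
    case (compl A)
    then have A: "A \<in> sets M1" using sub by blast
    have "emeasure M1 (space M1 - A) = emeasure M1 (space M1) - emeasure M1 A"
      using A fin(1) by (intro emeasure_compl) (auto simp: finite_measure.emeasure_finite)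
    also have "\<dots> = emeasure M2 (space M2) - emeasure M2 A" using compl.IH eq(2) by simp
    also have "\<dots> = emeasure M2 (space M2 - A)"
      using A fin(2) sets by (intro emeasure_compl[symmetric]) (auto simp: finite_measure.emeasure_finite)
    finally show ?case using space by simp
  next
    case (union A)
    then have "range A \<subseteq> sets M1" using sub by blast
    then show ?case
      using suminf_emeasure[of A M1] suminf_emeasure[of A M2] union sets by (metis suminf_cong)
  qed (use eq(1) in auto)
qed

section \<open>Convergence of the remaining paths to \<alpha>\<close>

context attractive_diffusion
begin

text \<open>The shifted path is evaluated through \<open>stopped\<close>, so that measurability of
  stopped values applies; rational shifts suffice by continuity.\<close>

definition returning :: "real \<Rightarrow> real \<Rightarrow> 'a set" where
  "returning a b = {w \<in> space M. hitting_time X a w < \<top> \<and>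
    (\<exists>q\<in>\<rat> \<inter> {0..}. b < stopped (\<lambda>w. hitting_time X a w + ennreal q) w)}"

lemma returning_sets [measurable]: "returning a b \<in> sets M"
proof -
  have [measurable]: "stopped (\<lambda>w. hitting_time X a w + ennreal q) \<in> borel_measurable M"
    if "q \<in> \<rat> \<inter> {0..}" for q
    by (intro measurable_value_at X_measurable) auto
  note [simp] = countable_nonneg_rats
  show ?thesis unfolding returning_def by measurable
qed

lemma returning_alt:
  "returning a b = {w \<in> space M. hitting_time X a w < \<top> \<and>
    (\<exists>q\<in>\<rat> \<inter> {0..}. b < X (enn2real (hitting_time X a w) + q) w)}"
  unfolding returning_def value_at_def
  by (intro Collect_cong conj_cong refl bex_cong) (auto simp: enn2real_plus less_top)

lemma hitting_value:
  assumes "w \<in> space M" "hitting_time X a w < \<top>"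
  shows "X (enn2real (hitting_time X a w)) w = a"
  using entry_time_finiteE[where X = X and w = w and C = "{a}"] X_continuous assms
  unfolding hitting_time_eq_entry by (metis closed_singleton enn2real_ennreal singletonD)

text \<open>By the strong Markov property at the hitting time of \<open>a\<close>, the probability to climb back from
  \<open>a\<close> above \<open>b\<close> is at most the probability to hit \<open>b\<close> from \<open>a\<close>.\<close>

lemma prob_returning:
  assumes y: "y \<in> I" and ab: "\<alpha> < a" "a < b" "b < \<beta>"
  shows "emeasure (P y) (returning a b) \<le> ennreal (S a / S b)"
proof -
  interpret prob_space "P y" by (rule prob_P) fact
  define T where "T = hitting_time X a"
  have T: "stopping_time (natural) T"
    unfolding T_def hitting_time_eq_entry by (rule entry_stopping_time_natural) simp
  have a: "a \<in> I" using ab by auto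
  interpret Pa: prob_space "P a" by (rule prob_P) fact
  define B where "B = {w \<in> space path_space. \<exists>q\<in>\<rat> \<inter> {0..}. b < w q}"
  have B: "B \<in> sets path_space"
  proof -
    note [measurable] = evaluation_measurable
    note [simp] = countable_nonneg_rats
    show ?thesis unfolding B_def by measurable
  qed
  have B_iff: "path_from X s w \<in> B \<longleftrightarrow> (\<exists>q\<in>\<rat> \<inter> {0..}. b < X (s + q) w)" for s w
    by (auto simp: B_def path_from_in_space path_from_apply)
  have "space M \<in> sets (filtration.pre_sigma (space M) (natural) T)"
  proof (rule filtration.sets_pre_sigmaI[OF filtration_natural T])
    fix t
    show "{w \<in> space M. T w \<le> t} \<in> sets (natural t)"
      using stopping_timeD[OF T, of t] by (simp add: pred_def space_natural_filtration)
  qed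
  note markov = strong_Markov[OF y T this B]
  have "returning a b = {w \<in> space M. T w < \<top> \<and> X (enn2real (T w)) w \<in> I \<and>
      path_from X (enn2real (T w)) w \<in> B}"
    unfolding returning_alt B_iff T_def using hitting_value a by (force intro!: Collect_cong)
  then have "emeasure (P y) (returning a b) = (\<integral>\<^sup>+ w. emeasure (P (X (enn2real (T w)) w))
      {w' \<in> space M. path_from X 0 w' \<in> B} *
      indicator {w \<in> space M. T w < \<top> \<and> X (enn2real (T w)) w \<in> I} w \<partial>P y)"
    using markov by simp
  also have "\<dots> \<le> (\<integral>\<^sup>+ w. ennreal (S a / S b) \<partial>P y)"
  proof (rule nn_integral_mono)
    fix w
    have "emeasure (P a) {w' \<in> space M. path_from X 0 w' \<in> B} \<le>
        emeasure (P a) {w \<in> space M. hitting_time X b w < \<top>}"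
    proof (rule emeasure_mono_AE)
      show "AE w in P a. w \<in> {w' \<in> space M. path_from X 0 w' \<in> B} \<longrightarrow>
          w \<in> {w \<in> space M. hitting_time X b w < \<top>}"
        using X_start[OF a]
      proof eventually_elim
        case (elim w)
        show ?case
        proof
          assume "w \<in> {w' \<in> space M. path_from X 0 w' \<in> B}"
          then obtain q where "w \<in> space M" "0 \<le> q" "b < X q w" by (auto simp: B_iff)
          then show "w \<in> {w \<in> space M. hitting_time X b w < \<top>}"
            using path_hits[of w 0 q b] elim ab by (auto simp: hitting_time_finite_iff)
        qed
      qed
      show "{w \<in> space M. hitting_time X b w < \<top>} \<in> sets (P a)" unfolding sets_P[OF a] by measurable
    qed
    also have "\<dots> = ennreal (S a / S b)"
      using prob_hits_above[OF a] ab by (simp add: Pa.emeasure_eq_measure)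
    finally show "emeasure (P (X (enn2real (T w)) w)) {w' \<in> space M. path_from X 0 w' \<in> B} *
        indicator {w \<in> space M. T w < \<top> \<and> X (enn2real (T w)) w \<in> I} w \<le> ennreal (S a / S b)"
      using hitting_value[of w a] by (auto simp: T_def split: split_indicator)
  qed
  also have "\<dots> = ennreal (S a / S b)" by (simp add: emeasure_space_1)
  finally show ?thesis .
qed

text \<open>The probability of climbing back from \<open>low b n\<close> is at most
  \<open>S (low b n) / S b\<close>, which tends to zero.\<close>

lemma never_returning_AE:
  assumes y: "y \<in> I" and b: "b \<in> I"
  shows "AE w in P y. \<exists>n. w \<notin> returning (low b n) b"
proof -
  have "emeasure (P y) (\<Inter>n. returning (low b n) b) \<le> ennreal (S (low b n) / S b)" for n
  proof -
    have "emeasure (P y) (\<Inter>n. returning (low b n) b) \<le> emeasure (P y) (returning (low b n) b)"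
      by (intro emeasure_mono) (auto simp: sets_P[OF y])
    also have "\<dots> \<le> ennreal (S (low b n) / S b)"
      using low_bounds[of b n] b y by (intro prob_returning) auto
    finally show ?thesis .
  qed
  moreover have "(\<lambda>n. ennreal (S (low b n) / S b)) \<longlonglongrightarrow> ennreal (S \<alpha> / S b)"
    using low_in[OF b] b scale_pos[of b]
    by (intro tendsto_ennrealI tendsto_intros scale_tendsto low_tendsto) auto
  ultimately have "emeasure (P y) (\<Inter>n. returning (low b n) b) \<le> ennreal (S \<alpha> / S b)"
    by (intro LIMSEQ_le_const) auto
  then have "emeasure (P y) (\<Inter>n. returning (low b n) b) = 0" by (simp add: S_\<alpha>)
  then have "(\<Inter>n. returning (low b n) b) \<in> null_sets (P y)"
    by (intro null_setsI) (auto simp: sets_P[OF y])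
  then have "AE w in P y. w \<notin> (\<Inter>n. returning (low b n) b)" by (rule AE_not_in)
  then show ?thesis by eventually_elim auto
qed

text \<open>For each of countably many levels \<open>b\<close> there is almost surely a lower level
  from which the path never climbs above \<open>b\<close> again. A falling path reaches that lower
  level, so eventually it stays at or below \<open>b\<close>.\<close>

lemma falling_tendsto_AE:
  assumes y: "y \<in> I"
  shows "AE w in P y. w \<in> falling \<longrightarrow> ((\<lambda>t. X t w) \<longlongrightarrow> \<alpha>) at_top"
proof -
  have "low y k \<in> I" for k using low_bounds[of y k] y by auto
  then have "AE w in P y. \<forall>k. \<exists>n. w \<notin> returning (low (low y k) n) (low y k)"
    unfolding AE_all_countable using never_returning_AE[OF y] by blast
  then show ?thesis
    using X_start[OF y] AE_space
  proof eventually_elim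
    case (elim w)
    show ?case
    proof
      assume fall: "w \<in> falling"
      then have w: "w \<in> space M" by (simp add: falling_def)
      show "((\<lambda>t. X t w) \<longlongrightarrow> \<alpha>) at_top"
      proof (rule order_tendstoI)
        fix e assume "e < \<alpha>"
        then have "e < X t w" if "0 \<le> t" for t using X_range[OF that w] by auto
        then show "\<forall>\<^sub>F t in at_top. e < X t w"
          by (auto intro!: eventually_mono[OF eventually_ge_at_top[of 0]])
      next
        fix e assume "\<alpha> < e"
        then have "\<forall>\<^sub>F k in sequentially. low y k < e" by (rule order_tendstoD[OF low_tendsto])
        then obtain k where k: "low y k < e" by (auto simp: eventually_sequentially)
        define b where "b = low y k"
        have b: "\<alpha> < b" "b < y" using low_bounds[of y k] y by (auto simp: b_def)
        obtain n where n: "w \<notin> returning (low b n) b" using elim(1) by (auto simp: b_def)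
        define a where "a = low b n"
        have a: "\<alpha> < a" "a < b" using low_bounds[of b n] b by (auto simp: a_def)
        obtain t where t: "0 \<le> t" "X t w < a" using fall a by (auto simp: falling_def)
        then have fin: "hitting_time X a w < \<top>"
          using path_hits[OF w, of t 0 a] elim a b by (auto simp: hitting_time_finite_iff)
        define T where "T = enn2real (hitting_time X a w)"
        have T: "0 \<le> T" by (simp add: T_def)
        have "X t w \<le> b" if le: "T \<le> t" for t
        proof (rule ccontr)
          assume "\<not> X t w \<le> b"
          then have "X (T + (t - T)) w \<in> {b<..}" by simp
          moreover have "continuous_on {0..} (\<lambda>s. X (T + s) w)"
            using T by (intro continuous_on_compose2[OF X_continuous[OF w]] continuous_intros) auto
          ultimately obtain q where "q \<in> \<rat>" "t - T < q" "X (T + q) w \<in> {b<..}"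
            using continuous_near_rational[of "\<lambda>s. X (T + s) w" "{b<..}" "t - T" "t - T + 1"] le by auto
          then show False
            using n fin w le unfolding a_def[symmetric] by (auto simp: returning_alt simp flip: T_def)
        qed
        then show "\<forall>\<^sub>F t in at_top. X t w < e"
          using k by (auto simp: b_def intro!: eventually_mono[OF eventually_ge_at_top[of T]])
            (meson le_less_trans)
      qed
    qed
  qed
qed

lemma rising_not_tendsto:
  assumes "w \<in> rising"
  shows "\<not> ((\<lambda>t. X t w) \<longlongrightarrow> \<alpha>) at_top"
proof
  assume "((\<lambda>t. X t w) \<longlongrightarrow> \<alpha>) at_top"
  then have "\<forall>\<^sub>F t in at_top. X t w < (\<alpha> + \<beta>) / 2"
    by (rule order_tendstoD) (use \<alpha>_less_\<beta> in simp)
  then obtain t where t: "\<And>s. t \<le> s \<Longrightarrow> X s w < (\<alpha> + \<beta>) / 2" by (auto simp: eventually_at_top_linorder)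
  define r where "r = max 0 t"
  have "X r w < \<beta>" using t[of r] \<alpha>_less_\<beta> by (auto simp: r_def)
  then obtain s where "r < s" "(\<alpha> + \<beta>) / 2 < X s w"
    using rising_later[OF assms, of r "(\<alpha> + \<beta>) / 2"] \<alpha>_less_\<beta> by (auto simp: r_def)
  then show False using t[of s] by (auto simp: r_def)
qed

lemma X_infinity_rising:
  assumes w: "w \<in> rising" and X0: "X 0 w \<in> I"
  shows "limit w = \<beta>"
proof -
  have space: "w \<in> space M" using w by (simp add: rising_def)
  let ?L = "Limsup at_top (\<lambda>t. ereal (X t w))"
  have "?L \<le> ereal \<beta>"
    using X_range[OF _ space] by (intro Limsup_bounded) (auto intro!: eventually_mono[OF eventually_ge_at_top[of 0]])
  moreover have "\<not> ?L < ereal \<beta>"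
  proof
    assume "?L < ereal \<beta>"
    then obtain b where b: "?L < ereal b" "b < \<beta>" using ereal_dense2[of ?L "ereal \<beta>"] by auto
    then have "\<forall>\<^sub>F t in at_top. ereal (X t w) < ereal b" using Limsup_lessD by blast
    then obtain t where t: "\<And>s. t \<le> s \<Longrightarrow> X s w < b" by (auto simp: eventually_at_top_linorder)
    define r where "r = max 0 t"
    have "X r w < \<beta>" using t[of r] b by (auto simp: r_def)
    then obtain s where "r < s" "b < X s w"
      using rising_later[OF w, of r b] b by (auto simp: r_def)
    then show False using t[of s] by (auto simp: r_def)
  qed
  ultimately have "?L = ereal \<beta>" by simp
  then show ?thesis using X_infinity_eq[OF space] X0 by auto
qed

lemma X_infinity_tendsto:
  assumes "w \<in> space M" "X 0 w \<in> I" "((\<lambda>t. X t w) \<longlongrightarrow> \<alpha>) at_top"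
  shows "limit w = \<alpha>"
proof -
  have "((\<lambda>t. ereal (X t w)) \<longlongrightarrow> ereal \<alpha>) at_top" using assms(3) by (rule tendsto_ereal)
  then have "Limsup at_top (\<lambda>t. ereal (X t w)) = ereal \<alpha>" by (intro lim_imp_Limsup) auto
  then show ?thesis using X_infinity_eq[OF assms(1)] assms(2) by auto
qed

text \<open>Rising has probability \<open>S y / S \<beta>\<close>. Hitting all levels
  \<open>low y n\<close> has probability at least \<open>1 - S y / S \<beta>\<close>, and almost
  surely entails convergence to \<alpha>, which excludes rising. Up to a null set the two events
  therefore exhaust the space.\<close>

lemma terminal_value_AE:
  assumes y: "y \<in> I"
  shows "AE w in P y. w \<in> rising \<and> limit w = \<beta> \<or>
    w \<notin> rising \<and> limit w = \<alpha> \<and> ((\<lambda>t. X t w) \<longlongrightarrow> \<alpha>) at_top"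
proof -
  interpret prob_space "P y" by (rule prob_P) fact
  note space = space_P[OF y]
  define H where "H n = {w \<in> space M. X 0 w = y \<and> hitting_time X (low y n) w < \<top>}" for n
  have H_sets: "H n \<in> sets (P y)" for n unfolding H_def sets_P[OF y] by measurable
  have "H n \<subseteq> H k" if "k \<le> n" for k n
  proof
    fix w assume "w \<in> H n"
    then obtain t where t: "w \<in> space M" "X 0 w = y" "0 \<le> t" "X t w = low y n"
      by (auto simp: H_def hitting_time_finite_iff)
    then show "w \<in> H k"
      using path_hits[of w t 0 "low y k"] low_decseq[of y k n] low_bounds[of y k] that y
      by (auto simp: H_def hitting_time_finite_iff)
  qed
  then have "decseq H" by (auto simp: decseq_def)
  then have "(\<lambda>n. prob (H n)) \<longlonglongrightarrow> prob (\<Inter>n. H n)"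
    using H_sets by (intro finite_Lim_measure_decseq) auto
  moreover have "1 - S y / S \<beta> \<le> prob (H n)" for n
  proof -
    have "prob (H n) = prob {w \<in> space M. hitting_time X (low y n) w < \<top>}"
      unfolding H_def using X_start[OF y] by (intro finite_measure_eq_AE) (auto simp: sets_P[OF y])
    then show ?thesis using prob_hits_below[OF y, of "low y n"] low_bounds[of y n] y by simp
  qed
  ultimately have H_prob: "1 - S y / S \<beta> \<le> prob (\<Inter>n. H n)" by (intro LIMSEQ_le_const) auto
  have AE_H: "AE w in P y. w \<in> (\<Inter>n. H n) \<longrightarrow> ((\<lambda>t. X t w) \<longlongrightarrow> \<alpha>) at_top"
    using falling_tendsto_AE[OF y]
    by eventually_elim (use falling_superset[OF y] in \<open>auto simp: H_def\<close>)
  define C where "C = space (P y) - rising"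
  define D where "D = (\<Inter>n. H n) - rising"
  have sets: "C \<in> sets (P y)" "D \<in> sets (P y)" "(\<Inter>n. H n) \<in> sets (P y)"
    using H_sets rising_sets unfolding C_def D_def space sets_P[OF y] by auto
  have "prob D = prob (\<Inter>n. H n)"
    using AE_H sets by (intro finite_measure_eq_AE) (auto simp: D_def dest: rising_not_tendsto elim: eventually_mono)
  moreover have "prob C = 1 - S y / S \<beta>"
    unfolding C_def using prob_rising[OF y] by (subst prob_compl) (auto simp: sets_P[OF y])
  moreover have "D \<subseteq> C" using sets.sets_into_space[OF sets(3)] by (auto simp: C_def D_def)
  ultimately have "prob (C - D) \<le> 0"
    using H_prob sets by (subst finite_measure_Diff) auto
  then have "prob (C - D) = 0" using measure_nonneg[of "P y" "C - D"] by linarith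
  then have "AE w in P y. w \<notin> C - D"
    using sets prob_eq_0[of "C - D"] by auto
  then show ?thesis
    using AE_H X_start[OF y] AE_space
  proof eventually_elim
    case (elim w)
    show ?case
    proof (cases "w \<in> rising")
      case True
      then show ?thesis using X_infinity_rising elim y by auto
    next
      case False
      then have "w \<in> (\<Inter>n. H n)" using elim by (auto simp: C_def D_def)
      then show ?thesis using X_infinity_tendsto[of w] elim y space False by auto
    qed
  qed
qed

section \<open>The martingale identity for \<open>S (X t)\<close>\<close>

lemma scale_X_measurable:
  assumes "space N = space M" "0 \<le> t" "X t \<in> borel_measurable N"
  shows "(\<lambda>w. S (X t w)) \<in> borel_measurable N"
proof -
  have X: "X t \<in> measurable N (restrict_space borel {\<alpha>..\<beta>})"
    using assms X_range[OF assms(2)] by (intro measurable_restrict_space2) auto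
  have S: "S \<in> borel_measurable (restrict_space borel {\<alpha>..\<beta>})"
    by (rule borel_measurable_continuous_on_restrict) (rule scale_continuous_closed)
  show ?thesis using measurable_compose[OF X S] .
qed

text \<open>On the interior this is the Markov property at time \<open>t\<close>. If
  \<open>X t = \<beta>\<close>, the path rises and the ratio is \<open>1\<close>; if
  \<open>X t = \<alpha>\<close>, it does not rise and the ratio is \<open>0\<close>.\<close>

lemma markov_natural:
  assumes y: "y \<in> I" and t: "0 \<le> t" and A: "A \<in> sets (natural (ennreal t))"
  shows "emeasure (P y) (A \<inter> rising) = (\<integral>\<^sup>+ w. ennreal (S (X t w) / S \<beta>) * indicator A w \<partial>P y)"
proof -
  interpret prob_space "P y" by (rule prob_P) fact
  \<comment> \<open>Rising expressed through rational times, which makes it a measurable set of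
    paths.\<close>
  define B where "B = {w \<in> space path_space. \<forall>n. \<exists>q\<in>\<rat> \<inter> {0..}. \<beta> - inverse (real (Suc n)) < w q}"
  have B: "B \<in> sets path_space"
  proof -
    note [measurable] = evaluation_measurable
    note [simp] = countable_nonneg_rats
    show ?thesis unfolding B_def by measurable
  qed
  have B_iff: "path_from X s w \<in> B \<longleftrightarrow>
      (\<forall>n. \<exists>q\<in>\<rat> \<inter> {0..}. \<beta> - inverse (real (Suc n)) < X (s + q) w)" for s w
    by (auto simp: B_def path_from_in_space path_from_apply)
  have start: "{w \<in> space M. path_from X 0 w \<in> B} = rising"
    unfolding B_iff rising_alt by simp
  have shift: "path_from X t w \<in> B \<longleftrightarrow> w \<in> rising" if w: "w \<in> space M" "X t w < \<beta>" for w
  proof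
    assume in_B: "path_from X t w \<in> B"
    have "\<exists>t\<ge>0. b < X t w" if b: "b < \<beta>" for b
    proof -
      obtain n where "inverse (real (Suc n)) < \<beta> - b" using reals_Archimedean[of "\<beta> - b"] b by auto
      moreover obtain q where "0 \<le> q" "\<beta> - inverse (real (Suc n)) < X (t + q) w" using in_B by (auto simp: B_iff)
      ultimately show ?thesis using t by (intro exI[of _ "t + q"]) auto
    qed
    then show "w \<in> rising" using w by (simp add: rising_def)
  next
    assume rising: "w \<in> rising"
    have "\<exists>q\<in>\<rat> \<inter> {0..}. b < X (t + q) w" if b: "b < \<beta>" for b
    proof -
      obtain s where s: "t < s" "b < X s w" using rising_later[OF rising t w(2) b] by blast
      have "continuous_on {0..} (\<lambda>s. X (t + s) w)"
        using t by (intro continuous_on_compose2[OF X_continuous[OF w(1)]] continuous_intros) auto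
      then obtain q where "q \<in> \<rat>" "s - t < q" "X (t + q) w \<in> {b<..}"
        using continuous_near_rational[of "\<lambda>s. X (t + s) w" "{b<..}" "s - t" "s - t + 1"] s by auto
      then show ?thesis using s by auto
    qed
    then show "path_from X t w \<in> B" by (simp add: B_iff)
  qed
  have at_\<beta>: "w \<in> rising" if "w \<in> space M" "X t w = \<beta>" for w
    using that t by (auto simp: rising_def)
  have at_\<alpha>: "w \<notin> rising" if "X t w = \<alpha>" for w
  proof
    assume rising: "w \<in> rising"
    then have w: "w \<in> space M" by (simp add: rising_def)
    have "X t w < \<beta>" using that \<alpha>_less_\<beta> by simp
    then obtain s where "t < s" "\<alpha> < X s w"
      using rising_later[OF rising t _ \<alpha>_less_\<beta>] by blast
    then show False using X_boundary[of t s w] w t that by simp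
  qed
  have A_space: "A \<subseteq> space M" using sets.sets_into_space[OF A] by (simp add: space_natural_filtration)
  have A_M: "A \<in> sets M" using A sets_natural_le by blast
  have [measurable]: "X t \<in> borel_measurable M" using t by (rule X_measurable)
  have const: "stopping_time (natural) (\<lambda>_. ennreal t)"
    by (rule stopping_time_const)
  have "A \<in> sets (filtration.pre_sigma (space M) (natural) (\<lambda>_. ennreal t))"
  proof (rule filtration.sets_pre_sigmaI[OF filtration_natural const])
    fix s
    show "{w \<in> A. ennreal t \<le> s} \<in> sets (natural s)"
      using A filtration.sets_F_mono[OF filtration_natural, where i = "ennreal t" and j = s]
      by (cases "ennreal t \<le> s") auto
  qed
  note markov = strong_Markov[OF y const this B]
  define A0 where "A0 = {w \<in> A. X t w \<in> I}"
  define A1 where "A1 = {w \<in> A. X t w = \<beta>}"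
  have A_sets: "A0 \<in> sets M" "A1 \<in> sets M"
  proof -
    have "A0 = A \<inter> {w \<in> space M. X t w \<in> I}" "A1 = A \<inter> {w \<in> space M. X t w = \<beta>}"
      using A_space by (auto simp: A0_def A1_def)
    moreover have "{w \<in> space M. X t w \<in> I} \<in> sets M" "{w \<in> space M. X t w = \<beta>} \<in> sets M"
      by measurable
    ultimately show "A0 \<in> sets M" "A1 \<in> sets M" using A_M by auto
  qed
  have split: "A \<inter> rising = (A0 \<inter> rising) \<union> A1" "(A0 \<inter> rising) \<inter> A1 = {}"
  proof -
    have "X t w \<in> I \<or> X t w = \<alpha> \<or> X t w = \<beta>" if "w \<in> A" for w
      using X_range[OF t, of w] A_space that by force
    then show "A \<inter> rising = (A0 \<inter> rising) \<union> A1"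
      using at_\<alpha> at_\<beta> A_space by (fastforce simp: A0_def A1_def)
  qed (auto simp: A0_def A1_def)
  have "A0 \<inter> rising = {w \<in> A. ennreal t < \<top> \<and> X (enn2real (ennreal t)) w \<in> I \<and>
      path_from X (enn2real (ennreal t)) w \<in> B}"
    using shift A_space t by (auto simp: A0_def)
  then have "emeasure (P y) (A0 \<inter> rising) = (\<integral>\<^sup>+ w. emeasure (P (X t w)) rising * indicator A0 w \<partial>P y)"
    using markov t unfolding start A0_def by simp
  also have "\<dots> = (\<integral>\<^sup>+ w. ennreal (S (X t w) / S \<beta>) * indicator A0 w \<partial>P y)"
  proof (intro nn_integral_cong)
    fix w
    show "emeasure (P (X t w)) rising * indicator A0 w = ennreal (S (X t w) / S \<beta>) * indicator A0 w"
    proof (cases "w \<in> A0")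
      case True
      then have "X t w \<in> I" by (simp add: A0_def)
      then show ?thesis
        using prob_rising[of "X t w"] prob_P[of "X t w"]
        by (simp add: finite_measure.emeasure_eq_measure prob_space.finite_measure)
    qed simp
  qed
  finally have "emeasure (P y) (A \<inter> rising) =
      (\<integral>\<^sup>+ w. ennreal (S (X t w) / S \<beta>) * indicator A0 w \<partial>P y) + (\<integral>\<^sup>+ w. indicator A1 w \<partial>P y)"
    unfolding split(1) using split(2) A_sets rising_sets
    by (subst plus_emeasure[symmetric]) (auto simp: sets_P[OF y])
  also have "(\<integral>\<^sup>+ w. ennreal (S (X t w) / S \<beta>) * indicator A0 w \<partial>P y) + (\<integral>\<^sup>+ w. indicator A1 w \<partial>P y) =
      (\<integral>\<^sup>+ w. ennreal (S (X t w) / S \<beta>) * indicator A0 w + indicator A1 w \<partial>P y)"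
    using A_sets scale_X_measurable[of M t] t
    by (intro nn_integral_add[symmetric]) (auto simp: measurable_P[OF y] X_measurable)
  also have "\<dots> = (\<integral>\<^sup>+ w. ennreal (S (X t w) / S \<beta>) * indicator A w \<partial>P y)"
  proof (intro nn_integral_cong)
    fix w assume "w \<in> space (P y)"
    then have "X t w \<in> I \<or> X t w = \<alpha> \<or> X t w = \<beta>"
      using X_range[OF t, of w] space_P[OF y] by force
    then show "ennreal (S (X t w) / S \<beta>) * indicator A0 w + indicator A1 w =
        ennreal (S (X t w) / S \<beta>) * indicator A w"
      using \<alpha>_less_\<beta> scale_pos[of \<beta>] S_\<alpha> by (auto simp: A0_def A1_def split: split_indicator)
  qed
  finally show ?thesis .
qed

end

section \<open>Optional stopping\<close>

locale randomized_diffusion = attractive_diffusion + randomization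
begin

abbreviation "randomized \<equiv> randomized_filtration (space M) U X"
abbreviation "\<T> \<equiv> randomized_stopping_times M U X"

text \<open>\<open>S\<close> is unspecified outside \<open>[\<alpha>, \<beta>]\<close>, where \<open>value_at\<close> may lie on a null set (\<open>X_infinity\<close> is \<open>0\<close> on
  paths starting at the boundary).\<close>

definition scale_ext :: "real \<Rightarrow> real" where
  "scale_ext z = S (max \<alpha> (min \<beta> z))"

lemma scale_ext_eq: "z \<in> {\<alpha>..\<beta>} \<Longrightarrow> scale_ext z = S z"
  by (auto simp: scale_ext_def max_def min_def)

lemma continuous_scale_ext: "continuous_on UNIV scale_ext"
  unfolding scale_ext_def[abs_def]
  by (rule continuous_on_compose2[OF scale_continuous_closed])
    (use \<alpha>_less_\<beta> in \<open>auto intro!: continuous_intros\<close>)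

lemma scale_ext_measurable [measurable]: "scale_ext \<in> borel_measurable borel"
  using continuous_scale_ext by (rule borel_measurable_continuous_onI)

lemma scale_ext_bounds: "0 \<le> scale_ext z" "scale_ext z \<le> S \<beta>"
  using scale_nonneg[of "max \<alpha> (min \<beta> z)"] scale_le[of "max \<alpha> (min \<beta> z)" \<beta>] \<alpha>_less_\<beta>
  by (auto simp: scale_ext_def)

lemma scale_ext_X: "0 \<le> t \<Longrightarrow> w \<in> space M \<Longrightarrow> scale_ext (X t w) = S (X t w)"
  using X_range by (intro scale_ext_eq) auto

lemma sets_randomized_le: "sets (randomized t) \<subseteq> sets M"
  unfolding sets_randomized_filtration
  by (intro sets.sigma_sets_subset)
    (auto intro: measurable_sets[OF X_measurable] measurable_sets[OF U_measurable])

lemma integrable_bounded_P: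
  fixes f :: "'a \<Rightarrow> real"
  assumes y: "y \<in> I" and f: "f \<in> borel_measurable M" and K: "AE w in P y. \<bar>f w\<bar> \<le> K"
  shows "integrable (P y) f"
proof -
  interpret prob_space "P y" by (rule prob_P) fact
  show ?thesis
    using K f by (intro integrable_const_bound[where B = K]) (auto simp: measurable_P[OF y])
qed

lemma U_independent:
  fixes f :: "'a \<Rightarrow> real"
  assumes y: "y \<in> I" and B: "B \<in> sets borel"
    and f: "f \<in> borel_measurable (natural \<top>)" and int: "integrable (P y) f"
  shows "(\<integral>w. indicator B (U w) * f w \<partial>P y) = measure (P y) {w \<in> space M. U w \<in> B} * (\<integral>w. f w \<partial>P y)"
proof -
  interpret prob_space "P y" by (rule prob_P) fact
  note space = space_P[OF y]
  have [measurable]: "U \<in> borel_measurable M" by (rule U_measurable)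
  have gM: "(\<lambda>w. indicator B (U w) :: real) \<in> borel_measurable M" using B by measurable
  have gV: "(\<lambda>w. indicator B (U w) :: real) \<in> borel_measurable (vimage_algebra (space M) U borel)"
    using measurable_compose[OF measurable_vimage_algebra1 borel_measurable_indicator[OF B], of U "space M"] by simp
  have fM: "f \<in> borel_measurable M" using f by (rule natural_measurable_M)
  have "indep_var borel (\<lambda>w. indicator B (U w)) borel f"
    unfolding indep_var_eq
  proof (intro conjI)
    have 1: "sigma_sets (space (P y)) {(\<lambda>w. indicator B (U w) :: real) -` A \<inter> space (P y) |A. A \<in> sets borel} \<subseteq>
        sets (vimage_algebra (space M) U borel)"
      using sets.sigma_sets_subset[of "{(\<lambda>w. indicator B (U w) :: real) -` A \<inter> space M |A. A \<in> sets borel}"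
          "vimage_algebra (space M) U borel"] measurable_sets[OF gV] space by auto
    have 2: "sigma_sets (space (P y)) {f -` A \<inter> space (P y) |A. A \<in> sets borel} \<subseteq>
        sets (natural \<top>)"
      using sets.sigma_sets_subset[of "{f -` A \<inter> space M |A. A \<in> sets borel}"
          "natural \<top>"] measurable_sets[OF f] space
      by (auto simp: space_natural_filtration)
    show "indep_set (sigma_sets (space (P y)) {(\<lambda>w. indicator B (U w) :: real) -` A \<inter> space (P y) |A. A \<in> sets borel})
        (sigma_sets (space (P y)) {f -` A \<inter> space (P y) |A. A \<in> sets borel})"
      using U_indep[OF y] 1 2 unfolding indep_sets2_eq by blast
  qed (use gM fM in \<open>auto simp: measurable_P[OF y]\<close>)
  then have "(\<integral>w. indicator B (U w) * f w \<partial>P y) = (\<integral>w. indicator B (U w) \<partial>P y) * (\<integral>w. f w \<partial>P y)"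
    by (rule indep_var_lebesgue_integral[OF _ _ int])
      (auto intro!: integrable_bounded_P[OF y gM, where K = 1])
  also have "(\<integral>w. indicator B (U w) \<partial>P y) = (\<integral>w. indicator {w \<in> space M. U w \<in> B} w \<partial>P y)"
    by (intro Bochner_Integration.integral_cong) (auto simp: space split: split_indicator)
  also have "\<dots> = measure (P y) {w \<in> space M. U w \<in> B}" using B by (simp add: sets_P[OF y])
  finally show ?thesis .
qed

lemma nn_integral_scale_X:
  assumes y: "y \<in> I" and t: "0 \<le> t" and A: "A \<in> sets M"
  shows "(\<integral>\<^sup>+ w. ennreal (S (X t w) / S \<beta>) * indicator A w \<partial>P y) =
    ennreal (\<integral>w. scale_ext (X t w) / S \<beta> * indicator A w \<partial>P y)"
proof -
  have [measurable]: "X t \<in> borel_measurable M" using t by (rule X_measurable)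
  have bnd: "0 \<le> scale_ext z / S \<beta> * indicator A w" "scale_ext z / S \<beta> * indicator A w \<le> 1" for z w
    using scale_ext_bounds[of z] scale_pos[of \<beta>] \<alpha>_less_\<beta> by (auto split: split_indicator)
  have "(\<integral>\<^sup>+ w. ennreal (S (X t w) / S \<beta>) * indicator A w \<partial>P y) =
      (\<integral>\<^sup>+ w. ennreal (scale_ext (X t w) / S \<beta> * indicator A w) \<partial>P y)"
    using t by (intro nn_integral_cong) (auto simp: scale_ext_X space_P[OF y] split: split_indicator)
  also have "\<dots> = ennreal (\<integral>w. scale_ext (X t w) / S \<beta> * indicator A w \<partial>P y)"
  proof (rule nn_integral_eq_integral)
    show "integrable (P y) (\<lambda>w. scale_ext (X t w) / S \<beta> * indicator A w)"
    proof (rule integrable_bounded_P[OF y, where K = 1])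
      show "AE w in P y. \<bar>scale_ext (X t w) / S \<beta> * indicator A w\<bar> \<le> 1"
        by (intro AE_I2) (simp only: abs_of_nonneg bnd)
    qed (use A in measurable)
  qed (use bnd in auto)
  finally show ?thesis .
qed

text \<open>Both sides are finite measures in \<open>A\<close>. By independence of \<open>U\<close>
  they agree on intersections of a \<open>U\<close>-event with an event of the natural filtration;
  these are closed under intersection and generate the randomized filtration.\<close>

lemma markov_randomized:
  assumes y: "y \<in> I" and t: "0 \<le> t"
    and A: "A \<in> sets (randomized (ennreal t))"
  shows "emeasure (P y) (A \<inter> rising) = (\<integral>\<^sup>+ w. ennreal (S (X t w) / S \<beta>) * indicator A w \<partial>P y)"
proof -
  interpret prob_space "P y" by (rule prob_P) fact
  note space = space_P[OF y]
  have Xt [measurable]: "X t \<in> borel_measurable M" using t by (rule X_measurable)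
  have Um [measurable]: "U \<in> borel_measurable M" by (rule U_measurable)
  let ?F = "natural (ennreal t)"
  define E where "E = {{w \<in> space M. U w \<in> B} \<inter> A' |B A'. B \<in> sets borel \<and> A' \<in> sets ?F}"
  define M1 where "M1 = density (P y) (indicator rising)"
  define M2 where "M2 = density (P y) (\<lambda>w. ennreal (S (X t w) / S \<beta>))"
  have rising: "rising \<in> sets (P y)" by (simp add: sets_P[OF y])
  have m2: "(\<lambda>w. ennreal (S (X t w) / S \<beta>)) \<in> borel_measurable (P y)"
    using scale_X_measurable[OF refl t Xt] by (simp add: measurable_P[OF y])
  have M1_eq: "emeasure M1 A = emeasure (P y) (A \<inter> rising)" if "A \<in> sets M" for A
    unfolding M1_def using that rising
    by (subst emeasure_density)
      (auto simp: sets_P[OF y] indicator_inter_arith[symmetric] Int_commute intro!: borel_measurable_indicator)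
  have M2_eq: "emeasure M2 A = (\<integral>\<^sup>+ w. ennreal (S (X t w) / S \<beta>) * indicator A w \<partial>P y)" if "A \<in> sets M" for A
    unfolding M2_def using that m2 by (subst emeasure_density) (auto simp: sets_P[OF y])
  have F_M: "A' \<in> sets M" if "A' \<in> sets ?F" for A' using that sets_natural_le by blast
  have eq: "emeasure M1 A = emeasure M2 A" if AE: "A \<in> E" for A
  proof -
    obtain B A' where A: "A = {w \<in> space M. U w \<in> B} \<inter> A'" "B \<in> sets borel" "A' \<in> sets ?F"
      using AE by (auto simp: E_def)
    have UB: "{w \<in> space M. U w \<in> B} \<in> sets M" using A(2) by measurable
    have A_M: "A \<in> sets M" unfolding A(1) using UB F_M[OF A(3)] by (rule sets.Int)
    have A'_nat: "A' \<in> sets (natural \<top>)"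
      using A(3) filtration.sets_F_mono[OF filtration_natural, where i = "ennreal t" and j = \<top>] by auto
    have Xt_nat [measurable]: "X t \<in> borel_measurable (natural \<top>)"
      using t by (intro measurable_natural_filtration) auto
    define pU where "pU = prob {w \<in> space M. U w \<in> B}"
    define f where "f w = scale_ext (X t w) / S \<beta> * indicator A' w" for w
    have f: "f \<in> borel_measurable (natural \<top>)"
      unfolding f_def[abs_def] using A'_nat by measurable
    have f_int: "integrable (P y) f"
    proof (rule integrable_bounded_P[OF y, where K = 1])
      show "f \<in> borel_measurable M" using f by (rule natural_measurable_M)
      show "AE w in P y. \<bar>f w\<bar> \<le> 1"
        using scale_ext_bounds scale_pos[of \<beta>] \<alpha>_less_\<beta> by (auto simp: f_def split: split_indicator)
    qed
    have "ennreal (prob (A' \<inter> rising)) = ennreal (\<integral>w. f w \<partial>P y)"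
      using markov_natural[OF y t A(3)] nn_integral_scale_X[OF y t F_M[OF A(3)]]
      by (simp add: f_def emeasure_eq_measure)
    moreover have "0 \<le> (\<integral>w. f w \<partial>P y)"
      using scale_ext_bounds scale_pos[of \<beta>] \<alpha>_less_\<beta>
      by (intro integral_nonneg_AE) (auto simp: f_def split: split_indicator)
    ultimately have mk: "prob (A' \<inter> rising) = (\<integral>w. f w \<partial>P y)" by simp
    have "prob (A \<inter> rising) = prob ({w \<in> space M. U w \<in> B} \<inter> (A' \<inter> rising))"
      using A(1) by (simp add: Int_assoc)
    also have "\<dots> = pU * prob (A' \<inter> rising)"
      unfolding pU_def
    proof (rule indep_setD[OF U_indep[OF y]])
      have "U -` B \<inter> space M \<in> sets (vimage_algebra (space M) U borel)"
        using A(2) by (rule in_vimage_algebra)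
      then show "{w \<in> space M. U w \<in> B} \<in> sets (vimage_algebra (space M) U borel)"
        by (simp add: vimage_def Int_def conj_commute)
      show "A' \<inter> rising \<in> sets (natural \<top>)" using A'_nat rising_natural by auto
    qed
    also have "\<dots> = (\<integral>w. indicator B (U w) * f w \<partial>P y)"
      unfolding mk pU_def using U_independent[OF y A(2) f f_int] by simp
    also have "\<dots> = (\<integral>w. scale_ext (X t w) / S \<beta> * indicator A w \<partial>P y)"
      by (intro Bochner_Integration.integral_cong)
        (auto simp: f_def A(1) space split: split_indicator)
    finally show ?thesis
      unfolding M1_eq[OF A_M] M2_eq[OF A_M] nn_integral_scale_X[OF y t A_M] by (simp add: emeasure_eq_measure)
  qed
  have UNIV_E: "{w \<in> space M. U w \<in> B} \<in> E" if "B \<in> sets borel" for B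
  proof -
    have "space M \<in> sets ?F" using sets.top[of ?F] by (simp add: space_natural_filtration)
    then show ?thesis unfolding E_def using that by blast
  qed
  have F_E: "A' \<in> E" if "A' \<in> sets ?F" for A'
  proof -
    have eq: "A' = {w \<in> space M. U w \<in> UNIV} \<inter> A'"
      using sets.sets_into_space[OF that] by (auto simp: space_natural_filtration)
    show ?thesis
      unfolding E_def by (intro CollectI exI[of _ UNIV] exI[of _ A'] conjI eq that) simp
  qed
  have E_M: "E \<subseteq> sets M"
  proof
    fix A assume "A \<in> E"
    then obtain B A' where A: "A = {w \<in> space M. U w \<in> B} \<inter> A'" "B \<in> sets borel" "A' \<in> sets ?F"
      by (auto simp: E_def)
    have "{w \<in> space M. U w \<in> B} \<in> sets M" using A(2) by measurable
    then show "A \<in> sets M" unfolding A(1) using F_M[OF A(3)] by (rule sets.Int)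
  qed
  have stable: "Int_stable E"
  proof (rule Int_stableI)
    fix A1 A2 assume "A1 \<in> E" "A2 \<in> E"
    then obtain B1 A1' B2 A2' where *: "A1 = {w \<in> space M. U w \<in> B1} \<inter> A1'" "A2 = {w \<in> space M. U w \<in> B2} \<inter> A2'"
      "B1 \<in> sets borel" "B2 \<in> sets borel" "A1' \<in> sets ?F" "A2' \<in> sets ?F" by (auto simp: E_def)
    then have "A1 \<inter> A2 = {w \<in> space M. U w \<in> B1 \<inter> B2} \<inter> (A1' \<inter> A2')" by auto
    then show "A1 \<inter> A2 \<in> E" unfolding E_def using * by blast
  qed
  have top: "emeasure M1 (space M) = emeasure M2 (space M)"
    using eq UNIV_E[of UNIV] by simp
  have "emeasure M1 (space M) \<le> 1"
    unfolding M1_eq[OF sets.top] by (rule measure_le_1)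
  moreover have s: "sets M1 = sets M" "sets M2 = sets M" "space M1 = space M" "space M2 = space M"
    by (simp_all add: M1_def M2_def sets_P[OF y] space)
  ultimately have fin: "finite_measure M1" "finite_measure M2"
    using top by (auto intro!: finite_measureI simp: top_unique)
  have "A \<in> sigma_sets (space M) E"
  proof -
    have "{U -` B \<inter> space M |B. B \<in> sets borel} \<union>
        {X s -` B \<inter> space M |s B. 0 \<le> s \<and> ennreal s \<le> ennreal t \<and> B \<in> sets borel} \<subseteq> E"
    proof (intro Un_least subsetI)
      fix A assume "A \<in> {U -` B \<inter> space M |B. B \<in> sets borel}"
      then obtain B where "B \<in> sets borel" "A = {w \<in> space M. U w \<in> B}" by auto
      then show "A \<in> E" using UNIV_E by simp
    next
      fix A assume "A \<in> {X s -` B \<inter> space M |s B. 0 \<le> s \<and> ennreal s \<le> ennreal t \<and> B \<in> sets borel}"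
      then show "A \<in> E" by (intro F_E) (auto simp: sets_natural_filtration)
    qed
    then show ?thesis using A unfolding sets_randomized_filtration using sigma_sets_mono' by blast
  qed
  then have "emeasure M1 A = emeasure M2 A"
    by (intro emeasure_eq_on_sigma_sets[OF stable _ _ fin eq]) (simp_all only: s E_M top)
  then show ?thesis
    using M1_eq[OF subsetD[OF sets_randomized_le A]] M2_eq[OF subsetD[OF sets_randomized_le A]] by simp
qed

lemma value_at_AE:
  assumes y: "y \<in> I"
  shows "AE w in P y. stopped \<tau> w \<in> {\<alpha>..\<beta>}"
  using terminal_value_AE[OF y] AE_space
proof eventually_elim
  case (elim w)
  then show ?case using X_range[of "enn2real (\<tau> w)" w] space_P[OF y] \<alpha>_less_\<beta> by (auto simp: value_at_def)
qed

text \<open>Where \<tau> is finite, it is rounded up to a grid and the martingale identity is summed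
  over its values. The result does not depend on the mesh, so dominated convergence carries it over
  to \<tau>. Where \<tau> is infinite, the stopped value is \<beta> or \<alpha> according to rising.
  The two parts add up to the probability of rising.\<close>

lemma optional_stopping:
  assumes y: "y \<in> I" and \<tau>: "\<tau> \<in> \<T>"
  shows "(\<integral>w. scale_ext (stopped \<tau> w) \<partial>P y) = S y"
proof -
  interpret prob_space "P y" by (rule prob_P) fact
  note space = space_P[OF y]
  let ?F = "randomized"
  have stop: "stopping_time ?F \<tau>" using \<tau> by (simp add: randomized_stopping_times_def)
  have \<tau>M [measurable]: "\<tau> \<in> borel_measurable M"
    using measurable_stopping_time[OF stop, of M] sets_randomized_le by (simp add: space_randomized_filtration)
  have V [measurable]: "stopped \<tau> \<in> borel_measurable M"
    by (intro measurable_value_at X_measurable) auto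
  have S\<beta>: "0 < S \<beta>" using scale_pos \<alpha>_less_\<beta> by simp
  define fin where "fin = {w \<in> space M. \<tau> w < \<top>}"
  have fin_M [measurable]: "fin \<in> sets M" unfolding fin_def by measurable
  define W where "W n w = X (real (grid_index n (\<tau> w)) / real (Suc n)) w" for n w
  have "grid_index n \<in> measurable borel (count_space UNIV)" for n
    unfolding grid_index_def by measurable
  then have g [measurable]: "(\<lambda>w. grid_index n (\<tau> w)) \<in> measurable M (count_space UNIV)" for n
    using \<tau>M by (rule measurable_compose[rotated])
  have W [measurable]: "W n \<in> borel_measurable M" for n
    unfolding W_def[abs_def]
    by (rule measurable_compose_countable[where f = "\<lambda>k. X (real k / real (Suc n))"]) (auto intro: X_measurable)
  have grid: "(\<integral>w. scale_ext (W n w) / S \<beta> * indicator fin w \<partial>P y) = prob (fin \<inter> rising)" for n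
  proof -
    define A where "A k = {w \<in> space M. \<tau> w < \<top> \<and> grid_index n (\<tau> w) = k}" for k
    have A_M [measurable]: "A k \<in> sets M" for k unfolding A_def by measurable
    have disj: "disjoint_family A" by (auto simp: A_def disjoint_family_on_def)
    have Un: "(\<Union>k. A k) = fin" by (auto simp: A_def fin_def)
    have le: "{w \<in> space M. \<tau> w < \<top> \<and> grid_index n (\<tau> w) \<le> j} \<in> sets (?F (ennreal (real k / real (Suc n))))"
      if "j \<le> k" for j k
    proof -
      have "{w \<in> space M. \<tau> w < \<top> \<and> grid_index n (\<tau> w) \<le> j} = {w \<in> space M. \<tau> w \<le> ennreal (real j / real (Suc n))}"
        using grid_index_le_iff[of "\<tau> _" n j] by (auto simp: le_less_trans)
      also have "\<dots> \<in> sets (?F (ennreal (real j / real (Suc n))))"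
        using stopping_timeD[OF stop, of "ennreal (real j / real (Suc n))"]
        by (simp add: pred_def space_randomized_filtration)
      also have "\<dots> \<subseteq> sets (?F (ennreal (real k / real (Suc n))))"
        using that by (intro filtration.sets_F_mono[OF filtration_randomized] ennreal_leI divide_right_mono) auto
      finally show ?thesis .
    qed
    \<comment> \<open>For finite \<tau>, rounding up makes index at most \<open>k\<close> equivalent
      to \<tau> at most \<open>k / (n + 1)\<close>. Hence an index equal to \<open>k\<close> is
      decided by the corresponding grid time.\<close>
    have A_F: "A k \<in> sets (?F (ennreal (real k / real (Suc n))))" for k
    proof -
      have "A k = {w \<in> space M. \<tau> w < \<top> \<and> grid_index n (\<tau> w) \<le> k} -
          (\<Union>j<k. {w \<in> space M. \<tau> w < \<top> \<and> grid_index n (\<tau> w) \<le> j})"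
        by (force simp: A_def)
      then show ?thesis using le by auto
    qed
    have "(\<integral>\<^sup>+ w. ennreal (scale_ext (W n w) / S \<beta>) * indicator fin w \<partial>P y) =
        (\<Sum>k. \<integral>\<^sup>+ w. ennreal (scale_ext (W n w) / S \<beta>) * indicator (A k) w \<partial>P y)"
      unfolding Un[symmetric] using disj
      by (intro nn_integral_disjoint_family) (auto simp: measurable_P[OF y] sets_P[OF y])
    also have "\<dots> = (\<Sum>k. emeasure (P y) (A k \<inter> rising))"
    proof (intro suminf_cong)
      fix k
      have "(\<integral>\<^sup>+ w. ennreal (scale_ext (W n w) / S \<beta>) * indicator (A k) w \<partial>P y) =
          (\<integral>\<^sup>+ w. ennreal (S (X (real k / real (Suc n)) w) / S \<beta>) * indicator (A k) w \<partial>P y)"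
        by (intro nn_integral_cong) (auto simp: W_def A_def scale_ext_X split: split_indicator)
      also have "\<dots> = emeasure (P y) (A k \<inter> rising)"
        by (rule markov_randomized[OF y _ A_F, symmetric]) simp
      finally show "(\<integral>\<^sup>+ w. ennreal (scale_ext (W n w) / S \<beta>) * indicator (A k) w \<partial>P y) =
          emeasure (P y) (A k \<inter> rising)" .
    qed
    also have "\<dots> = emeasure (P y) (\<Union>k. A k \<inter> rising)"
      using disj by (intro suminf_emeasure) (auto simp: sets_P[OF y] disjoint_family_on_def)
    also have "(\<Union>k. A k \<inter> rising) = fin \<inter> rising" unfolding Un[symmetric] by auto
    finally have nn: "(\<integral>\<^sup>+ w. ennreal (scale_ext (W n w) / S \<beta> * indicator fin w) \<partial>P y) = ennreal (prob (fin \<inter> rising))"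
      unfolding emeasure_eq_measure
      by (subst nn_integral_cong[where v = "\<lambda>w. ennreal (scale_ext (W n w) / S \<beta>) * indicator fin w"])
        (auto split: split_indicator)
    show ?thesis
    proof (rule integral_eq_nn_integral[THEN trans])
      show "enn2real (\<integral>\<^sup>+ w. ennreal (scale_ext (W n w) / S \<beta> * indicator fin w) \<partial>P y) = prob (fin \<inter> rising)"
        unfolding nn by simp
    qed (use scale_ext_bounds S\<beta> in \<open>auto simp: measurable_P[OF y] less_imp_le\<close>)
  qed
  have "(\<lambda>n. \<integral>w. scale_ext (W n w) / S \<beta> * indicator fin w \<partial>P y) \<longlonglongrightarrow>
      (\<integral>w. scale_ext (stopped \<tau> w) / S \<beta> * indicator fin w \<partial>P y)"
  proof (rule integral_dominated_convergence[where w = "\<lambda>_. 1"])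
    show "AE w in P y. (\<lambda>n. scale_ext (W n w) / S \<beta> * indicator fin w) \<longlonglongrightarrow>
        scale_ext (stopped \<tau> w) / S \<beta> * indicator fin w"
    proof (rule AE_I2)
      fix w assume "w \<in> space (P y)"
      then have w: "w \<in> space M" by (simp add: space)
      show "(\<lambda>n. scale_ext (W n w) / S \<beta> * indicator fin w) \<longlonglongrightarrow>
          scale_ext (stopped \<tau> w) / S \<beta> * indicator fin w"
      proof (cases "w \<in> fin")
        case True
        then have "(\<lambda>n. W n w) \<longlonglongrightarrow> stopped \<tau> w"
          using X_grid_tendsto[OF w, of "\<tau> w"]
          by (simp add: fin_def W_def value_at_def order.strict_implies_not_eq del: of_nat_Suc)
        then have "(\<lambda>n. scale_ext (W n w)) \<longlonglongrightarrow> scale_ext (stopped \<tau> w)"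
          by (intro continuous_on_tendsto_compose[OF continuous_scale_ext]) auto
        then show ?thesis using S\<beta> by (intro tendsto_intros) auto
      qed simp
    qed
    show "AE w in P y. norm (scale_ext (W n w) / S \<beta> * indicator fin w) \<le> 1" for n
      using scale_ext_bounds S\<beta> by (auto split: split_indicator)
  qed (auto simp: measurable_P[OF y])
  then have finite_part: "(\<integral>w. scale_ext (stopped \<tau> w) / S \<beta> * indicator fin w \<partial>P y) = prob (fin \<inter> rising)"
    unfolding grid by (rule LIMSEQ_unique[OF _ tendsto_const])
  have infinite_part: "(\<integral>w. scale_ext (stopped \<tau> w) / S \<beta> * indicator (space M - fin) w \<partial>P y) =
      prob ((space M - fin) \<inter> rising)"
  proof -
    have "(\<integral>w. scale_ext (stopped \<tau> w) / S \<beta> * indicator (space M - fin) w \<partial>P y) =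
        (\<integral>w. indicator ((space M - fin) \<inter> rising) w \<partial>P y)"
    proof (rule integral_cong_AE)
      show "AE w in P y. scale_ext (stopped \<tau> w) / S \<beta> * indicator (space M - fin) w =
          indicator ((space M - fin) \<inter> rising) w"
        using terminal_value_AE[OF y]
      proof eventually_elim
        case (elim w)
        show ?case
        proof (cases "w \<in> space M - fin")
          case True
          then have "stopped \<tau> w = limit w"
            by (auto simp: fin_def value_at_def less_top)
          then show ?thesis
            using True elim S\<beta> \<alpha>_less_\<beta> S_\<alpha> by (auto simp: scale_ext_eq split: split_indicator)
        qed simp
      qed
    qed (auto simp: measurable_P[OF y])
    then show ?thesis by (simp add: sets_P[OF y])
  qed
  have int: "integrable (P y) (\<lambda>w. scale_ext (stopped \<tau> w) / S \<beta> * indicator A w)" if "A \<in> sets M" for A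
    using that scale_ext_bounds S\<beta>
    by (intro integrable_bounded_P[OF y, where K = 1]) (auto split: split_indicator)
  have "(\<integral>w. scale_ext (stopped \<tau> w) / S \<beta> \<partial>P y) =
      (\<integral>w. scale_ext (stopped \<tau> w) / S \<beta> * indicator fin w +
        scale_ext (stopped \<tau> w) / S \<beta> * indicator (space M - fin) w \<partial>P y)"
    by (intro Bochner_Integration.integral_cong) (auto simp: space split: split_indicator)
  also have "\<dots> = prob (fin \<inter> rising) + prob ((space M - fin) \<inter> rising)"
    unfolding finite_part[symmetric] infinite_part[symmetric]
    by (intro Bochner_Integration.integral_add int) auto
  also have "\<dots> = prob ((fin \<inter> rising) \<union> ((space M - fin) \<inter> rising))"
    by (intro finite_measure_Union[symmetric]) (auto simp: sets_P[OF y])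
  also have "(fin \<inter> rising) \<union> ((space M - fin) \<inter> rising) = rising"
    by (auto simp: rising_def)
  also have "prob rising = S y / S \<beta>" by (rule prob_rising[OF y])
  finally show ?thesis using S\<beta> by simp
qed

end

section \<open>Exit times that realize optimal mixtures\<close>

context randomized_diffusion
begin

lemma scale_at: "x \<in> I \<Longrightarrow> scale \<alpha> \<beta> S x"
  by unfold_locales (auto intro: scale_continuous_closed scale_less simp: S_\<alpha>)

lemma exit_time_randomized: "exit_time X a b \<in> \<T>"
  unfolding randomized_stopping_times_def exit_time_eq_entry
  by (auto intro!: entry_stopping_time_randomized simp: closed_Compl)

lemma mixed_time_randomized:
  assumes "\<tau>1 \<in> \<T>" "\<tau>2 \<in> \<T>"
  shows "mixed_time U p \<tau>1 \<tau>2 \<in> \<T>"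
  unfolding randomized_stopping_times_def
proof (intro CollectI stopping_timeI)
  fix t
  have [measurable]: "Measurable.pred (randomized t) (\<lambda>w. \<tau>1 w \<le> t)"
      "Measurable.pred (randomized t) (\<lambda>w. \<tau>2 w \<le> t)"
      "U \<in> borel_measurable (randomized t)"
    using assms stopping_timeD measurable_U_randomized_filtration
    by (auto simp: randomized_stopping_times_def)
  have "Measurable.pred (randomized t)
      (\<lambda>w. (U w < p \<and> \<tau>1 w \<le> t) \<or> (\<not> U w < p \<and> \<tau>2 w \<le> t))"
    by measurable
  also have "(\<lambda>w. (U w < p \<and> \<tau>1 w \<le> t) \<or> (\<not> U w < p \<and> \<tau>2 w \<le> t)) = (\<lambda>w. mixed_time U p \<tau>1 \<tau>2 w \<le> t)"
    by (auto simp: mixed_time_def fun_eq_iff)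
  finally show "Measurable.pred (randomized t) (\<lambda>w. mixed_time U p \<tau>1 \<tau>2 w \<le> t)" .
qed

lemma value_at_measurable_M:
  assumes "\<tau> \<in> \<T>"
  shows "stopped \<tau> \<in> borel_measurable M"
proof -
  have "\<tau> \<in> borel_measurable M"
    using assms measurable_stopping_time[of "randomized" \<tau> M] sets_randomized_le
    by (simp add: space_randomized_filtration randomized_stopping_times_def)
  then show ?thesis by (intro measurable_value_at X_measurable) auto
qed

text \<open>Without exit the terminal value is \<alpha> or \<beta>, and a path that stays inside
  \<open>(a, b)\<close> can tend to it only if it coincides with \<open>a\<close> or
  \<open>b\<close>. With exit, the intermediate value theorem gives the value, and a start at an end
  point exits at time \<open>0\<close>.\<close>

lemma exit_value_AE:
  assumes y: "y \<in> I" and ab: "\<alpha> \<le> a" "a \<le> y" "y \<le> b" "b \<le> \<beta>"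
  shows "AE w in P y. stopped (exit_time X a b) w \<in> {a, b} \<and>
    (a = y \<or> b = y \<longrightarrow> stopped (exit_time X a b) w = y)"
  using terminal_value_AE[OF y] X_start[OF y] AE_space
proof eventually_elim
  case (elim w)
  have w: "w \<in> space M" using elim space_P[OF y] by simp
  have closed: "closed (- {a<..<b})" by (simp add: closed_Compl)
  show ?case
  proof (cases "exit_time X a b w = \<top>")
    case True
    then have inside: "a < X t w" "X t w < b" if "0 \<le> t" for t
      using that unfolding exit_time_eq_entry entry_time_top_iff by auto
    have strict: "a < y" "y < b" using inside[of 0] elim by auto
    have "limit w \<in> {a, b}"
    proof (cases "w \<in> rising")
      case True
      have "\<not> b < \<beta>" using True inside by (force simp: rising_def)
      then show ?thesis using elim True ab by auto
    next
      case False
      then have "limit w = \<alpha>" and lim: "((\<lambda>t. X t w) \<longlongrightarrow> \<alpha>) at_top" using elim by auto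
      moreover have "a \<le> \<alpha>"
        using inside by (intro tendsto_lowerbound[OF lim])
          (auto intro!: eventually_mono[OF eventually_ge_at_top[of 0]] less_imp_le)
      ultimately show ?thesis using ab by auto
    qed
    then show ?thesis using True strict by (auto simp: value_at_def)
  next
    case False
    then have fin: "entry_time X (- {a<..<b}) w < \<top>" by (simp add: exit_time_eq_entry less_top)
    obtain t where t: "0 \<le> t" "entry_time X (- {a<..<b}) w = ennreal t" "X t w \<in> - {a<..<b}"
        "\<And>s. 0 \<le> s \<Longrightarrow> s < t \<Longrightarrow> X s w \<notin> - {a<..<b}"
      using entry_time_finiteE[where X = X and w = w, OF X_continuous[OF w] closed fin] by blast
    have V: "stopped (exit_time X a b) w = X t w"
      using t(1,2) by (simp add: value_at_def exit_time_eq_entry)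
    show ?thesis
    proof (cases "a = y \<or> b = y")
      case True
      then have "t = 0" using t(4)[of 0] t(1) elim by force
      then show ?thesis using V elim True by auto
    next
      case False
      then have strict: "a < y" "y < b" using ab by auto
      have "X t w \<in> {a, b}"
      proof (cases "X t w \<le> a")
        case True
        obtain r where r: "r \<in> {0..t}" "X r w = a"
          using path_hits[OF w, of t 0 a] True t(1) elim strict by auto
        then have "r = t" using t(4)[of r] by force
        then show ?thesis using r by simp
      next
        case False
        then have "b \<le> X t w" using t(3) by auto
        then obtain r where r: "r \<in> {0..t}" "X r w = b"
          using path_hits[OF w, of 0 t b] t(1) elim strict by auto
        then have "r = t" using t(4)[of r] by force
        then show ?thesis using r by simp
      qed
      then show ?thesis using V False by auto
    qed
  qed
qed

text \<open>On two points the position is an affine function of \<open>S\<close>, so optional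
  stopping determines the mean.\<close>

lemma mean_at_exit_time:
  assumes y: "y \<in> I" and ab: "\<alpha> \<le> a" "a \<le> y" "y \<le> b" "b \<le> \<beta>"
  shows "mean_at \<alpha> \<beta> P X y (exit_time X a b) = mean_exit S y a b"
proof -
  interpret prob_space "P y" by (rule prob_P) fact
  let ?V = "stopped (exit_time X a b)"
  have V [measurable]: "?V \<in> borel_measurable M" by (rule value_at_measurable_M[OF exit_time_randomized])
  show ?thesis
  proof (cases "a < y \<and> y < b")
    case True
    then have Sab: "S a < S b" using scale_less[of a b] ab by auto
    have int: "integrable (P y) (\<lambda>w. scale_ext (?V w))"
      using scale_ext_bounds by (intro integrable_bounded_P[OF y, where K = "S \<beta>"]) auto
    have "(\<integral>w. ?V w \<partial>P y) = (\<integral>w. a + (b - a) / (S b - S a) * (scale_ext (?V w) - S a) \<partial>P y)"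
    proof (rule integral_cong_AE)
      show "AE w in P y. ?V w = a + (b - a) / (S b - S a) * (scale_ext (?V w) - S a)"
        using exit_value_AE[OF y ab]
        by eventually_elim (use ab Sab True in \<open>auto simp: scale_ext_eq\<close>)
    qed (auto simp: measurable_P[OF y])
    also have "\<dots> = a + (b - a) / (S b - S a) * (S y - S a)"
      using int optional_stopping[OF y exit_time_randomized, of a b] by (simp add: prob_space)
    also have "\<dots> = mean_exit S y a b"
      using True Sab by (simp add: mean_exit_def field_simps)
    finally show ?thesis by (simp add: mean_at_def)
  next
    case False
    have "(\<integral>w. ?V w \<partial>P y) = (\<integral>w. y \<partial>P y)"
      using exit_value_AE[OF y ab]
      by (intro integral_cong_AE) (use False ab in \<open>auto simp: measurable_P[OF y] elim: eventually_mono\<close>)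
    then show ?thesis using False by (auto simp: mean_at_def mean_exit_def prob_space)
  qed
qed

lemma prob_U_less:
  assumes y: "y \<in> I" and p: "p \<in> {0..1}"
  shows "measure (P y) {w \<in> space M. U w < p} = p"
proof -
  have "measure (P y) {w \<in> space M. U w < p} = measure (distr (P y) borel U) {..<p}"
    using U_measurable by (subst measure_distr) (auto simp: measurable_P[OF y] space_P[OF y] intro!: arg_cong[where f = "measure (P y)"])
  also have "\<dots> = measure lborel ({0..1} \<inter> {..<p}) / measure lborel {0..1::real}"
    unfolding U_uniform[OF y] by (subst measure_uniform_measure) auto
  also have "{0..1} \<inter> {..<p} = {0..<p}" using p by auto
  finally show ?thesis using p by simp
qed

text \<open>Exit values are measurable with respect to the path alone, so the choice made by
  \<open>U\<close> is independent of them and the means combine with weights \<open>p\<close> and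
  \<open>1 - p\<close>.\<close>

lemma mean_at_mixed_time:
  assumes x: "x \<in> I" and p: "p \<in> {0..1}"
    and 1: "\<alpha> \<le> a1" "a1 \<le> x" "x \<le> b1" "b1 \<le> \<beta>" and 2: "\<alpha> \<le> a2" "a2 \<le> x" "x \<le> b2" "b2 \<le> \<beta>"
  shows "mean_at \<alpha> \<beta> P X x (mixed_time U p (exit_time X a1 b1) (exit_time X a2 b2)) =
    p * mean_exit S x a1 b1 + (1 - p) * mean_exit S x a2 b2"
proof -
  interpret prob_space "P x" by (rule prob_P) fact
  let ?V = "\<lambda>a b. stopped (exit_time X a b)"
  have [measurable]: "?V a b \<in> borel_measurable M" for a b
    by (rule value_at_measurable_M[OF exit_time_randomized])
  have [measurable]: "U \<in> borel_measurable M" by (rule U_measurable)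
  have nat: "?V a b \<in> borel_measurable (natural \<top>)" for a b
    by (intro measurable_value_at)
      (auto intro: measurable_natural_filtration entry_measurable_natural
        simp: space_natural_filtration exit_time_eq_entry closed_Compl)
  have bnd: "AE w in P x. \<bar>?V a b w\<bar> \<le> \<bar>\<alpha>\<bar> + \<bar>\<beta>\<bar>" for a b
    using value_at_AE[OF x, of "exit_time X a b"] by eventually_elim auto
  have int: "integrable (P x) (?V a b)" for a b
    using bnd by (intro integrable_bounded_P[OF x]) auto
  have int': "integrable (P x) (\<lambda>w. indicator B (U w) * ?V a b w)" if "B \<in> sets borel" for a b B
  proof (rule integrable_bounded_P[OF x])
    show "AE w in P x. \<bar>indicator B (U w) * ?V a b w\<bar> \<le> \<bar>\<alpha>\<bar> + \<bar>\<beta>\<bar>"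
      using bnd[of a b] by eventually_elim (auto split: split_indicator)
  qed (use that in measurable)
  have ind: "(\<integral>w. indicator B (U w) * ?V a b w \<partial>P x) = measure (P x) {w \<in> space M. U w \<in> B} * mean_at \<alpha> \<beta> P X x (exit_time X a b)"
    if "B \<in> sets borel" for a b B
    unfolding mean_at_def by (rule U_independent[OF x that nat int])
  have ge: "measure (P x) {w \<in> space M. U w \<in> {p..}} = 1 - p"
  proof -
    have "{w \<in> space M. U w \<in> {p..}} = space (P x) - {w \<in> space M. U w < p}"
      by (auto simp: space_P[OF x])
    then show ?thesis
      using prob_U_less[OF x p] by (simp add: prob_compl sets_P[OF x])
  qed
  have "mean_at \<alpha> \<beta> P X x (mixed_time U p (exit_time X a1 b1) (exit_time X a2 b2)) =
      (\<integral>w. indicator {..<p} (U w) * ?V a1 b1 w + indicator {p..} (U w) * ?V a2 b2 w \<partial>P x)"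
    unfolding mean_at_def
    by (intro Bochner_Integration.integral_cong) (auto simp: value_at_def mixed_time_def)
  also have "\<dots> = (\<integral>w. indicator {..<p} (U w) * ?V a1 b1 w \<partial>P x) + (\<integral>w. indicator {p..} (U w) * ?V a2 b2 w \<partial>P x)"
    by (intro Bochner_Integration.integral_add int') auto
  also have "\<dots> = p * mean_exit S x a1 b1 + (1 - p) * mean_exit S x a2 b2"
    using prob_U_less[OF x p] ge by (simp add: ind mean_at_exit_time[OF x 1] mean_at_exit_time[OF x 2])
  finally show ?thesis .
qed

text \<open>The second moment about \<open>c\<close> is at least the variance, and below the majorant its expectation
  is computed by optional stopping.\<close>

lemma variance_at_le:
  assumes x: "x \<in> I" and maj: "majorant \<alpha> \<beta> S x c v l"
    and \<tau>: "\<tau> \<in> \<T>"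
  shows "variance_at \<alpha> \<beta> P X x \<tau> \<le> v"
proof -
  interpret prob_space "P x" by (rule prob_P) fact
  let ?V = "stopped \<tau>"
  have V [measurable]: "?V \<in> borel_measurable M" by (rule value_at_measurable_M[OF \<tau>])
  have bnd: "AE w in P x. \<bar>?V w\<bar> \<le> \<bar>\<alpha>\<bar> + \<bar>\<beta>\<bar>"
    using value_at_AE[OF x, of \<tau>] by eventually_elim auto
  have int: "integrable (P x) ?V" using bnd by (intro integrable_bounded_P[OF x]) auto
  have int2: "integrable (P x) (\<lambda>w. (?V w)\<^sup>2)"
  proof (rule integrable_bounded_P[OF x])
    show "AE w in P x. \<bar>(?V w)\<^sup>2\<bar> \<le> (\<bar>\<alpha>\<bar> + \<bar>\<beta>\<bar>)\<^sup>2"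
      using bnd by eventually_elim (auto simp: abs_le_square_iff[symmetric])
  qed measurable
  have intS: "integrable (P x) (\<lambda>w. scale_ext (?V w))"
    using scale_ext_bounds by (intro integrable_bounded_P[OF x, where K = "S \<beta>"]) auto
  define e where "e = mean_at \<alpha> \<beta> P X x \<tau>"
  have moment: "(\<integral>w. (?V w - d)\<^sup>2 \<partial>P x) = (\<integral>w. (?V w)\<^sup>2 \<partial>P x) - 2 * d * e + d\<^sup>2" for d
    using int int2 by (simp add: power2_diff e_def mean_at_def prob_space mult_ac)
  have "variance_at \<alpha> \<beta> P X x \<tau> \<le> (\<integral>w. (?V w - c)\<^sup>2 \<partial>P x)"
    unfolding variance_at_def moment e_def[symmetric]
    using zero_le_power2[of "c - e"] by (simp add: power2_eq_square algebra_simps)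
  also have "\<dots> \<le> (\<integral>w. v + l * (scale_ext (?V w) - S x) \<partial>P x)"
  proof (rule integral_mono_AE)
    show "AE w in P x. (?V w - c)\<^sup>2 \<le> v + l * (scale_ext (?V w) - S x)"
      using value_at_AE[OF x, of \<tau>]
    proof eventually_elim
      case (elim w)
      then show ?case using maj scale_ext_eq[OF elim] unfolding majorant_def by auto
    qed
  qed (use int int2 intS in \<open>auto simp: power2_diff\<close>)
  also have "\<dots> = v" using intS optional_stopping[OF x \<tau>] by (simp add: prob_space)
  finally show ?thesis .
qed

text \<open>Both inequalities of the upper bound become equalities: the mean is \<open>c\<close>, so
  the second moment about \<open>c\<close> is the variance, and almost surely the stopped value is a
  contact point.\<close>

lemma optimal_mixture_optimal_time:
  assumes x: "x \<in> I" and opt: "optimal_mixture \<alpha> \<beta> S x v p a1 b1 a2 b2"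
  shows "optimal_time \<alpha> \<beta> M P X U x (mixed_time U p (exit_time X a1 b1) (exit_time X a2 b2))"
    "optimal_variance \<alpha> \<beta> M P X U x = ereal v"
proof -
  interpret prob_space "P x" by (rule prob_P) fact
  obtain c l where *: "p \<in> {0..1}" "a1 \<in> {\<alpha>..x}" "b1 \<in> {x..\<beta>}" "a2 \<in> {\<alpha>..x}" "b2 \<in> {x..\<beta>}"
      and maj: "majorant \<alpha> \<beta> S x c v l" and con: "\<forall>z\<in>{a1, b1, a2, b2}. contact S x c v l z"
      and c: "p * mean_exit S x a1 b1 + (1 - p) * mean_exit S x a2 b2 = c"
    using opt unfolding optimal_mixture_def by blast
  let ?\<tau> = "mixed_time U p (exit_time X a1 b1) (exit_time X a2 b2)"
  let ?V = "stopped ?\<tau>"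
  have \<tau>: "?\<tau> \<in> \<T>"
    by (intro mixed_time_randomized exit_time_randomized)
  have V [measurable]: "?V \<in> borel_measurable M" by (rule value_at_measurable_M[OF \<tau>])
  have mean: "mean_at \<alpha> \<beta> P X x ?\<tau> = c"
    using mean_at_mixed_time[OF x *(1)] * c by auto
  have intS: "integrable (P x) (\<lambda>w. scale_ext (?V w))"
    using scale_ext_bounds by (intro integrable_bounded_P[OF x, where K = "S \<beta>"]) auto
  have ab: "\<alpha> \<le> a1" "a1 \<le> x" "x \<le> b1" "b1 \<le> \<beta>" "\<alpha> \<le> a2" "a2 \<le> x" "x \<le> b2" "b2 \<le> \<beta>"
    using * by auto
  have "variance_at \<alpha> \<beta> P X x ?\<tau> = (\<integral>w. v + l * (scale_ext (?V w) - S x) \<partial>P x)"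
    unfolding variance_at_def mean
  proof (rule integral_cong_AE)
    show "AE w in P x. (?V w - c)\<^sup>2 = v + l * (scale_ext (?V w) - S x)"
      using exit_value_AE[OF x ab(1-4)] exit_value_AE[OF x ab(5-8)]
    proof eventually_elim
      case (elim w)
      have "?V w = (if U w < p then stopped (exit_time X a1 b1) w else stopped (exit_time X a2 b2) w)"
        by (simp add: value_at_def mixed_time_def)
      then have "?V w \<in> {a1, b1, a2, b2}" using elim by auto
      moreover from this have "?V w \<in> {\<alpha>..\<beta>}" using ab by auto
      ultimately show ?case using con scale_ext_eq[of "?V w"] unfolding contact_def by metis
    qed
  qed (auto simp: measurable_P[OF x])
  also have "\<dots> = v" using intS optional_stopping[OF x \<tau>] by (simp add: prob_space)
  finally have var: "variance_at \<alpha> \<beta> P X x ?\<tau> = v" .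
  show V_eq: "optimal_variance \<alpha> \<beta> M P X U x = ereal v"
    unfolding optimal_variance_def
  proof (rule antisym)
    show "(SUP \<tau>\<in>\<T>. ereal (variance_at \<alpha> \<beta> P X x \<tau>)) \<le> ereal v"
      using variance_at_le[OF x maj] by (intro SUP_least) auto
    show "ereal v \<le> (SUP \<tau>\<in>\<T>. ereal (variance_at \<alpha> \<beta> P X x \<tau>))"
      using \<tau> var by (intro SUP_upper2) auto
  qed
  show "optimal_time \<alpha> \<beta> M P X U x ?\<tau>"
    unfolding optimal_time_def V_eq using \<tau> var by simp
qed

end

section \<open>From conditions on means to conditions on the scale\<close>

lemma linear_diffusion_interval:
  assumes "linear_diffusion \<alpha> \<beta> M P X S m" "randomization \<alpha> \<beta> M P X U" "\<alpha> < \<beta>"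
    "S \<alpha> = 0" "(S \<longlongrightarrow> S \<alpha>) (at_right \<alpha>)" "(S \<longlongrightarrow> S \<beta>) (at_left \<beta>)"
  shows "randomized_diffusion \<alpha> \<beta> M P X S m U"
  using assms
  by (simp add: randomized_diffusion_def attractive_diffusion_def attractive_diffusion_axioms_def)

context randomized_diffusion
begin

text \<open>Since \<open>S \<alpha> = 0\<close>, the exit mean is
  \<open>\<alpha> + (\<beta> - \<alpha>) * (S x / S \<beta>)\<close>, which passes the midpoint
  together with \<open>S x / S \<beta>\<close> passing 1/2.\<close>

lemma mean_at_exit_interval_le_iff:
  assumes x: "x \<in> I"
  shows "mean_at \<alpha> \<beta> P X x (exit_time X \<alpha> \<beta>) \<le> (\<beta> + \<alpha>) / 2 \<longleftrightarrow> S x \<le> S \<beta> / 2"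
proof -
  have pos: "0 < S \<beta>" using scale_pos \<alpha>_less_\<beta> by simp
  have "mean_at \<alpha> \<beta> P X x (exit_time X \<alpha> \<beta>) = mean_exit S x \<alpha> \<beta>"
    using x by (intro mean_at_exit_time) auto
  also have "\<dots> = \<alpha> + (\<beta> - \<alpha>) * (S x / S \<beta>)"
    using x pos by (simp add: mean_exit_def S_\<alpha> field_simps)
  also have "\<dots> \<le> (\<beta> + \<alpha>) / 2 \<longleftrightarrow> (\<beta> - \<alpha>) * (S x / S \<beta>) \<le> (\<beta> - \<alpha>) * (1 / 2)"
    by (simp add: field_simps)
  also have "\<dots> \<longleftrightarrow> S x / S \<beta> \<le> 1 / 2"
    using \<alpha>_less_\<beta> by (intro mult_le_cancel_left_pos) simp
  also have "\<dots> \<longleftrightarrow> S x \<le> S \<beta> / 2" using pos by (simp add: divide_le_eq)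
  finally show ?thesis .
qed

end

lemma Inf_Sup_bounds:
  fixes A :: "real set"
  assumes sub: "A \<subseteq> {a..b}" and ne: "A \<noteq> {}"
  shows "a \<le> Inf A" "Inf A \<le> Sup A" "Sup A \<le> b"
proof -
  obtain u where u: "u \<in> A" using ne by blast
  have "Inf A \<le> u" using u bdd_below_mono[OF bdd_below_Icc sub] by (rule cInf_lower)
  also have "u \<le> Sup A" using u bdd_above_mono[OF bdd_above_Icc sub] by (rule cSup_upper)
  finally show "Inf A \<le> Sup A" .
  show "a \<le> Inf A" using ne sub by (intro cInf_greatest) auto
  show "Sup A \<le> b" using ne sub by (intro cSup_least) auto
qed

lemma mixed_time_same: "mixed_time U p \<tau> \<tau> = \<tau>"
  by (simp add: mixed_time_def fun_eq_iff)

theorem theorem3p5: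
  fixes \<alpha> \<beta> x :: real and M :: "'a measure" and P :: "real \<Rightarrow> 'a measure"
    and X :: "real \<Rightarrow> 'a \<Rightarrow> real" and U :: "'a \<Rightarrow> real"
    and S :: "real \<Rightarrow> real" and m :: "real measure"
  assumes diffusion: "linear_diffusion \<alpha> \<beta> M P X S m"
    and randomization: "randomization \<alpha> \<beta> M P X U"
    and x: "x \<in> {\<alpha><..<\<beta>}"
    and attractive_left: "S \<alpha> = 0" "(S \<longlongrightarrow> S \<alpha>) (at_right \<alpha>)"
    and attractive_right: "(S \<longlongrightarrow> S \<beta>) (at_left \<beta>)"
  shows
    "optimal_variance \<alpha> \<beta> M P X U x < \<infinity> \<and>
     (mean_at \<alpha> \<beta> P X x (exit_time X \<alpha> \<beta>) \<le> (\<beta> + \<alpha>) / 2 \<longrightarrow>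
       (\<exists>a\<in>{\<alpha>..x}. \<exists>b\<in>{x..\<beta>}. \<exists>z\<in>{x..\<beta>}. \<exists>p\<in>{0..1}.
         optimal_time \<alpha> \<beta> M P X U x (mixed_time U p (exit_time X a b) (exit_time X \<alpha> z))) \<and>
       (left_condition \<alpha> \<beta> P X S \<longrightarrow>
         (\<exists>z\<^sub>1\<in>{x..\<beta>}. \<exists>z\<^sub>2\<in>{x..\<beta>}. \<exists>p\<in>{0..1}.
           optimal_time \<alpha> \<beta> M P X U x (mixed_time U p (exit_time X \<alpha> z\<^sub>1) (exit_time X \<alpha> z\<^sub>2)))) \<and>
       ((\<forall>z\<in>{\<alpha><..<\<beta>}. S differentiable (at z)) \<and>
        mono_on {\<alpha><..<\<beta>} (\<lambda>z. deriv S z / S z * (z - \<alpha>)) \<longrightarrow>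
         (\<exists>z. (left_root \<alpha> \<beta> S x z \<and> (\<forall>w. left_root \<alpha> \<beta> S x w \<longrightarrow> w = z) \<or>
               (\<nexists>w. left_root \<alpha> \<beta> S x w) \<and> z = \<beta>) \<and>
              optimal_time \<alpha> \<beta> M P X U x (exit_time X \<alpha> z) \<and>
              optimal_variance \<alpha> \<beta> M P X U x =
                ereal ((z - \<alpha>)\<^sup>2 * (S x / S z) * (1 - S x / S z))))) \<and>
     (mean_at \<alpha> \<beta> P X x (exit_time X \<alpha> \<beta>) > (\<beta> + \<alpha>) / 2 \<longrightarrow>
       (\<exists>a\<in>{\<alpha>..x}. \<exists>y\<in>{\<alpha>..x}. \<exists>b\<in>{x..\<beta>}. \<exists>p\<in>{0..1}.
         optimal_time \<alpha> \<beta> M P X U x (mixed_time U p (exit_time X y \<beta>) (exit_time X a b))) \<and>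
       (right_condition \<alpha> \<beta> P X S \<longrightarrow>
         (\<exists>y\<^sub>1\<in>{\<alpha>..x}. \<exists>y\<^sub>2\<in>{\<alpha>..x}. \<exists>p\<in>{0..1}.
           optimal_time \<alpha> \<beta> M P X U x (mixed_time U p (exit_time X y\<^sub>1 \<beta>) (exit_time X y\<^sub>2 \<beta>)))) \<and>
       ((\<forall>y\<in>{\<alpha><..<\<beta>}. S differentiable (at y)) \<and>
        antimono_on {\<alpha><..<\<beta>} (\<lambda>y. deriv S y / (S \<beta> - S y) * (\<beta> - y)) \<longrightarrow>
         (\<exists>y. (right_root \<alpha> \<beta> S x y \<and> (\<forall>w. right_root \<alpha> \<beta> S x w \<longrightarrow> w = y) \<or>
               (\<nexists>w. right_root \<alpha> \<beta> S x w) \<and> y = \<alpha>) \<and>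
              optimal_time \<alpha> \<beta> M P X U x (exit_time X y \<beta>) \<and>
              optimal_variance \<alpha> \<beta> M P X U x =
                ereal ((\<beta> - y)\<^sup>2 * ((S \<beta> - S x) / (S \<beta> - S y)) *
                       ((S x - S y) / (S \<beta> - S y))))))"
proof -
  interpret randomized_diffusion \<alpha> \<beta> M P X S m U
    using linear_diffusion_interval[OF diffusion randomization _ attractive_left attractive_right] x by auto
  interpret scale \<alpha> \<beta> S x by (rule scale_at[OF x])
  note opt = optimal_mixture_optimal_time[OF x]
  \<comment> \<open>A single interval arises as the degenerate mixture of two equal ones.\<close>
  have single: "optimal_time \<alpha> \<beta> M P X U x (exit_time X a b)"
    if "optimal_mixture \<alpha> \<beta> S x v 1 a b a b" for v a b
    using opt(1)[OF that] by (simp add: mixed_time_same)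
  note exit_iff = mean_at_exit_interval_le_iff[OF x]
  have exit_iff': "(\<beta> + \<alpha>) / 2 < mean_at \<alpha> \<beta> P X x (exit_time X \<alpha> \<beta>) \<longleftrightarrow> S \<beta> / 2 < S x"
    using exit_iff by (meson not_le)
  have finite: "optimal_variance \<alpha> \<beta> M P X U x < \<infinity>"
  proof (cases "S x \<le> S \<beta> / 2")
    case True
    then show ?thesis using optimal_left_mixture opt(2) by fastforce
  next
    case False
    then show ?thesis using optimal_right_mixture opt(2) by fastforce
  qed
  show ?thesis
    unfolding exit_iff exit_iff'
  proof (intro conjI impI, goal_cases)
    case 1
    show ?case by (rule finite)
  next
    case Sx: 2
    obtain v p a b z where m: "optimal_mixture \<alpha> \<beta> S x v p a b \<alpha> z"
      using optimal_left_mixture[OF Sx] by blast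
    then have "a \<in> {\<alpha>..x}" "b \<in> {x..\<beta>}" "z \<in> {x..\<beta>}" "p \<in> {0..1}"
      by (auto simp: optimal_mixture_def)
    then show ?case using opt(1)[OF m] by blast
  next
    case (3)
    note Sx = 3(1) and cond = 3(2)
    \<comment> \<open>The mean under the law started at the infimum is converted only for an
      interior starting point, where optional stopping applies; the deterministic lemma asks for
      exactly this case.\<close>
    have "c < mean_exit S (Inf (Z_set \<alpha> \<beta> S c)) \<alpha> (Sup (Z_set \<alpha> \<beta> S c))"
      if "c \<in> {\<alpha><..<\<beta>}" "\<exists>u\<in>Z_set \<alpha> \<beta> S c. \<exists>v\<in>Z_set \<alpha> \<beta> S c. u \<noteq> v" "Inf (Z_set \<alpha> \<beta> S c) \<in> {\<alpha><..<\<beta>}" for c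
    proof -
      have "Z_set \<alpha> \<beta> S c \<subseteq> {\<alpha>..\<beta>}" "Z_set \<alpha> \<beta> S c \<noteq> {}"
        using that(2) by (auto simp: Z_set_def is_arg_max_def)
      note bounds = Inf_Sup_bounds[OF this]
      have "c < mean_at \<alpha> \<beta> P X (Inf (Z_set \<alpha> \<beta> S c)) (exit_time X \<alpha> (Sup (Z_set \<alpha> \<beta> S c)))"
        using cond that(1,2) unfolding left_condition_def by blast
      then show ?thesis
        using bounds by (subst (asm) mean_at_exit_time[OF that(3)]) auto
    qed
    then obtain v p z1 z2 where m: "optimal_mixture \<alpha> \<beta> S x v p \<alpha> z1 \<alpha> z2"
      using optimal_left_mixture_one_sided[OF Sx] by blast
    then have "z1 \<in> {x..\<beta>}" "z2 \<in> {x..\<beta>}" "p \<in> {0..1}"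
      by (auto simp: optimal_mixture_def)
    then show ?case using opt(1)[OF m] by blast
  next
    case 4
    then show ?case
      by - (rule ex_forward[OF optimal_left_interval], assumption, blast, blast, elim conjE, intro conjI,
        (assumption | (rule single, assumption) | (rule opt(2), assumption))+)
  next
    case Sx: 5
    obtain v p y a b where m: "optimal_mixture \<alpha> \<beta> S x v p y \<beta> a b"
      using optimal_right_mixture[OF Sx] by blast
    then have "a \<in> {\<alpha>..x}" "y \<in> {\<alpha>..x}" "b \<in> {x..\<beta>}" "p \<in> {0..1}"
      by (auto simp: optimal_mixture_def)
    then show ?case using opt(1)[OF m] by blast
  next
    case (6)
    note Sx = 6(1) and cond = 6(2)
    have "mean_exit S (Sup (Y_set \<alpha> \<beta> S c)) (Inf (Y_set \<alpha> \<beta> S c)) \<beta> < c"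
      if "c \<in> {\<alpha><..<\<beta>}" "\<exists>u\<in>Y_set \<alpha> \<beta> S c. \<exists>v\<in>Y_set \<alpha> \<beta> S c. u \<noteq> v" "Sup (Y_set \<alpha> \<beta> S c) \<in> {\<alpha><..<\<beta>}" for c
    proof -
      have "Y_set \<alpha> \<beta> S c \<subseteq> {\<alpha>..\<beta>}" "Y_set \<alpha> \<beta> S c \<noteq> {}"
        using that(2) by (auto simp: Y_set_def is_arg_max_def)
      note bounds = Inf_Sup_bounds[OF this]
      have "mean_at \<alpha> \<beta> P X (Sup (Y_set \<alpha> \<beta> S c)) (exit_time X (Inf (Y_set \<alpha> \<beta> S c)) \<beta>) < c"
        using cond that(1,2) unfolding right_condition_def by blast
      then show ?thesis
        using bounds by (subst (asm) mean_at_exit_time[OF that(3)]) auto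
    qed
    then obtain v p y1 y2 where m: "optimal_mixture \<alpha> \<beta> S x v p y1 \<beta> y2 \<beta>"
      using optimal_right_mixture_one_sided[OF Sx] by blast
    then have "y1 \<in> {\<alpha>..x}" "y2 \<in> {\<alpha>..x}" "p \<in> {0..1}"
      by (auto simp: optimal_mixture_def)
    then show ?case using opt(1)[OF m] by blast
  next
    case 7
    then show ?case
      by - (rule ex_forward[OF optimal_right_interval], assumption, blast, blast, elim conjE, intro conjI,
        (assumption | (rule single, assumption) | (rule opt(2), assumption))+)
  qed
qed

end
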